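(* Let $p,n$ be positive integers and let $X\sim N_p(\theta,\eta^{-1}I_p)$ and $S\sim \eta^{-1}\chi^2_n$ be independent, with $\theta\in\mathbb{R}^p$ and $\eta=1/\sigma^2\in(0,\infty)$ both unknown. Consider estimation of $\theta$ under the loss $L(d;\{\theta,\sigma^2\})=\|d-\theta\|^2/\sigma^2=\eta\|d-\theta\|^2$. Let $\delta_\pi(X,S)$ be the generalized Bayes estimator of $\theta$ with respect to the (improper) hierarchical prior $\pi(\theta,\eta)$ given by $$\theta\mid\{\eta,\lambda\}\sim N_p\Big(0,\frac1\eta\frac{1-\lambda}{\lambda}I_p\Big),\quad \lambda\sim\frac{\lambda^a(1-\lambda)^b}{B(a+1,b+1)}\ (0<\lambda<1),\quad \eta\sim\frac1\eta\ (0<\eta<\infty).$$ If $-1<a<n/2$ and $b>-1/2$, then $\delta_\pi$ is admissible (among all estimators of $\theta$).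
   Context: An estimator is a measurable map $\delta:\mathbb{R}^p\times(0,\infty)\to\mathbb{R}^p$ with risk $R(\theta,\eta,\delta)=E_{\theta,\eta}[\eta\|\delta(X,S)-\theta\|^2]$. $\delta$ is admissible if there is no estimator $\delta'$ with $R(\theta,\eta,\delta')\le R(\theta,\eta,\delta)$ for all $(\theta,\eta)\in\mathbb{R}^p\times(0,\infty)$ and strict inequality for some $(\theta,\eta)$. The prior density is explicitly $$\pi(\theta,\eta)=\eta^{-1}\eta^{p/2}\int_0^1\frac{1}{(2\pi)^{p/2}}\Big(\frac{\lambda}{1-\lambda}\Big)^{p/2}\exp\Big(-\frac{\lambda}{1-\lambda}\frac{\eta\|\theta\|^2}{2}\Big)\frac{\lambda^a(1-\lambda)^b}{B(a+1,b+1)}\,d\lambda,$$ where $B$ is the Beta function. The generalized Bayes estimator is $$\delta_\pi(x,s)=\frac{\int_{\mathbb{R}^p}\int_0^\infty\theta\,\eta f_x(x\mid\theta,\eta)f_s(s\mid\eta)\pi(\theta,\eta)\,d\eta\,d\theta}{\int_{\mathbb{R}^p}\int_0^\infty\eta f_x(x\mid\theta,\eta)f_s(s\mid\eta)\pi(\theta,\eta)\,d\eta\,d\theta},$$ where $f_x(x\mid\theta,\eta)=\frac{\eta^{p/2}}{(2\pi)^{p/2}}\exp(-\frac\eta2\|x-\theta\|^2)$ and $f_s(s\mid\eta)=\frac{\eta^{n/2}}{\Gamma(n/2)2^{n/2}}s^{n/2-1}\exp(-\frac{\eta s}{2})$ are the densities of $X$ and $S$. *)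

theory Defs
  imports "HOL-Probability.Probability"
begin

text \<open>
  The dimension \<open>p\<close> is \<open>CARD('p)\<close>, and \<open>\<eta> > 0\<close> is the precision \<open>1 / \<sigma>\<^sup>2\<close>. \<open>fx\<close> and \<open>fs\<close> are the
  densities of \<open>X \<sim> N(\<theta>, I / \<eta>)\<close> on \<open>\<real>\<^sup>p\<close> and of \<open>S \<sim> \<chi>\<^sup>2\<^sub>n / \<eta>\<close> on \<open>(0,\<infinity>)\<close>.
\<close>

definition fx :: "real ^ 'p \<Rightarrow> real \<Rightarrow> real ^ 'p \<Rightarrow> real" where
  "fx \<theta> \<eta> x = \<eta> powr (CARD('p) / 2) / (2 * pi) powr (CARD('p) / 2)
     * exp (- (\<eta> / 2) * (norm (x - \<theta>))\<^sup>2)"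

definition fs :: "nat \<Rightarrow> real \<Rightarrow> real \<Rightarrow> real" where
  "fs n \<eta> s = \<eta> powr (n / 2) / (Gamma (n / 2) * 2 powr (n / 2))
     * s powr (n / 2 - 1) * exp (- (\<eta> * s / 2))"

text \<open>Independence of \<open>X\<close> and \<open>S\<close> is expressed by taking the product of their laws.\<close>

definition sampling_law :: "nat \<Rightarrow> real ^ 'p \<Rightarrow> real \<Rightarrow> ((real ^ 'p) \<times> real) measure" where
  "sampling_law n \<theta> \<eta> =
     density lborel (\<lambda>x. ennreal (fx \<theta> \<eta> x))
       \<Otimes>\<^sub>M density (restrict_space lborel {0<..}) (\<lambda>s. ennreal (fs n \<eta> s))"

text \<open>Values of an estimator at points with \<open>s \<le> 0\<close> are irrelevant, to measurability as well as to
  the risk.\<close>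

definition estimator :: "((real ^ 'p) \<times> real \<Rightarrow> real ^ 'p) \<Rightarrow> bool" where
  "estimator \<delta> \<longleftrightarrow> \<delta> \<in> borel \<Otimes>\<^sub>M restrict_space borel {0<..} \<rightarrow>\<^sub>M borel"

definition loss :: "real ^ 'p \<Rightarrow> real \<Rightarrow> real ^ 'p \<Rightarrow> real" where
  "loss \<theta> \<eta> d = \<eta> * (norm (d - \<theta>))\<^sup>2"

text \<open>The risk of an arbitrary estimator may be infinite.\<close>

definition risk ::
  "nat \<Rightarrow> real ^ 'p \<Rightarrow> real \<Rightarrow> ((real ^ 'p) \<times> real \<Rightarrow> real ^ 'p) \<Rightarrow> ennreal" where
  "risk n \<theta> \<eta> \<delta> = (\<integral>\<^sup>+ z. ennreal (loss \<theta> \<eta> (\<delta> z)) \<partial>sampling_law n \<theta> \<eta>)"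

definition dominates ::
  "nat \<Rightarrow> ((real ^ 'p) \<times> real \<Rightarrow> real ^ 'p) \<Rightarrow> ((real ^ 'p) \<times> real \<Rightarrow> real ^ 'p) \<Rightarrow> bool" where
  "dominates n \<delta>' \<delta> \<longleftrightarrow>
     (\<forall>\<theta>. \<forall>\<eta>>0. risk n \<theta> \<eta> \<delta>' \<le> risk n \<theta> \<eta> \<delta>) \<and>
     (\<exists>\<theta>. \<exists>\<eta>>0. risk n \<theta> \<eta> \<delta>' < risk n \<theta> \<eta> \<delta>)"

definition admissible :: "nat \<Rightarrow> ((real ^ 'p) \<times> real \<Rightarrow> real ^ 'p) \<Rightarrow> bool" where
  "admissible n \<delta> \<longleftrightarrow> estimator \<delta> \<and> \<not> (\<exists>\<delta>'. estimator \<delta>' \<and> dominates n \<delta>' \<delta>)"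

definition gen_bayes ::
  "nat \<Rightarrow> (real ^ 'p \<Rightarrow> real \<Rightarrow> real) \<Rightarrow> (real ^ 'p) \<times> real \<Rightarrow> real ^ 'p" where
  "gen_bayes n \<pi> = (\<lambda>(x, s).
     (LINT \<theta>|lborel. (LINT \<eta>:{0<..}|lborel. (\<eta> * fx \<theta> \<eta> x * fs n \<eta> s * \<pi> \<theta> \<eta>) *\<^sub>R \<theta>))
     /\<^sub>R (LINT \<theta>|lborel. (LINT \<eta>:{0<..}|lborel. \<eta> * fx \<theta> \<eta> x * fs n \<eta> s * \<pi> \<theta> \<eta>)))"

definition beta_density :: "real \<Rightarrow> real \<Rightarrow> real \<Rightarrow> real" where
  "beta_density a b l = l powr a * (1 - l) powr b / Beta (a + 1) (b + 1)"

text \<open>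
  At \<open>\<theta> = 0\<close> the integral over the mixing variable \<open>l\<close> diverges if \<open>b \<le> p / 2 - 1\<close>,
  and the library's integral then has value \<open>0\<close>; this affects only a null set of \<open>\<theta>\<close>, hence not \<open>gen_bayes\<close>.
\<close>

definition prior :: "real \<Rightarrow> real \<Rightarrow> real ^ 'p \<Rightarrow> real \<Rightarrow> real" where
  "prior a b \<theta> \<eta> = 1 / \<eta> * \<eta> powr (CARD('p) / 2) *
     (LINT l:{0<..<1}|lborel.
        1 / (2 * pi) powr (CARD('p) / 2) * (l / (1 - l)) powr (CARD('p) / 2)
        * exp (- (l / (1 - l)) * (\<eta> * (norm \<theta>)\<^sup>2 / 2)) * beta_density a b l)"

text \<open>The prior is the hierarchical one: \<open>1 / \<eta>\<close> times the mixture over \<open>l\<close> (the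
  \<open>Beta(a+1,b+1)\<close> variable) of normal densities with mean \<open>0\<close> and precision \<open>\<eta> l / (1 - l)\<close>.\<close>

lemma prior_hierarchical:
  fixes \<theta> :: "real ^ 'p"
  shows "prior a b \<theta> \<eta> =
    1 / \<eta> * (LINT l:{0<..<1}|lborel. fx 0 (\<eta> * (l / (1 - l))) \<theta> * beta_density a b l)"
proof -
  have "(LINT l:{0<..<1}|lborel. fx 0 (\<eta> * (l / (1 - l))) \<theta> * beta_density a b l) =
    (LINT l:{0<..<1}|lborel. \<eta> powr (CARD('p) / 2) *
       (1 / (2 * pi) powr (CARD('p) / 2) * (l / (1 - l)) powr (CARD('p) / 2)
        * exp (- (l / (1 - l)) * (\<eta> * (norm \<theta>)\<^sup>2 / 2)) * beta_density a b l))"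
  proof (intro set_lebesgue_integral_cong allI impI)
    fix l :: real
    have "(\<eta> * (l / (1 - l))) powr (CARD('p) / 2)
        = \<eta> powr (CARD('p) / 2) * (l / (1 - l)) powr (CARD('p) / 2)"
      by (rule powr_mult)
    then show "fx 0 (\<eta> * (l / (1 - l))) \<theta> * beta_density a b l = \<eta> powr (CARD('p) / 2) *
       (1 / (2 * pi) powr (CARD('p) / 2) * (l / (1 - l)) powr (CARD('p) / 2)
        * exp (- (l / (1 - l)) * (\<eta> * (norm \<theta>)\<^sup>2 / 2)) * beta_density a b l)"
      by (simp add: fx_def mult_ac)
  qed simp
  then show ?thesis
    by (simp add: prior_def)
qed

lemma fx_eq_prod_normal_density:
  fixes \<theta> x :: "real ^ 'p"
  assumes "\<eta> > 0"
  shows "fx \<theta> \<eta> x = (\<Prod>i\<in>UNIV. normal_density (\<theta> $ i) (1 / sqrt \<eta>) (x $ i))"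
proof -
  have "normal_density m (1 / sqrt \<eta>) y = sqrt \<eta> / sqrt (2 * pi) * exp (- (\<eta> / 2) * (y - m)\<^sup>2)"
    for m y
    using assms by (simp add: normal_density_def power_divide real_sqrt_divide mult_ac)
  then have "(\<Prod>i\<in>UNIV. normal_density (\<theta> $ i) (1 / sqrt \<eta>) (x $ i)) =
      (\<Prod>i\<in>(UNIV::'p set). sqrt \<eta> / sqrt (2 * pi)) *
      exp (\<Sum>i\<in>UNIV. - (\<eta> / 2) * (x $ i - \<theta> $ i)\<^sup>2)"
    by (simp only: prod.distrib exp_sum finite)
  also have "(\<Sum>i\<in>UNIV. - (\<eta> / 2) * (x $ i - \<theta> $ i)\<^sup>2) = - (\<eta> / 2) * (norm (x - \<theta>))\<^sup>2"
    by (simp add: norm_vec_def L2_set_def sum_nonneg sum_distrib_left)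
  also have "(\<Prod>i\<in>(UNIV::'p set). sqrt \<eta> / sqrt (2 * pi)) =
      \<eta> powr (CARD('p) / 2) / (2 * pi) powr (CARD('p) / 2)"
    using assms
    by (simp add: power_divide powr_half_sqrt[symmetric] powr_powr powr_realpow[symmetric])
  finally show ?thesis
    by (simp add: fx_def)
qed

end

theory Submission
  imports Defs
begin

text \<open>
  Write \<open>l\<close> for the mixing variable of the prior. Given \<open>(\<eta>, l)\<close>, normal theory is conjugate: the marginal law
  of \<open>X\<close> is \<open>N(0, I / (\<eta> l))\<close> and the posterior of \<open>\<theta>\<close> is \<open>N((1 - l) x, (1 - l) / \<eta> I)\<close>
  (\<open>fx_mult_fx\<close>). Two things follow. The generalized Bayes estimator is \<open>(1 - L(x, s)) x\<close>, where \<open>L\<close> is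
  the posterior mean of \<open>l\<close> (\<open>gen_bayes_prior\<close>). And averaging the risk of any estimator \<open>\<delta>\<close> over
  \<open>\<theta>\<close> given \<open>(\<eta>, l)\<close> yields a variance that is the same for all estimators, plus the mean of
  \<open>|\<delta> - (1 - l) x|\<^sup>2\<close> (\<open>nn_integral_risk_conjugate_prior\<close>). After cancelling that variance, \<open>\<theta>\<close> has
  disappeared: if \<open>\<delta>\<close> is never worse than the generalized Bayes estimator, then \<open>x - \<delta>(x, s)\<close> predicts
  \<open>l x\<close> at least as well as \<open>L x\<close> does, for every value of \<open>(\<eta>, l)\<close>.

  Blyth's method shows that this forces \<open>x - \<delta> = L x\<close> almost everywhere. The only
  improper ingredient of the prior is \<open>d\<eta> / \<eta>\<close>; it is tempered by
  \<open>h\<^sub>i(\<eta>)\<^sup>2\<close> with \<open>h\<^sub>i = (i + 1) / (i + 1 + |ln \<eta>|)\<close>, which increases to \<open>1\<close>. Under the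
  posterior law of \<open>(\<eta>, l)\<close> given \<open>(x, s)\<close>, replacing \<open>L x\<close> by any other guess \<open>u\<close> changes the
  weighted risk by at least
  \<open>|u - L x|\<^sup>2 E h\<^sub>i\<^sup>2 / 2 - 2 |x|\<^sup>2 E E' (l - l')\<^sup>2 (h\<^sub>i(\<eta>) - h\<^sub>i(\<eta>'))\<^sup>2\<close>, with \<open>(\<eta>', l')\<close> an
  independent copy of \<open>(\<eta>, l)\<close> (\<open>weighted_risk_gap\<close>). So if the second term, integrated over
  \<open>(x, s)\<close>, tends to \<open>0\<close>, every competitor that is never worse agrees with \<open>L x\<close> almost everywhere
  (\<open>blyth_limit\<close>), and then has the same risk function.

  The second term tends to \<open>0\<close> by dominated convergence. Since \<open>h\<^sub>i\<close> is a function of \<open>ln \<eta>\<close> with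
  slope at most \<open>1 / (1 + |ln \<eta>|)\<close> uniformly in \<open>i\<close>, its squared increments are at most
  \<open>(1 + |ln \<eta> - ln \<eta>'|)\<^sup>2 / (1 + |ln \<eta>|)\<^sup>2\<close>. The numerator is harmless because
  the posterior of \<open>\<eta>\<close> given \<open>l\<close> is a Gamma law with scale determined by \<open>s + l |x|\<^sup>2\<close>. The remaining
  integral over \<open>(x, s)\<close> is scale invariant up to the factor \<open>1 / \<eta>\<close>, which leaves
  \<open>\<integral> d\<eta> / (\<eta> (1 + |ln \<eta>|)\<^sup>2) < \<infinity>\<close> times the mass of the Beta law
  (\<open>domination_finite\<close>).
\<close>

section \<open>Blyth's method for predicting a bounded multiple of the observation\<close>

text \<open>
  The covariance of \<open>f\<close> and \<open>h\<^sup>2\<close> equals \<open>E E' (f - f') (h\<^sup>2 - h'\<^sup>2) / 2\<close>, where the prime marks an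
  independent copy. Factoring \<open>h\<^sup>2 - h'\<^sup>2 = (h - h') (h + h')\<close> and applying \<open>2 A B \<le> A\<^sup>2 / 4 + 4 B\<^sup>2\<close>
  puts the increment of \<open>h\<close>, not of \<open>h\<^sup>2\<close>, into the error term. That is the point of
  tempering with a square: the other factor is paid for by \<open>E h\<^sup>2\<close>.
\<close>

lemma (in prob_space) covariance_bound:
  fixes f h :: "'a \<Rightarrow> real"
  assumes [measurable]: "f \<in> borel_measurable M" "h \<in> borel_measurable M"
    and f: "\<And>y. y \<in> space M \<Longrightarrow> 0 \<le> f y \<and> f y \<le> 1"
    and h: "\<And>y. y \<in> space M \<Longrightarrow> 0 \<le> h y \<and> h y \<le> 1"
    and r: "r\<^sup>2 \<le> G * X" and "0 \<le> G" and "0 \<le> X"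
  shows "2 * r * (\<integral>y. (f y - expectation f) * (h y)\<^sup>2 \<partial>M)
    \<le> G / 2 * (\<integral>y. (h y)\<^sup>2 \<partial>M)
       + 2 * X * (\<integral>y. \<integral>y'. (f y - f y')\<^sup>2 * (h y - h y')\<^sup>2 \<partial>M \<partial>M)"
proof -
  interpret P: pair_prob_space M M ..
  have int1: "integrable M g" if "g \<in> borel_measurable M" "\<And>y. y \<in> space M \<Longrightarrow> \<bar>g y\<bar> \<le> 1"
    for g :: "'a \<Rightarrow> real"
    by (rule integrable_const_bound[where B = 1]) (use that in auto)
  have int2: "integrable (M \<Otimes>\<^sub>M M) g"
    if "g \<in> borel_measurable (M \<Otimes>\<^sub>M M)" "\<And>y y'. y \<in> space M \<Longrightarrow> y' \<in> space M \<Longrightarrow> \<bar>g (y, y')\<bar> \<le> C"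
    for g :: "'a \<times> 'a \<Rightarrow> real" and C
    by (rule P.P.integrable_const_bound[where B = C]) (use that in \<open>auto simp: space_pair_measure\<close>)
  have fh1: "\<bar>f y * (h y')\<^sup>2\<bar> \<le> 1" if "y \<in> space M" "y' \<in> space M" for y y'
    using f[OF that(1)] h[OF that(2)] by (auto simp: abs_mult intro!: mult_le_one power_le_one)
  have h1: "\<bar>(h y)\<^sup>2\<bar> \<le> 1" if "y \<in> space M" for y
    using h[OF that] by (auto intro!: power_le_one)
  have d1: "\<bar>(f y - f y')\<^sup>2 * (h y - h y')\<^sup>2\<bar> \<le> 1" if "y \<in> space M" "y' \<in> space M" for y y'
    using f[OF that(1)] f[OF that(2)] h[OF that(1)] h[OF that(2)]
    by (auto simp: abs_mult abs_square_le_1[symmetric] intro!: mult_le_one)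
       (auto simp: abs_square_le_1)
  let ?D = "\<lambda>p::'a \<times> 'a. (f (fst p) - f (snd p))\<^sup>2 * (h (fst p) - h (snd p))\<^sup>2"
  let ?a = "\<lambda>p. f (fst p) * (h (fst p))\<^sup>2" and ?b = "\<lambda>p. f (snd p) * (h (fst p))\<^sup>2"
  let ?c = "\<lambda>p. f (fst p) * (h (snd p))\<^sup>2" and ?d = "\<lambda>p. f (snd p) * (h (snd p))\<^sup>2"
  have I: "integrable (M \<Otimes>\<^sub>M M) ?a" "integrable (M \<Otimes>\<^sub>M M) ?b" "integrable (M \<Otimes>\<^sub>M M) ?c"
    "integrable (M \<Otimes>\<^sub>M M) ?d" "integrable (M \<Otimes>\<^sub>M M) (\<lambda>p. (h (fst p))\<^sup>2)"
    "integrable (M \<Otimes>\<^sub>M M) (\<lambda>p. (h (snd p))\<^sup>2)" "integrable (M \<Otimes>\<^sub>M M) ?D"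
    using fh1 h1 d1 by (auto intro!: int2[of _ 1])
  have J: "integrable M (\<lambda>y. f y * (h y)\<^sup>2)" "integrable M f" "integrable M (\<lambda>y. (h y)\<^sup>2)"
    using f by (auto intro!: int1 fh1 h1)
  have Ia: "integral\<^sup>L (M \<Otimes>\<^sub>M M) ?a = (\<integral>y. f y * (h y)\<^sup>2 \<partial>M)"
    using P.integral_fst'[OF I(1)] by (simp add: prob_space)
  have Id: "integral\<^sup>L (M \<Otimes>\<^sub>M M) ?d = (\<integral>y. f y * (h y)\<^sup>2 \<partial>M)"
    using P.integral_fst'[OF I(4)] by (simp add: prob_space)
  have Ib: "integral\<^sup>L (M \<Otimes>\<^sub>M M) ?b = expectation f * (\<integral>y. (h y)\<^sup>2 \<partial>M)"
    using P.integral_fst'[OF I(2)] J by simp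
  have Ic: "integral\<^sup>L (M \<Otimes>\<^sub>M M) ?c = expectation f * (\<integral>y. (h y)\<^sup>2 \<partial>M)"
    using P.integral_fst'[OF I(3)] J by simp
  have Ih: "integral\<^sup>L (M \<Otimes>\<^sub>M M) (\<lambda>p. (h (fst p))\<^sup>2) = (\<integral>y. (h y)\<^sup>2 \<partial>M)"
    "integral\<^sup>L (M \<Otimes>\<^sub>M M) (\<lambda>p. (h (snd p))\<^sup>2) = (\<integral>y. (h y)\<^sup>2 \<partial>M)"
    using P.integral_fst'[OF I(5)] P.integral_fst'[OF I(6)] by (simp_all add: prob_space)
  have ID: "integral\<^sup>L (M \<Otimes>\<^sub>M M) ?D = (\<integral>y. \<integral>y'. (f y - f y')\<^sup>2 * (h y - h y')\<^sup>2 \<partial>M \<partial>M)"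
    using P.integral_fst'[OF I(7)] by simp
  \<comment> \<open>The pointwise inequality that is integrated over the pair of independent copies.\<close>
  have pw: "r * (?a p - ?b p - ?c p + ?d p)
      \<le> G / 4 * (h (fst p))\<^sup>2 + G / 4 * (h (snd p))\<^sup>2 + 2 * X * ?D p" for p
  proof -
    obtain f1 f2 h1 h2 where e: "f1 = f (fst p)" "f2 = f (snd p)" "h1 = h (fst p)" "h2 = h (snd p)"
      by blast
    define s where "s = (f1 - f2) * (h1 - h2)"
    have "(r * s)\<^sup>2 \<le> (G * X) * s\<^sup>2"
      using r by (simp add: power_mult_distrib mult_right_mono)
    have am: "4 * (G * A) * (X * B) \<le> (G * A / 2 + 2 * X * B)\<^sup>2" for A B
      using zero_le_power2[of "G * A / 2 - 2 * X * B"] by (simp add: power2_eq_square algebra_simps)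
    have "2 * (r * s * (h1 + h2)) \<le> 2 * (G * (h1 + h2)\<^sup>2 / 8 + 2 * X * s\<^sup>2)"
    proof (rule power2_le_imp_le)
      have "(2 * (r * s * (h1 + h2)))\<^sup>2 = 4 * (r * s)\<^sup>2 * (h1 + h2)\<^sup>2"
        by (simp add: power_mult_distrib)
      also have "\<dots> \<le> 4 * ((G * X) * s\<^sup>2) * (h1 + h2)\<^sup>2"
        using \<open>(r * s)\<^sup>2 \<le> (G * X) * s\<^sup>2\<close> by (intro mult_right_mono mult_left_mono) auto
      also have "\<dots> = 4 * (G * ((h1 + h2)\<^sup>2 / 2)) * (X * (2 * s\<^sup>2))" by (simp add: algebra_simps)
      also have "\<dots> \<le> (G * ((h1 + h2)\<^sup>2 / 2) / 2 + 2 * X * (2 * s\<^sup>2))\<^sup>2" by (rule am)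
      also have "\<dots> = (2 * (G * (h1 + h2)\<^sup>2 / 8 + 2 * X * s\<^sup>2))\<^sup>2" by (simp add: algebra_simps)
      finally show "(2 * (r * s * (h1 + h2)))\<^sup>2 \<le> (2 * (G * (h1 + h2)\<^sup>2 / 8 + 2 * X * s\<^sup>2))\<^sup>2" .
      show "0 \<le> 2 * (G * (h1 + h2)\<^sup>2 / 8 + 2 * X * s\<^sup>2)" using assms by simp
    qed
    moreover have "G * (h1 + h2)\<^sup>2 \<le> G * (2 * h1\<^sup>2 + 2 * h2\<^sup>2)"
      using zero_le_power2[of "h1 - h2"] \<open>0 \<le> G\<close>
      by (intro mult_left_mono) (auto simp: power2_eq_square algebra_simps)
    moreover have "r * s * (h1 + h2) = r * (?a p - ?b p - ?c p + ?d p)"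
      unfolding s_def e by (simp add: power2_eq_square algebra_simps)
    moreover have "s\<^sup>2 = ?D p" unfolding s_def e by (simp add: power_mult_distrib)
    ultimately show ?thesis unfolding e by (simp add: algebra_simps)
  qed
  have "2 * r * (\<integral>y. (f y - expectation f) * (h y)\<^sup>2 \<partial>M)
      = 2 * r * ((\<integral>y. f y * (h y)\<^sup>2 \<partial>M) - expectation f * (\<integral>y. (h y)\<^sup>2 \<partial>M))"
    using J by (simp add: left_diff_distrib)
  also have "\<dots> = integral\<^sup>L (M \<Otimes>\<^sub>M M) (\<lambda>p. r * (?a p - ?b p - ?c p + ?d p))"
    using I by (simp add: Ia Ib Ic Id algebra_simps)
  also have "\<dots> \<le> integral\<^sup>L (M \<Otimes>\<^sub>M M)
      (\<lambda>p. G / 4 * (h (fst p))\<^sup>2 + G / 4 * (h (snd p))\<^sup>2 + 2 * X * ?D p)"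
    using I pw by (intro integral_mono) auto
  also have "\<dots> = G / 2 * (\<integral>y. (h y)\<^sup>2 \<partial>M) + 2 * X * integral\<^sup>L (M \<Otimes>\<^sub>M M) ?D"
    using I by (simp add: Ih)
  finally show ?thesis unfolding ID .
qed

text \<open>
  Expanding the square around the mean \<open>m\<close> leaves the cross term
  \<open>2 ((u - m \<xi>) \<bullet> \<xi>) E (f - m) h\<^sup>2\<close>, which would vanish for constant \<open>h\<close>. It is a covariance and
  is absorbed by \<open>covariance_bound\<close>, at the cost of half of the quadratic gain.
\<close>

lemma (in prob_space) weighted_risk_gap:
  fixes f h :: "'a \<Rightarrow> real" and u \<xi> :: "'v::euclidean_space"
  assumes [measurable]: "f \<in> borel_measurable M" "h \<in> borel_measurable M"
    and f: "\<And>y. y \<in> space M \<Longrightarrow> 0 \<le> f y \<and> f y \<le> 1"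
    and h: "\<And>y. y \<in> space M \<Longrightarrow> 0 \<le> h y \<and> h y \<le> 1"
  defines "m \<equiv> expectation f"
  shows "(\<integral>\<^sup>+y. ennreal ((norm (u - m *\<^sub>R \<xi>))\<^sup>2 / 2 * (h y)\<^sup>2) \<partial>M)
      + (\<integral>\<^sup>+y. ennreal ((norm (m *\<^sub>R \<xi> - f y *\<^sub>R \<xi>))\<^sup>2 * (h y)\<^sup>2) \<partial>M)
    \<le> (\<integral>\<^sup>+y. ennreal ((norm (u - f y *\<^sub>R \<xi>))\<^sup>2 * (h y)\<^sup>2) \<partial>M)
      + 2 * (\<integral>\<^sup>+y. \<integral>\<^sup>+y'. ennreal ((norm \<xi>)\<^sup>2 * ((f y - f y')\<^sup>2 * (h y - h y')\<^sup>2)) \<partial>M \<partial>M)"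
proof -
  interpret P: pair_prob_space M M ..
  have bnd: "integrable M g" if "g \<in> borel_measurable M" "\<And>y. y \<in> space M \<Longrightarrow> \<bar>g y\<bar> \<le> 1"
    for g :: "'a \<Rightarrow> real"
    by (rule integrable_const_bound[where B = 1]) (use that in auto)
  have h1: "\<bar>(h y)\<^sup>2\<bar> \<le> 1" if "y \<in> space M" for y
    using h[OF that] by (auto intro!: power_le_one)
  have fh1: "\<bar>(f y) ^ j * (h y)\<^sup>2\<bar> \<le> 1" if "y \<in> space M" for y j
    using f[OF that] h[OF that] by (auto simp: abs_mult intro!: mult_le_one power_le_one)
  have i0: "integrable M (\<lambda>y. (h y)\<^sup>2)" using h1 by (auto intro!: bnd)
  have i1: "integrable M (\<lambda>y. f y * (h y)\<^sup>2)" using fh1[of _ 1] by (auto intro!: bnd)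
  have i2: "integrable M (\<lambda>y. (f y)\<^sup>2 * (h y)\<^sup>2)" using fh1[of _ 2] by (auto intro!: bnd)
  have d1: "\<bar>(f y - f y')\<^sup>2 * (h y - h y')\<^sup>2\<bar> \<le> 1" if "y \<in> space M" "y' \<in> space M" for y y'
    using f[OF that(1)] f[OF that(2)] h[OF that(1)] h[OF that(2)]
    by (auto simp: abs_mult abs_square_le_1[symmetric] intro!: mult_le_one)
       (auto simp: abs_square_le_1)
  let ?D = "\<lambda>p::'a \<times> 'a. (norm \<xi>)\<^sup>2 * ((f (fst p) - f (snd p))\<^sup>2 * (h (fst p) - h (snd p))\<^sup>2)"
  have iD0: "integrable (M \<Otimes>\<^sub>M M) (\<lambda>p. (f (fst p) - f (snd p))\<^sup>2 * (h (fst p) - h (snd p))\<^sup>2)"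
    by (rule P.P.integrable_const_bound[where B = 1]) (use d1 in \<open>auto simp: space_pair_measure\<close>)
  then have iD: "integrable (M \<Otimes>\<^sub>M M) ?D" by (rule integrable_mult_right)
  define g where "g = u - m *\<^sub>R \<xi>"
  have e1: "(norm (m *\<^sub>R \<xi> - f y *\<^sub>R \<xi>))\<^sup>2 = (norm \<xi>)\<^sup>2 * (f y - m)\<^sup>2" for y
    by (simp add: scaleR_diff_left[symmetric] power_mult_distrib power2_commute mult_ac)
  have e2: "(norm (u - f y *\<^sub>R \<xi>))\<^sup>2 = (norm g)\<^sup>2 - 2 * (g \<bullet> \<xi>) * (f y - m) + (norm \<xi>)\<^sup>2 * (f y - m)\<^sup>2" for y
  proof -
    have "u - f y *\<^sub>R \<xi> = g - (f y - m) *\<^sub>R \<xi>" by (simp add: g_def algebra_simps)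
    then show ?thesis
      by (simp add: power2_norm_eq_inner inner_diff_left inner_diff_right inner_commute)
         (simp add: power2_eq_square algebra_simps)
  qed
  have ia: "integrable M (\<lambda>y. (f y - m) * (h y)\<^sup>2)"
    using i0 i1 by (simp add: left_diff_distrib)
  have "(\<lambda>y. (f y - m)\<^sup>2 * (h y)\<^sup>2)
      = (\<lambda>y. (f y)\<^sup>2 * (h y)\<^sup>2 - 2 * m * (f y * (h y)\<^sup>2) + m\<^sup>2 * (h y)\<^sup>2)"
    by (auto simp: power2_eq_square algebra_simps)
  then have ib: "integrable M (\<lambda>y. (f y - m)\<^sup>2 * (h y)\<^sup>2)"
    using i0 i1 i2 by simp
  have E2: "(\<lambda>y. (norm (u - f y *\<^sub>R \<xi>))\<^sup>2 * (h y)\<^sup>2) = (\<lambda>y. (norm g)\<^sup>2 * (h y)\<^sup>2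
      - 2 * (g \<bullet> \<xi>) * ((f y - m) * (h y)\<^sup>2) + (norm \<xi>)\<^sup>2 * ((f y - m)\<^sup>2 * (h y)\<^sup>2))"
    unfolding e2 by (auto simp: algebra_simps)
  have i3: "integrable M (\<lambda>y. (norm (u - f y *\<^sub>R \<xi>))\<^sup>2 * (h y)\<^sup>2)"
    unfolding E2 using i0 ia ib by simp
  have cs: "(g \<bullet> \<xi>)\<^sup>2 \<le> (norm g)\<^sup>2 * (norm \<xi>)\<^sup>2"
    using Cauchy_Schwarz_ineq[of g \<xi>] by (simp add: power2_norm_eq_inner)
  have main: "(norm g)\<^sup>2 / 2 * (\<integral>y. (h y)\<^sup>2 \<partial>M) + (norm \<xi>)\<^sup>2 * (\<integral>y. (f y - m)\<^sup>2 * (h y)\<^sup>2 \<partial>M)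
     \<le> (\<integral>y. (norm (u - f y *\<^sub>R \<xi>))\<^sup>2 * (h y)\<^sup>2 \<partial>M)
       + 2 * ((norm \<xi>)\<^sup>2 * (\<integral>y. \<integral>y'. (f y - f y')\<^sup>2 * (h y - h y')\<^sup>2 \<partial>M \<partial>M))"
    unfolding E2 using i0 ia ib covariance_bound[of f h "g \<bullet> \<xi>" "(norm g)\<^sup>2" "(norm \<xi>)\<^sup>2", OF _ _ f h cs]
    by (simp add: m_def)
  have n1: "(\<integral>\<^sup>+y. ennreal ((norm g)\<^sup>2 / 2 * (h y)\<^sup>2) \<partial>M) = ennreal ((norm g)\<^sup>2 / 2 * (\<integral>y. (h y)\<^sup>2 \<partial>M))"
    using i0 by (subst nn_integral_eq_integral) auto
  have n2: "(\<integral>\<^sup>+y. ennreal ((norm \<xi>)\<^sup>2 * (f y - m)\<^sup>2 * (h y)\<^sup>2) \<partial>M)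
     = ennreal ((norm \<xi>)\<^sup>2 * (\<integral>y. (f y - m)\<^sup>2 * (h y)\<^sup>2 \<partial>M))"
    using ib by (subst nn_integral_eq_integral) (auto simp: mult.assoc)
  have n3: "(\<integral>\<^sup>+y. ennreal ((norm (u - f y *\<^sub>R \<xi>))\<^sup>2 * (h y)\<^sup>2) \<partial>M)
     = ennreal (\<integral>y. (norm (u - f y *\<^sub>R \<xi>))\<^sup>2 * (h y)\<^sup>2 \<partial>M)"
    using i3 by (rule nn_integral_eq_integral) auto
  have n4: "(\<integral>\<^sup>+y. \<integral>\<^sup>+y'. ennreal ((norm \<xi>)\<^sup>2 * ((f y - f y')\<^sup>2 * (h y - h y')\<^sup>2)) \<partial>M \<partial>M)
     = ennreal ((norm \<xi>)\<^sup>2 * (\<integral>y. \<integral>y'. (f y - f y')\<^sup>2 * (h y - h y')\<^sup>2 \<partial>M \<partial>M))"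
  proof -
    have "(\<integral>\<^sup>+y. \<integral>\<^sup>+y'. ennreal ((norm \<xi>)\<^sup>2 * ((f y - f y')\<^sup>2 * (h y - h y')\<^sup>2)) \<partial>M \<partial>M)
        = (\<integral>\<^sup>+p. ennreal (?D p) \<partial>(M \<Otimes>\<^sub>M M))"
      by (subst nn_integral_fst[symmetric]) auto
    also have "\<dots> = ennreal (integral\<^sup>L (M \<Otimes>\<^sub>M M) ?D)"
      using iD by (rule nn_integral_eq_integral) auto
    finally show ?thesis using P.integral_fst'[OF iD0] by simp
  qed
  have nn: "0 \<le> (\<integral>y. (h y)\<^sup>2 \<partial>M)" "0 \<le> (\<integral>y. (f y - m)\<^sup>2 * (h y)\<^sup>2 \<partial>M)"
    "0 \<le> (\<integral>y. (norm (u - f y *\<^sub>R \<xi>))\<^sup>2 * (h y)\<^sup>2 \<partial>M)"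
    "0 \<le> (\<integral>y. \<integral>y'. (f y - f y')\<^sup>2 * (h y - h y')\<^sup>2 \<partial>M \<partial>M)"
    by (auto intro!: integral_nonneg)
  have two: "2 * ennreal x = ennreal (2 * x)" if "x \<ge> 0" for x
    using that by (simp add: ennreal_mult'')
  show ?thesis
    unfolding g_def[symmetric] e1 n1 n2 n3 n4 using main nn
    by (simp add: two del: ennreal_plus flip: ennreal_plus)
qed

text \<open>
  Here \<open>A\<close> stands for the marginal law of the observation \<open>z\<close>, \<open>k z\<close> for the posterior density of the
  hyperparameter \<open>y\<close>, and \<open>m\<close> for the posterior mean of \<open>f\<close>; \<open>u\<close> competes with \<open>m \<xi>\<close> as a predictor of
  \<open>f \<xi>\<close> and is never worse under the priors tempered by \<open>(h i)\<^sup>2\<close>. Integrating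
  \<open>weighted_risk_gap\<close> over \<open>z\<close> bounds the weighted distance of \<open>u\<close> and \<open>m \<xi>\<close> by the integral of
  \<open>|\<xi>|\<^sup>2 (f - f')\<^sup>2 (h - h')\<^sup>2\<close>, for which \<open>H\<close> provides an integrable majorant because
  \<open>(f - f')\<^sup>2 \<le> f\<^sup>2 + f'\<^sup>2\<close> and the increments of \<open>h\<close> are bounded by both \<open>H y y'\<close> and \<open>H y' y\<close>.
  The two bounds on \<open>(h i)\<^sup>2\<close> itself make the tempered risk of \<open>m \<xi>\<close> finite, so that it can be
  cancelled; their constants may depend on \<open>i\<close>.
\<close>

lemma blyth_limit:
  fixes A :: "'z measure" and B :: "'y measure" and k :: "'z \<Rightarrow> 'y \<Rightarrow> real"
    and f :: "'y \<Rightarrow> real" and h :: "nat \<Rightarrow> 'y \<Rightarrow> real" and H :: "'y \<Rightarrow> 'y \<Rightarrow> real"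
    and \<xi> u :: "'z \<Rightarrow> 'v::euclidean_space"
  assumes A: "sigma_finite_measure A" and B: "sigma_finite_measure B"
    and kjoint[measurable]: "(\<lambda>(z, y). k z y) \<in> borel_measurable (A \<Otimes>\<^sub>M B)"
    and [measurable]: "f \<in> borel_measurable B"
      "\<And>i. h i \<in> borel_measurable B" "(\<lambda>(y, y'). H y y') \<in> borel_measurable (B \<Otimes>\<^sub>M B)"
      "\<xi> \<in> borel_measurable A" "u \<in> borel_measurable A"
    and k: "\<And>z y. z \<in> space A \<Longrightarrow> y \<in> space B \<Longrightarrow> 0 \<le> k z y"
    and k1: "\<And>z. z \<in> space A \<Longrightarrow> (\<integral>\<^sup>+y. ennreal (k z y) \<partial>B) = 1"
    and f: "\<And>y. y \<in> space B \<Longrightarrow> 0 \<le> f y \<and> f y \<le> 1"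
    and h: "\<And>i y. y \<in> space B \<Longrightarrow> 0 < h i y \<and> h i y \<le> 1"
    and hmono: "\<And>i y. y \<in> space B \<Longrightarrow> h 0 y \<le> h i y"
    and hlim: "\<And>y. y \<in> space B \<Longrightarrow> (\<lambda>i. h i y) \<longlonglongrightarrow> 1"
    and hdiff: "\<And>i y y'. y \<in> space B \<Longrightarrow> y' \<in> space B \<Longrightarrow> (h i y - h i y')\<^sup>2 \<le> H y y'"
    and c: "\<And>i. 0 \<le> c i"
    and hle: "\<And>i y y'. y \<in> space B \<Longrightarrow> y' \<in> space B \<Longrightarrow> (h i y)\<^sup>2 \<le> c i * H y y'"
    and hle': "\<And>i y y'. y \<in> space B \<Longrightarrow> y' \<in> space B \<Longrightarrow> (h i y')\<^sup>2 \<le> c i * H y y'"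
    and fin: "(\<integral>\<^sup>+z. \<integral>\<^sup>+y. \<integral>\<^sup>+y'. ennreal ((norm (\<xi> z))\<^sup>2 * (f y)\<^sup>2 * H y y' * k z y * k z y') \<partial>B \<partial>B \<partial>A) < \<infinity>"
  defines "m \<equiv> \<lambda>z. \<integral>y. k z y * f y \<partial>B"
  assumes le: "\<And>i. (\<integral>\<^sup>+z. \<integral>\<^sup>+y. ennreal ((norm (u z - f y *\<^sub>R \<xi> z))\<^sup>2 * (h i y)\<^sup>2 * k z y) \<partial>B \<partial>A)
      \<le> (\<integral>\<^sup>+z. \<integral>\<^sup>+y. ennreal ((norm (m z *\<^sub>R \<xi> z - f y *\<^sub>R \<xi> z))\<^sup>2 * (h i y)\<^sup>2 * k z y) \<partial>B \<partial>A)"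
  shows "AE z in A. u z = m z *\<^sub>R \<xi> z"
proof -
  interpret A: sigma_finite_measure A by (rule A)
  interpret B: sigma_finite_measure B by (rule B)
  interpret BB: pair_sigma_finite B B ..
  interpret AB: pair_sigma_finite A B ..
  have [measurable]: "m \<in> borel_measurable A" unfolding m_def by measurable
  have kmeas[measurable]: "k z \<in> borel_measurable B" if "z \<in> space A" for z
    using measurable_Pair2[OF kjoint that] by simp
  \<comment> \<open>\<open>F\<close> is the tempered risk of \<open>m \<xi>\<close>, \<open>G\<close> the gain of \<open>m \<xi>\<close> over \<open>u\<close>, and \<open>J\<close> the error that tends to \<open>0\<close>.\<close>
  define D where "D i z y y' = (norm (\<xi> z))\<^sup>2 * ((f y - f y')\<^sup>2 * (h i y - h i y')\<^sup>2)" for i z y y'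
  define J where "J i = (\<integral>\<^sup>+z. \<integral>\<^sup>+y. \<integral>\<^sup>+y'. ennreal (D i z y y' * k z y * k z y') \<partial>B \<partial>B \<partial>A)" for i
  define F where "F i = (\<integral>\<^sup>+z. \<integral>\<^sup>+y. ennreal ((norm (m z *\<^sub>R \<xi> z - f y *\<^sub>R \<xi> z))\<^sup>2 * (h i y)\<^sup>2 * k z y) \<partial>B \<partial>A)" for i
  define G where "G i = (\<integral>\<^sup>+z. \<integral>\<^sup>+y. ennreal ((norm (u z - m z *\<^sub>R \<xi> z))\<^sup>2 / 2 * (h i y)\<^sup>2 * k z y) \<partial>B \<partial>A)" for i
  have dens: "(\<integral>\<^sup>+y. ennreal (g y) \<partial>density B (k z)) = (\<integral>\<^sup>+y. ennreal (g y * k z y) \<partial>B)"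
    if "z \<in> space A" and [measurable]: "g \<in> borel_measurable B" for z g
    using that k[OF that(1)] by (subst nn_integral_density) (auto simp: ennreal_mult'' mult.commute intro!: nn_integral_cong)
  have m_eq: "m z = integral\<^sup>L (density B (k z)) f" if "z \<in> space A" for z
    unfolding m_def using that k by (subst integral_density) auto
  have prob: "prob_space (density B (k z))" if "z \<in> space A" for z
    using that k1 by (intro prob_spaceI) (simp add: emeasure_density cong: nn_integral_cong)
  have key: "G i + F i \<le> F i + 2 * J i" for i
  proof -
    have pw: "(\<integral>\<^sup>+y. ennreal ((norm (u z - m z *\<^sub>R \<xi> z))\<^sup>2 / 2 * (h i y)\<^sup>2 * k z y) \<partial>B)
       + (\<integral>\<^sup>+y. ennreal ((norm (m z *\<^sub>R \<xi> z - f y *\<^sub>R \<xi> z))\<^sup>2 * (h i y)\<^sup>2 * k z y) \<partial>B)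
       \<le> (\<integral>\<^sup>+y. ennreal ((norm (u z - f y *\<^sub>R \<xi> z))\<^sup>2 * (h i y)\<^sup>2 * k z y) \<partial>B)
       + 2 * (\<integral>\<^sup>+y. \<integral>\<^sup>+y'. ennreal (D i z y y' * k z y * k z y') \<partial>B \<partial>B)"
      if z: "z \<in> space A" for z
    proof -
      interpret N: prob_space "density B (k z)" by (rule prob[OF z])
      have "(\<integral>\<^sup>+y. \<integral>\<^sup>+y'. ennreal (D i z y y') \<partial>density B (k z) \<partial>density B (k z))
        = (\<integral>\<^sup>+y. (\<integral>\<^sup>+y'. ennreal (D i z y y' * k z y') \<partial>B) \<partial>density B (k z))"
        using z by (intro nn_integral_cong dens) (auto simp: D_def)
      also have "\<dots> = (\<integral>\<^sup>+y. ennreal (k z y) * (\<integral>\<^sup>+y'. ennreal (D i z y y' * k z y') \<partial>B) \<partial>B)"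
        unfolding D_def by (intro nn_integral_density) (use z in measurable)
      also have "\<dots> = (\<integral>\<^sup>+y. \<integral>\<^sup>+y'. ennreal (D i z y y' * k z y * k z y') \<partial>B \<partial>B)"
        using z k[OF z] unfolding D_def
        by (intro nn_integral_cong, subst nn_integral_cmult[symmetric])
           (auto simp: ennreal_mult''[symmetric] ennreal_mult'[symmetric] mult_ac intro!: nn_integral_cong)
      finally have dd: "(\<integral>\<^sup>+y. \<integral>\<^sup>+y'. ennreal (D i z y y') \<partial>density B (k z) \<partial>density B (k z))
        = (\<integral>\<^sup>+y. \<integral>\<^sup>+y'. ennreal (D i z y y' * k z y * k z y') \<partial>B \<partial>B)" .
      have hh: "0 \<le> h i y \<and> h i y \<le> 1" if "y \<in> space B" for y using h[OF that, of i] by auto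
      show ?thesis
        using N.weighted_risk_gap[of f "h i" "u z" "\<xi> z", folded m_eq[OF z] D_def] f hh
        unfolding dd[symmetric] by (simp add: dens[OF z])
    qed
    have "G i + F i = (\<integral>\<^sup>+z. (\<integral>\<^sup>+y. ennreal ((norm (u z - m z *\<^sub>R \<xi> z))\<^sup>2 / 2 * (h i y)\<^sup>2 * k z y) \<partial>B)
       + (\<integral>\<^sup>+y. ennreal ((norm (m z *\<^sub>R \<xi> z - f y *\<^sub>R \<xi> z))\<^sup>2 * (h i y)\<^sup>2 * k z y) \<partial>B) \<partial>A)"
      unfolding G_def F_def by (intro nn_integral_add[symmetric]) measurable
    also have "\<dots> \<le> (\<integral>\<^sup>+z. (\<integral>\<^sup>+y. ennreal ((norm (u z - f y *\<^sub>R \<xi> z))\<^sup>2 * (h i y)\<^sup>2 * k z y) \<partial>B)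
       + 2 * (\<integral>\<^sup>+y. \<integral>\<^sup>+y'. ennreal (D i z y y' * k z y * k z y') \<partial>B \<partial>B) \<partial>A)"
      by (intro nn_integral_mono pw)
    also have "\<dots> = (\<integral>\<^sup>+z. (\<integral>\<^sup>+y. ennreal ((norm (u z - f y *\<^sub>R \<xi> z))\<^sup>2 * (h i y)\<^sup>2 * k z y) \<partial>B) \<partial>A) + 2 * J i"
      unfolding J_def D_def by (subst nn_integral_add) (auto simp: nn_integral_cmult)
    also have "\<dots> \<le> F i + 2 * J i"
      unfolding F_def by (intro add_right_mono le)
    finally show ?thesis .
  qed
  \<comment> \<open>The majorant also controls the tempered risk \<open>F\<close> of \<open>m \<xi>\<close>, by Jensen's inequality for \<open>m\<close>.\<close>
  define W where "W z = (\<integral>\<^sup>+y. \<integral>\<^sup>+y'. ennreal ((norm (\<xi> z))\<^sup>2 * (f y)\<^sup>2 * H y y' * k z y * k z y') \<partial>B \<partial>B)" for z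
  have H0: "0 \<le> H y y'" if "y \<in> space B" "y' \<in> space B" for y y'
    using hdiff[OF that, of 0] zero_le_power2[of "h 0 y - h 0 y'"] by linarith
  have F_fin: "F i < \<infinity>" for i
  proof -
    have pw: "(\<integral>\<^sup>+y. ennreal ((norm (m z *\<^sub>R \<xi> z - f y *\<^sub>R \<xi> z))\<^sup>2 * (h i y)\<^sup>2 * k z y) \<partial>B)
        \<le> 2 * (ennreal (c i) * W z)" if z: "z \<in> space A" for z
    proof -
      interpret N: prob_space "density B (k z)" by (rule prob[OF z])
      note [measurable] = kmeas[OF z]
      have cW: "ennreal (c i) * W z
          = (\<integral>\<^sup>+y. \<integral>\<^sup>+y'. ennreal (c i * ((norm (\<xi> z))\<^sup>2 * (f y)\<^sup>2 * H y y' * k z y * k z y')) \<partial>B \<partial>B)"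
      proof -
        have "ennreal (c i) * W z
          = (\<integral>\<^sup>+y. ennreal (c i) * (\<integral>\<^sup>+y'. ennreal ((norm (\<xi> z))\<^sup>2 * (f y)\<^sup>2 * H y y' * k z y * k z y') \<partial>B) \<partial>B)"
          unfolding W_def by (rule nn_integral_cmult[symmetric]) measurable
        also have "\<dots> = (\<integral>\<^sup>+y. \<integral>\<^sup>+y'. ennreal (c i * ((norm (\<xi> z))\<^sup>2 * (f y)\<^sup>2 * H y y' * k z y * k z y')) \<partial>B \<partial>B)"
          using c[of i] by (intro nn_integral_cong, subst nn_integral_cmult[symmetric]) (auto simp: ennreal_mult')
        finally show ?thesis .
      qed
      have kf: "0 \<le> (norm (\<xi> z))\<^sup>2 * (f y)\<^sup>2 * k z y * k z y'" if "y \<in> space B" "y' \<in> space B" for y y'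
        by (intro mult_nonneg_nonneg k[OF z] that) auto
      have q1: "(norm (\<xi> z))\<^sup>2 * (f y)\<^sup>2 * k z y * k z y' * (h i y)\<^sup>2
            \<le> c i * ((norm (\<xi> z))\<^sup>2 * (f y)\<^sup>2 * H y y' * k z y * k z y')"
        if y: "y \<in> space B" and y': "y' \<in> space B" for y y'
        using mult_left_mono[OF hle[OF y y', of i] kf[OF y y']] by (simp only: mult_ac)
      have q2: "(norm (\<xi> z))\<^sup>2 * (f y)\<^sup>2 * k z y * k z y' * (h i y')\<^sup>2
            \<le> c i * ((norm (\<xi> z))\<^sup>2 * (f y)\<^sup>2 * H y y' * k z y * k z y')"
        if y: "y \<in> space B" and y': "y' \<in> space B" for y y'
        using mult_left_mono[OF hle'[OF y y', of i] kf[OF y y']] by (simp only: mult_ac)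
      have int_f: "integrable (density B (k z)) f" "integrable (density B (k z)) (\<lambda>y. (f y)\<^sup>2)"
        using f by (auto intro!: N.integrable_const_bound[where B = 1] AE_I2 power_le_one)
      have m0: "0 \<le> m z" unfolding m_eq[OF z] using f by (intro integral_nonneg_AE AE_I2) auto
      have "(m z)\<^sup>2 \<le> (\<integral>y. (f y)\<^sup>2 \<partial>density B (k z))"
        using N.variance_eq[OF int_f] N.variance_positive[of f] unfolding m_eq[OF z] by simp
      then have "ennreal ((m z)\<^sup>2) \<le> (\<integral>\<^sup>+y. ennreal ((f y)\<^sup>2) \<partial>density B (k z))"
        using int_f by (subst nn_integral_eq_integral) (auto intro: ennreal_leI)
      also have "\<dots> = (\<integral>\<^sup>+y. ennreal ((f y)\<^sup>2 * k z y) \<partial>B)" by (rule dens[OF z]) simp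
      finally have m2: "ennreal ((m z)\<^sup>2) \<le> (\<integral>\<^sup>+y. ennreal ((f y)\<^sup>2 * k z y) \<partial>B)" .
      have "(\<integral>\<^sup>+y. ennreal ((norm (\<xi> z))\<^sup>2 * (f y)\<^sup>2 * (h i y)\<^sup>2 * k z y) \<partial>B)
          = (\<integral>\<^sup>+y. ennreal ((norm (\<xi> z))\<^sup>2 * (f y)\<^sup>2 * (h i y)\<^sup>2 * k z y) * (\<integral>\<^sup>+y'. ennreal (k z y') \<partial>B) \<partial>B)"
        by (simp add: k1[OF z])
      also have "\<dots> = (\<integral>\<^sup>+y. \<integral>\<^sup>+y'. ennreal ((norm (\<xi> z))\<^sup>2 * (f y)\<^sup>2 * k z y * k z y' * (h i y)\<^sup>2) \<partial>B \<partial>B)"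
        using k[OF z] by (intro nn_integral_cong, subst nn_integral_cmult[symmetric])
          (auto simp: mult_ac simp flip: ennreal_mult' ennreal_mult'' intro!: nn_integral_cong)
      also have "\<dots> \<le> ennreal (c i) * W z"
        unfolding cW by (intro nn_integral_mono ennreal_leI q1)
      finally have p1: "(\<integral>\<^sup>+y. ennreal ((norm (\<xi> z))\<^sup>2 * (f y)\<^sup>2 * (h i y)\<^sup>2 * k z y) \<partial>B) \<le> ennreal (c i) * W z" .
      have "(\<integral>\<^sup>+y'. ennreal ((norm (\<xi> z))\<^sup>2 * (m z)\<^sup>2 * (h i y')\<^sup>2 * k z y') \<partial>B)
          = ennreal ((m z)\<^sup>2) * (\<integral>\<^sup>+y'. ennreal ((norm (\<xi> z))\<^sup>2 * (h i y')\<^sup>2 * k z y') \<partial>B)"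
        by (subst nn_integral_cmult[symmetric]) (auto simp: ennreal_mult'[symmetric] mult_ac)
      also have "\<dots> \<le> (\<integral>\<^sup>+y. ennreal ((f y)\<^sup>2 * k z y) \<partial>B) * (\<integral>\<^sup>+y'. ennreal ((norm (\<xi> z))\<^sup>2 * (h i y')\<^sup>2 * k z y') \<partial>B)"
        by (intro mult_right_mono m2) simp
      also have "\<dots> = (\<integral>\<^sup>+y. ennreal ((f y)\<^sup>2 * k z y) * (\<integral>\<^sup>+y'. ennreal ((norm (\<xi> z))\<^sup>2 * (h i y')\<^sup>2 * k z y') \<partial>B) \<partial>B)"
        by (rule nn_integral_multc[symmetric]) simp
      also have "\<dots> = (\<integral>\<^sup>+y. \<integral>\<^sup>+y'. ennreal ((norm (\<xi> z))\<^sup>2 * (f y)\<^sup>2 * k z y * k z y' * (h i y')\<^sup>2) \<partial>B \<partial>B)"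
        using k[OF z] by (intro nn_integral_cong, subst nn_integral_cmult[symmetric])
          (auto simp: mult_ac simp flip: ennreal_mult' ennreal_mult'' intro!: nn_integral_cong)
      also have "\<dots> \<le> ennreal (c i) * W z"
        unfolding cW by (intro nn_integral_mono ennreal_leI q2)
      finally have p2: "(\<integral>\<^sup>+y'. ennreal ((norm (\<xi> z))\<^sup>2 * (m z)\<^sup>2 * (h i y')\<^sup>2 * k z y') \<partial>B) \<le> ennreal (c i) * W z" .
      have "(norm (m z *\<^sub>R \<xi> z - f y *\<^sub>R \<xi> z))\<^sup>2 * (h i y)\<^sup>2 * k z y
          \<le> (norm (\<xi> z))\<^sup>2 * (f y)\<^sup>2 * (h i y)\<^sup>2 * k z y + (norm (\<xi> z))\<^sup>2 * (m z)\<^sup>2 * (h i y)\<^sup>2 * k z y"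
        if y: "y \<in> space B" for y
      proof -
        have "(m z - f y)\<^sup>2 \<le> (f y)\<^sup>2 + (m z)\<^sup>2"
          using m0 f[OF y] by (simp add: power2_diff)
        then have "((m z - f y)\<^sup>2) * ((norm (\<xi> z))\<^sup>2 * (h i y)\<^sup>2 * k z y)
            \<le> ((f y)\<^sup>2 + (m z)\<^sup>2) * ((norm (\<xi> z))\<^sup>2 * (h i y)\<^sup>2 * k z y)"
          using k[OF z y] by (intro mult_right_mono) auto
        moreover have "(norm (m z *\<^sub>R \<xi> z - f y *\<^sub>R \<xi> z))\<^sup>2 = (m z - f y)\<^sup>2 * (norm (\<xi> z))\<^sup>2"
          by (simp add: scaleR_diff_left[symmetric] power_mult_distrib)
        ultimately show ?thesis
          by (simp add: algebra_simps)
      qed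
      then have "(\<integral>\<^sup>+y. ennreal ((norm (m z *\<^sub>R \<xi> z - f y *\<^sub>R \<xi> z))\<^sup>2 * (h i y)\<^sup>2 * k z y) \<partial>B)
        \<le> (\<integral>\<^sup>+y. ennreal ((norm (\<xi> z))\<^sup>2 * (f y)\<^sup>2 * (h i y)\<^sup>2 * k z y)
            + ennreal ((norm (\<xi> z))\<^sup>2 * (m z)\<^sup>2 * (h i y)\<^sup>2 * k z y) \<partial>B)"
        using k[OF z] by (intro nn_integral_mono) (auto simp flip: ennreal_plus intro: ennreal_leI)
      also have "\<dots> \<le> ennreal (c i) * W z + ennreal (c i) * W z"
        by (subst nn_integral_add) (auto intro!: add_mono p1 p2)
      finally show ?thesis by (simp add: mult_2)
    qed
    have "F i \<le> (\<integral>\<^sup>+z. 2 * (ennreal (c i) * W z) \<partial>A)"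
      unfolding F_def by (intro nn_integral_mono pw)
    also have "\<dots> = 2 * (ennreal (c i) * (\<integral>\<^sup>+z. W z \<partial>A))"
      unfolding W_def by (simp add: nn_integral_cmult)
    also have "\<dots> < \<infinity>"
      using fin unfolding W_def by (auto simp: ennreal_mult_less_top)
    finally show ?thesis .
  qed
  let ?T = "A \<Otimes>\<^sub>M (B \<Otimes>\<^sub>M B)"
  have iter: "(\<integral>\<^sup>+z. \<integral>\<^sup>+y. \<integral>\<^sup>+y'. g z y y' \<partial>B \<partial>B \<partial>A) = (\<integral>\<^sup>+(z, y, y'). g z y y' \<partial>?T)"
    if g: "(\<lambda>(z, y, y'). g z y y') \<in> borel_measurable ?T" for g :: "'z \<Rightarrow> 'y \<Rightarrow> 'y \<Rightarrow> ennreal"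
  proof -
    have "(\<integral>\<^sup>+(z, y, y'). g z y y' \<partial>?T) = (\<integral>\<^sup>+z. \<integral>\<^sup>+(y, y'). g z y y' \<partial>(B \<Otimes>\<^sub>M B) \<partial>A)"
      by (subst BB.P.nn_integral_fst[symmetric]) (use g in auto)
    also have "\<dots> = (\<integral>\<^sup>+z. \<integral>\<^sup>+y. \<integral>\<^sup>+y'. g z y y' \<partial>B \<partial>B \<partial>A)"
    proof (rule nn_integral_cong)
      fix z assume "z \<in> space A"
      from measurable_Pair2[OF g this]
      show "(\<integral>\<^sup>+(y, y'). g z y y' \<partial>(B \<Otimes>\<^sub>M B)) = (\<integral>\<^sup>+y. \<integral>\<^sup>+y'. g z y y' \<partial>B \<partial>B)"
        by (subst B.nn_integral_fst[symmetric]) (auto simp: split_beta')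
    qed
    finally show ?thesis ..
  qed
  define w where "w z y y' = (norm (\<xi> z))\<^sup>2 * (f y)\<^sup>2 * H y y' * k z y * k z y'" for z y y'
  have w_fin: "(\<integral>\<^sup>+(z, y, y'). ennreal (w z y y' + w z y' y) \<partial>?T) < \<infinity>"
  proof -
    have w0: "0 \<le> w z y y'" if "z \<in> space A" "y \<in> space B" "y' \<in> space B" for z y y'
      using that k H0 by (simp add: w_def)
    have "(\<integral>\<^sup>+(z, y, y'). ennreal (w z y y' + w z y' y) \<partial>?T)
        = (\<integral>\<^sup>+p. ennreal (w (fst p) (fst (snd p)) (snd (snd p))) + ennreal (w (fst p) (snd (snd p)) (fst (snd p))) \<partial>?T)"
      using w0 by (intro nn_integral_cong) (auto simp: space_pair_measure)
    also have "\<dots> = (\<integral>\<^sup>+(z, y, y'). ennreal (w z y y') \<partial>?T) + (\<integral>\<^sup>+(z, y, y'). ennreal (w z y' y) \<partial>?T)"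
      unfolding split_beta' w_def by (subst nn_integral_add) auto
    also have "(\<integral>\<^sup>+(z, y, y'). ennreal (w z y' y) \<partial>?T) = (\<integral>\<^sup>+z. \<integral>\<^sup>+y. \<integral>\<^sup>+y'. ennreal (w z y' y) \<partial>B \<partial>B \<partial>A)"
      unfolding w_def by (intro iter[symmetric]) measurable
    also have "\<dots> = (\<integral>\<^sup>+z. \<integral>\<^sup>+y. \<integral>\<^sup>+y'. ennreal (w z y y') \<partial>B \<partial>B \<partial>A)"
      unfolding w_def by (intro nn_integral_cong BB.Fubini') measurable
    also have "(\<integral>\<^sup>+(z, y, y'). ennreal (w z y y') \<partial>?T) = \<dots>"
      unfolding w_def by (intro iter[symmetric]) measurable
    finally show ?thesis using fin unfolding w_def by simp
  qed
  have J_lim: "J \<longlonglongrightarrow> 0"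
  proof -
    have J_eq: "J = (\<lambda>i. \<integral>\<^sup>+(z, y, y'). ennreal (D i z y y' * k z y * k z y') \<partial>?T)"
      unfolding J_def D_def by (intro ext iter) measurable
    have "(\<lambda>i. \<integral>\<^sup>+(z, y, y'). ennreal (D i z y y' * k z y * k z y') \<partial>?T) \<longlonglongrightarrow> (\<integral>\<^sup>+p. 0 \<partial>?T)"
    proof (rule nn_integral_dominated_convergence[where w = "\<lambda>(z, y, y'). ennreal (w z y y' + w z y' y)"])
      show "(\<lambda>(z, y, y'). ennreal (D i z y y' * k z y * k z y')) \<in> borel_measurable ?T" for i
        unfolding D_def by measurable
      show "(\<lambda>(z, y, y'). ennreal (w z y y' + w z y' y)) \<in> borel_measurable ?T"
        unfolding w_def by measurable
      show "(\<integral>\<^sup>+p. (case p of (z, y, y') \<Rightarrow> ennreal (w z y y' + w z y' y)) \<partial>?T) < \<infinity>" by (rule w_fin)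
      show "AE p in ?T. (case p of (z, y, y') \<Rightarrow> ennreal (D i z y y' * k z y * k z y'))
          \<le> (case p of (z, y, y') \<Rightarrow> ennreal (w z y y' + w z y' y))" for i
      proof (rule AE_I2, clarsimp simp: space_pair_measure intro!: ennreal_leI)
        fix z y y' assume S: "z \<in> space A" "y \<in> space B" "y' \<in> space B"
        have "(f y - f y')\<^sup>2 \<le> (f y)\<^sup>2 + (f y')\<^sup>2"
          using f[OF S(2)] f[OF S(3)] by (simp add: power2_diff)
        then have "(f y - f y')\<^sup>2 * (h i y - h i y')\<^sup>2
            \<le> (f y)\<^sup>2 * (h i y - h i y')\<^sup>2 + (f y')\<^sup>2 * (h i y' - h i y)\<^sup>2"
          by (simp add: distrib_right[symmetric] power2_commute mult_right_mono)
        also have "\<dots> \<le> (f y)\<^sup>2 * H y y' + (f y')\<^sup>2 * H y' y"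
          using hdiff S by (intro add_mono mult_left_mono) auto
        finally have "(f y - f y')\<^sup>2 * (h i y - h i y')\<^sup>2 * ((norm (\<xi> z))\<^sup>2 * k z y * k z y')
          \<le> ((f y)\<^sup>2 * H y y' + (f y')\<^sup>2 * H y' y) * ((norm (\<xi> z))\<^sup>2 * k z y * k z y')"
          using k S by (intro mult_right_mono) auto
        then show "D i z y y' * k z y * k z y' \<le> w z y y' + w z y' y"
          by (simp add: D_def w_def algebra_simps)
      qed
      show "AE p in ?T. (\<lambda>i. case p of (z, y, y') \<Rightarrow> ennreal (D i z y y' * k z y * k z y')) \<longlonglongrightarrow> 0"
      proof (rule AE_I2, clarsimp simp: space_pair_measure)
        fix z y y' assume S: "z \<in> space A" "y \<in> space B" "y' \<in> space B"
        have "(\<lambda>i. D i z y y' * k z y * k z y')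
            \<longlonglongrightarrow> (norm (\<xi> z))\<^sup>2 * ((f y - f y')\<^sup>2 * (1 - 1)\<^sup>2) * k z y * k z y'"
          unfolding D_def using S by (intro tendsto_intros hlim)
        then show "(\<lambda>i. ennreal (D i z y y' * k z y * k z y')) \<longlonglongrightarrow> 0"
          by (intro tendsto_ennrealI[where x = 0, simplified]) simp
      qed
    qed simp
    then show ?thesis unfolding J_eq by simp
  qed
  \<comment> \<open>As the cut-offs increase, the gain for the first one is bounded by all the errors, hence \<open>0\<close>.\<close>
  have "G 0 \<le> G i" for i
    unfolding G_def using k hmono h
    by (intro nn_integral_mono ennreal_leI mult_right_mono mult_left_mono power_mono) (auto simp: less_imp_le)
  moreover have "G i \<le> 2 * J i" for i
    using key[of i] F_fin[of i] unfolding add.commute[of "G i" "F i"] by (auto simp: ennreal_add_left_cancel_le)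
  ultimately have "G 0 \<le> 2 * J i" for i by (rule order_trans)
  moreover have "(\<lambda>i. 2 * J i) \<longlonglongrightarrow> 2 * 0"
    by (intro ennreal_tendsto_cmult J_lim) simp
  ultimately have "G 0 \<le> 2 * 0" by (intro LIMSEQ_le_const) auto
  then have "G 0 = 0" by simp
  then have "AE z in A. (\<integral>\<^sup>+y. ennreal ((norm (u z - m z *\<^sub>R \<xi> z))\<^sup>2 / 2 * (h 0 y)\<^sup>2 * k z y) \<partial>B) = 0"
    unfolding G_def by (subst (asm) nn_integral_0_iff_AE) auto
  then show ?thesis
  proof (rule AE_mp, intro AE_I2 impI)
    fix z assume z: "z \<in> space A"
      and 0: "(\<integral>\<^sup>+y. ennreal ((norm (u z - m z *\<^sub>R \<xi> z))\<^sup>2 / 2 * (h 0 y)\<^sup>2 * k z y) \<partial>B) = 0"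
    note [measurable] = kmeas[OF z]
    show "u z = m z *\<^sub>R \<xi> z"
    proof (rule ccontr)
      assume ne: "u z \<noteq> m z *\<^sub>R \<xi> z"
      have "AE y in B. ennreal ((norm (u z - m z *\<^sub>R \<xi> z))\<^sup>2 / 2 * (h 0 y)\<^sup>2 * k z y) = 0"
        using 0 by (subst (asm) nn_integral_0_iff_AE) auto
      then have "AE y in B. ennreal (k z y) = 0"
      proof (rule AE_mp, intro AE_I2 impI)
        fix y assume y: "y \<in> space B"
          and "ennreal ((norm (u z - m z *\<^sub>R \<xi> z))\<^sup>2 / 2 * (h 0 y)\<^sup>2 * k z y) = 0"
        then have "(norm (u z - m z *\<^sub>R \<xi> z))\<^sup>2 / 2 * (h 0 y)\<^sup>2 * k z y \<le> 0"
          by (simp add: ennreal_eq_0_iff)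
        moreover have "0 < (norm (u z - m z *\<^sub>R \<xi> z))\<^sup>2 / 2 * (h 0 y)\<^sup>2"
          using ne h[OF y, of 0] by simp
        ultimately have "k z y \<le> 0"
          using mult_pos_pos[of "(norm (u z - m z *\<^sub>R \<xi> z))\<^sup>2 / 2 * (h 0 y)\<^sup>2" "k z y"] by linarith
        then show "ennreal (k z y) = 0" by (rule ennreal_neg)
      qed
      then have "(\<integral>\<^sup>+y. ennreal (k z y) \<partial>B) = (\<integral>\<^sup>+y. 0 \<partial>B)" by (rule nn_integral_cong_AE)
      then show False using k1[OF z] by simp
    qed
  qed
qed

section \<open>Gaussian integrals\<close>

lemma fx_nonneg [simp]: "0 \<le> fx \<theta> \<eta> x"
  by (simp add: fx_def)

lemma borel_measurable_fx [measurable (raw)]: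
  fixes \<theta> x :: "'a \<Rightarrow> real ^ 'p"
  assumes [measurable]: "\<theta> \<in> borel_measurable M" "\<eta> \<in> borel_measurable M" "x \<in> borel_measurable M"
  shows "(\<lambda>w. fx (\<theta> w) (\<eta> w) (x w)) \<in> borel_measurable M"
  unfolding fx_def by measurable

lemma nn_integral_fx:
  fixes \<theta> :: "real ^ 'p"
  assumes "0 < \<eta>"
  shows "(\<integral>\<^sup>+x. ennreal (fx \<theta> \<eta> x) \<partial>lborel) = 1"
proof -
  let ?n = "\<lambda>b. normal_density (\<theta> \<bullet> b) (1 / sqrt \<eta>)"
  have B: "Basis = range (\<lambda>i::'p. axis i (1::real))"
    by (auto simp: Basis_vec_def)
  have inj: "inj (\<lambda>i::'p. axis i (1::real))"
    by (auto simp: inj_on_def axis_eq_axis)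
  have "ennreal (fx \<theta> \<eta> x) = (\<Prod>b\<in>Basis. ennreal (?n b (x \<bullet> b)))" for x
    unfolding fx_eq_prod_normal_density[OF assms] B
    by (simp add: prod.reindex[OF inj] inner_axis prod_ennreal)
  then have "(\<integral>\<^sup>+x. ennreal (fx \<theta> \<eta> x) \<partial>lborel) = (\<Prod>b\<in>Basis. \<integral>\<^sup>+t. ennreal (?n b t) \<partial>lborel)"
    using nn_integral_lborel_prod[of "\<lambda>b t. ennreal (?n b t)"] by simp
  also have "\<dots> = 1"
    using assms by (intro prod.neutral ballI) (subst nn_integral_eq_integral, auto)
  finally show ?thesis .
qed

lemma fx_eq_centred: "fx \<theta> \<eta> x = fx 0 \<eta> (x - \<theta>)"
  by (simp add: fx_def)

lemma fx_uminus: "fx 0 \<eta> (- x) = fx 0 \<eta> x"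
  by (simp add: fx_def)

text \<open>
  Half of the exponent is kept as a Gaussian density of half the precision; the other half absorbs any
  polynomial. Hence moments can be bounded without being computed, with the correct power of \<open>\<eta>\<close>.
\<close>

lemma fx_split_precision:
  fixes x :: "real ^ 'p"
  assumes "0 < \<eta>"
  shows "fx 0 \<eta> x = 2 powr (CARD('p) / 2) * exp (- (\<eta> * (norm x)\<^sup>2 / 4)) * fx 0 (\<eta> / 2) x"
proof -
  have "\<eta> powr (CARD('p) / 2) = 2 powr (CARD('p) / 2) * (\<eta> / 2) powr (CARD('p) / 2)"
    using assms by (simp add: powr_mult[symmetric])
  moreover have "exp (- (\<eta> / 2) * (norm x)\<^sup>2) = exp (- (\<eta> * (norm x)\<^sup>2 / 4)) * exp (- (\<eta> / 2 / 2) * (norm x)\<^sup>2)"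
    by (simp add: exp_add[symmetric])
  ultimately show ?thesis by (simp add: fx_def)
qed

lemma power_mult_exp_minus_le:
  fixes t :: real
  assumes "0 \<le> t"
  shows "t ^ m * exp (- t) \<le> fact m"
proof -
  have "t ^ m / fact m \<le> exp t"
    using sum_le_suminf[OF summable_exp_generic[of t], of "{m}"] assms
    by (simp add: exp_def scaleR_conv_of_real divide_inverse mult.commute)
  then show ?thesis by (simp add: exp_minus field_simps)
qed

lemma nn_integral_norm_power_fx_le:
  assumes "0 < \<eta>"
  shows "(\<integral>\<^sup>+x. ennreal ((norm x)\<^sup>2 ^ m * fx 0 \<eta> x) \<partial>(lborel :: (real ^ 'p) measure))
    \<le> ennreal (fact m * 4 ^ m * 2 powr (CARD('p) / 2) / \<eta> ^ m)"
proof -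
  let ?C = "fact m * 4 ^ m * 2 powr (CARD('p) / 2) / \<eta> ^ m"
  have "(norm x)\<^sup>2 ^ m * fx 0 \<eta> x \<le> ?C * fx 0 (\<eta> / 2) x" for x :: "real ^ 'p"
  proof -
    have "(\<eta> * (norm x)\<^sup>2 / 4) ^ m * exp (- (\<eta> * (norm x)\<^sup>2 / 4)) \<le> fact m"
      using assms by (intro power_mult_exp_minus_le) simp
    then have "(norm x)\<^sup>2 ^ m * exp (- (\<eta> * (norm x)\<^sup>2 / 4)) \<le> fact m * 4 ^ m / \<eta> ^ m"
      using assms by (simp add: power_mult_distrib power_divide field_simps)
    then have "(norm x)\<^sup>2 ^ m * exp (- (\<eta> * (norm x)\<^sup>2 / 4)) * (2 powr (CARD('p) / 2) * fx 0 (\<eta> / 2) x)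
        \<le> fact m * 4 ^ m / \<eta> ^ m * (2 powr (CARD('p) / 2) * fx 0 (\<eta> / 2) x)"
      by (intro mult_right_mono) auto
    then show ?thesis
      by (simp add: fx_split_precision[OF assms, of x] mult_ac)
  qed
  then have "(\<integral>\<^sup>+x. ennreal ((norm x)\<^sup>2 ^ m * fx 0 \<eta> x) \<partial>(lborel :: (real ^ 'p) measure))
      \<le> (\<integral>\<^sup>+x. ennreal ?C * ennreal (fx 0 (\<eta> / 2) x) \<partial>(lborel :: (real ^ 'p) measure))"
    using assms by (intro nn_integral_mono) (auto simp flip: ennreal_mult' intro!: ennreal_leI)
  also have "\<dots> = ennreal ?C"
    using assms by (simp add: nn_integral_cmult nn_integral_fx)
  finally show ?thesis .
qed

lemma nn_integral_lborel_reflect: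
  fixes f :: "'v::euclidean_space \<Rightarrow> ennreal"
  assumes [measurable]: "f \<in> borel_measurable borel"
  shows "(\<integral>\<^sup>+x. f (t - x) \<partial>lborel) = (\<integral>\<^sup>+x. f x \<partial>lborel)"
  by (subst (2) lborel_affine[of "-1" t]) (simp_all add: nn_integral_density nn_integral_distr)

lemma nn_integral_lborel_shift:
  fixes f :: "'v::euclidean_space \<Rightarrow> ennreal"
  assumes [measurable]: "f \<in> borel_measurable borel"
  shows "(\<integral>\<^sup>+x. f (t + x) \<partial>lborel) = (\<integral>\<^sup>+x. f x \<partial>lborel)"
  by (subst (2) lborel_affine[of 1 t]) (simp_all add: nn_integral_density nn_integral_distr)

text \<open>
  Averaging the integrand over \<open>\<theta> - \<mu>\<close> and its reflection removes the cross term by the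
  parallelogram law, so no integrability has to be discussed.
\<close>

lemma bias_variance:
  fixes \<mu> d :: "real ^ 'p"
  assumes "0 < \<eta>"
  shows "(\<integral>\<^sup>+\<theta>. ennreal ((norm (d - \<theta>))\<^sup>2 * fx \<mu> \<eta> \<theta>) \<partial>lborel)
    = ennreal ((norm (d - \<mu>))\<^sup>2)
      + (\<integral>\<^sup>+z. ennreal ((norm z)\<^sup>2 * fx 0 \<eta> z) \<partial>(lborel :: (real ^ 'p) measure))"
    (is "?I = ?b + ?V")
proof -
  have "?I = (\<integral>\<^sup>+z. ennreal ((norm (d - \<mu> - z))\<^sup>2 * fx 0 \<eta> z) \<partial>lborel)"
    by (subst nn_integral_lborel_shift[of _ \<mu>, symmetric]) (auto simp: fx_eq_centred[of \<mu>] diff_diff_eq)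
  moreover have "\<dots> = (\<integral>\<^sup>+z. ennreal ((norm (d - \<mu> + z))\<^sup>2 * fx 0 \<eta> z) \<partial>lborel)"
    by (subst nn_integral_lborel_reflect[of _ 0, symmetric]) (auto simp: fx_uminus)
  ultimately have "?I + ?I = (\<integral>\<^sup>+z. ennreal ((norm (d - \<mu> - z))\<^sup>2 * fx 0 \<eta> z)
      + ennreal ((norm (d - \<mu> + z))\<^sup>2 * fx 0 \<eta> z) \<partial>lborel)"
    by (subst nn_integral_add) auto
  also have "\<dots> = (\<integral>\<^sup>+z. ennreal (2 * (norm (d - \<mu>))\<^sup>2) * ennreal (fx 0 \<eta> z) + 2 * ennreal ((norm z)\<^sup>2 * fx 0 \<eta> z)
      \<partial>(lborel :: (real ^ 'p) measure))"
  proof (rule nn_integral_cong)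
    fix z :: "real ^ 'p"
    have "(norm (d - \<mu> - z))\<^sup>2 + (norm (d - \<mu> + z))\<^sup>2 = 2 * (norm (d - \<mu>))\<^sup>2 + 2 * (norm z)\<^sup>2"
      by (simp add: power2_norm_eq_inner inner_diff_left inner_diff_right inner_add_left inner_add_right)
    then have "(norm (d - \<mu> - z))\<^sup>2 * fx 0 \<eta> z + (norm (d - \<mu> + z))\<^sup>2 * fx 0 \<eta> z
        = 2 * (norm (d - \<mu>))\<^sup>2 * fx 0 \<eta> z + 2 * ((norm z)\<^sup>2 * fx 0 \<eta> z)"
      unfolding distrib_right[symmetric] by (simp add: distrib_right mult.assoc)
    then show "ennreal ((norm (d - \<mu> - z))\<^sup>2 * fx 0 \<eta> z) + ennreal ((norm (d - \<mu> + z))\<^sup>2 * fx 0 \<eta> z)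
        = ennreal (2 * (norm (d - \<mu>))\<^sup>2) * ennreal (fx 0 \<eta> z) + 2 * ennreal ((norm z)\<^sup>2 * fx 0 \<eta> z)"
      by (simp add: ennreal_mult'[symmetric] ennreal_plus[symmetric] ennreal_numeral[symmetric]
          del: ennreal_plus ennreal_numeral)
  qed
  also have "\<dots> = ennreal (2 * (norm (d - \<mu>))\<^sup>2) + 2 * ?V"
    using assms by (subst nn_integral_add) (auto simp: nn_integral_cmult nn_integral_fx)
  also have "\<dots> = 2 * (?b + ?V)"
    by (simp add: distrib_left ennreal_mult'')
  finally have "2 * ?I = 2 * (?b + ?V)" by (simp add: mult_2)
  then show ?thesis
    unfolding ennreal_mult_cancel_left by simp
qed

lemma integral_fx_scaleR:
  fixes \<mu> :: "real ^ 'p"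
  assumes "0 < \<eta>"
  shows "integrable lborel (\<lambda>\<theta>. fx \<mu> \<eta> \<theta>)" "(\<integral>\<theta>. fx \<mu> \<eta> \<theta> \<partial>lborel) = 1"
    "integrable lborel (\<lambda>\<theta>. fx \<mu> \<eta> \<theta> *\<^sub>R \<theta>)" "(\<integral>\<theta>. fx \<mu> \<eta> \<theta> *\<^sub>R \<theta> \<partial>lborel) = \<mu>"
proof -
  show i0: "integrable lborel (\<lambda>\<theta>. fx \<mu> \<eta> \<theta>)"
    by (rule integrableI_nonneg) (auto simp: nn_integral_fx[OF assms])
  show i1: "(\<integral>\<theta>. fx \<mu> \<eta> \<theta> \<partial>lborel) = 1"
    using i0 nn_integral_fx[OF assms, of \<mu>] by (simp add: integral_eq_nn_integral)
  have "(\<integral>\<^sup>+\<theta>. ennreal ((norm (0 - \<theta>))\<^sup>2 * fx \<mu> \<eta> \<theta>) \<partial>lborel) < \<infinity>"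
    unfolding bias_variance[OF assms]
    using nn_integral_norm_power_fx_le[OF assms, of 1, where 'p = 'p] by (auto simp: less_top[symmetric] top_unique)
  then have "integrable lborel (\<lambda>\<theta>. (norm \<theta>)\<^sup>2 * fx \<mu> \<eta> \<theta>)"
    by (intro integrableI_nonneg) auto
  then have i2: "integrable lborel (\<lambda>\<theta>. fx \<mu> \<eta> \<theta> + (norm \<theta>)\<^sup>2 * fx \<mu> \<eta> \<theta>)" using i0 by simp
  show i3: "integrable lborel (\<lambda>\<theta>. fx \<mu> \<eta> \<theta> *\<^sub>R \<theta>)"
  proof (rule Bochner_Integration.integrable_bound[OF i2])
    have "norm \<theta> \<le> 1 + (norm \<theta>)\<^sup>2" for \<theta> :: "real ^ 'p"
      using zero_le_power2[of "norm \<theta> - 1"] norm_ge_zero[of \<theta>] unfolding power2_diff one_power2 by linarith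
    from mult_right_mono[OF this fx_nonneg]
    show "AE \<theta> in lborel. norm (fx \<mu> \<eta> \<theta> *\<^sub>R \<theta>) \<le> norm (fx \<mu> \<eta> \<theta> + (norm \<theta>)\<^sup>2 * fx \<mu> \<eta> \<theta>)"
      by (intro AE_I2) (simp add: algebra_simps)
  qed auto
  have "(\<integral>\<theta>. fx \<mu> \<eta> \<theta> *\<^sub>R \<theta> \<partial>lborel) = (\<integral>\<theta>. fx \<mu> \<eta> (2 *\<^sub>R \<mu> - \<theta>) *\<^sub>R (2 *\<^sub>R \<mu> - \<theta>) \<partial>lborel)"
    by (subst lborel_affine[of "-1" "2 *\<^sub>R \<mu>"]) (simp_all add: density_1 integral_distr)
  also have "\<dots> = (\<integral>\<theta>. (2 * fx \<mu> \<eta> \<theta>) *\<^sub>R \<mu> - fx \<mu> \<eta> \<theta> *\<^sub>R \<theta> \<partial>lborel)"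
  proof (rule Bochner_Integration.integral_cong[OF refl])
    fix \<theta>
    have "fx \<mu> \<eta> (2 *\<^sub>R \<mu> - \<theta>) = fx \<mu> \<eta> \<theta>"
      using fx_uminus[of \<eta> "\<theta> - \<mu>"] by (simp add: fx_eq_centred[of \<mu>] scaleR_2)
    then show "fx \<mu> \<eta> (2 *\<^sub>R \<mu> - \<theta>) *\<^sub>R (2 *\<^sub>R \<mu> - \<theta>) = (2 * fx \<mu> \<eta> \<theta>) *\<^sub>R \<mu> - fx \<mu> \<eta> \<theta> *\<^sub>R \<theta>"
      by (simp add: scaleR_right_diff_distrib mult.commute)
  qed
  also have "\<dots> = 2 *\<^sub>R \<mu> - (\<integral>\<theta>. fx \<mu> \<eta> \<theta> *\<^sub>R \<theta> \<partial>lborel)"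
    using i0 i3 i1 by simp
  finally have "2 *\<^sub>R (\<integral>\<theta>. fx \<mu> \<eta> \<theta> *\<^sub>R \<theta> \<partial>lborel) = 2 *\<^sub>R \<mu>"
    by (simp add: scaleR_2)
  then show "(\<integral>\<theta>. fx \<mu> \<eta> \<theta> *\<^sub>R \<theta> \<partial>lborel) = \<mu>" by simp
qed

text \<open>
  Normal conjugacy: sampling density times prior density equals posterior density times marginal density.
\<close>

lemma fx_mult_fx:
  fixes x \<theta> :: "real ^ 'p"
  assumes "0 < \<eta>" "0 < l" "l < 1"
  shows "fx \<theta> \<eta> x * fx 0 (\<eta> * (l / (1 - l))) \<theta>
    = fx ((1 - l) *\<^sub>R x) (\<eta> / (1 - l)) \<theta> * fx 0 (\<eta> * l) x"
proof -
  have "- (\<eta> / 2) * (norm (x - \<theta>))\<^sup>2 + - (\<eta> * (l / (1 - l)) / 2) * (norm (\<theta> - 0))\<^sup>2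
      = - (\<eta> / (1 - l) / 2) * (norm (\<theta> - (1 - l) *\<^sub>R x))\<^sup>2 + - (\<eta> * l / 2) * (norm (x - 0))\<^sup>2"
    unfolding power2_norm_eq_inner inner_diff_left inner_diff_right inner_scaleR_left inner_scaleR_right
    using assms by (simp add: inner_commute[of x \<theta>] field_simps)
  then have "exp (- (\<eta> / 2) * (norm (x - \<theta>))\<^sup>2) * exp (- (\<eta> * (l / (1 - l)) / 2) * (norm (\<theta> - 0))\<^sup>2)
      = exp (- (\<eta> / (1 - l) / 2) * (norm (\<theta> - (1 - l) *\<^sub>R x))\<^sup>2) * exp (- (\<eta> * l / 2) * (norm (x - 0))\<^sup>2)"
    by (simp only: exp_add[symmetric])
  moreover have "\<eta> powr (CARD('p) / 2) * (\<eta> * (l / (1 - l))) powr (CARD('p) / 2)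
      = (\<eta> / (1 - l)) powr (CARD('p) / 2) * (\<eta> * l) powr (CARD('p) / 2)"
    by (simp add: powr_mult[symmetric])
  ultimately show ?thesis
    unfolding fx_def by (simp add: field_simps)
qed

section \<open>One-dimensional integrals\<close>

lemma nn_integral_restrict_lborel:
  fixes f :: "real \<Rightarrow> ennreal"
  assumes "S \<in> sets borel"
  shows "(\<integral>\<^sup>+x. f x \<partial>restrict_space lborel S) = (\<integral>\<^sup>+x. f x * indicator S x \<partial>lborel)"
  using assms by (intro nn_integral_restrict_space) simp

lemma nn_integral_powr_exp:
  fixes q c :: real
  assumes "0 < q" "0 < c"
  shows "(\<integral>\<^sup>+u. ennreal (u powr (q - 1) * exp (- (c * u))) \<partial>restrict_space lborel {0<..}) = ennreal (Gamma q / c powr q)"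
proof -
  let ?g = "\<lambda>u::real. ennreal (u powr (q - 1) * exp (- u)) * indicator {0<..} u"
  have "ennreal (Gamma q) = (\<integral>\<^sup>+u. ?g u \<partial>lborel)"
    unfolding Gamma_conv_nn_integral_real[OF assms(1)]
    using AE_lborel_singleton[of "0::real"]
    by (intro nn_integral_cong_AE) (auto elim!: eventually_mono simp: indicator_def exp_minus field_simps)
  also have "\<dots> = ennreal c * (\<integral>\<^sup>+u. ?g (0 + c * u) \<partial>lborel)"
    using assms by (subst nn_integral_real_affine[of _ c 0]) auto
  also have "(\<integral>\<^sup>+u. ?g (0 + c * u) \<partial>lborel)
      = (\<integral>\<^sup>+u. ennreal (c powr (q - 1)) * (ennreal (u powr (q - 1) * exp (- (c * u))) * indicator {0<..} u) \<partial>lborel)"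
    using assms by (intro nn_integral_cong) (auto simp: indicator_def powr_mult zero_less_mult_iff mult.assoc simp flip: ennreal_mult')
  also have "\<dots> = ennreal (c powr (q - 1)) * (\<integral>\<^sup>+u. ennreal (u powr (q - 1) * exp (- (c * u))) * indicator {0<..} u \<partial>lborel)"
    by (rule nn_integral_cmult) simp
  also have "ennreal c * (ennreal (c powr (q - 1)) * (\<integral>\<^sup>+u. ennreal (u powr (q - 1) * exp (- (c * u))) * indicator {0<..} u \<partial>lborel))
      = ennreal (c powr q) * (\<integral>\<^sup>+u. ennreal (u powr (q - 1) * exp (- (c * u))) \<partial>restrict_space lborel {0<..})"
    using assms by (simp add: nn_integral_restrict_lborel mult.assoc[symmetric] powr_mult_base flip: ennreal_mult')
  finally have e: "ennreal (Gamma q) = ennreal (c powr q) * (\<integral>\<^sup>+u. ennreal (u powr (q - 1) * exp (- (c * u))) \<partial>restrict_space lborel {0<..})" .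
  have "ennreal (Gamma q / c powr q) = ennreal (1 / c powr q) * ennreal (Gamma q)"
    using assms by (simp flip: ennreal_mult')
  also have "\<dots> = (\<integral>\<^sup>+u. ennreal (u powr (q - 1) * exp (- (c * u))) \<partial>restrict_space lborel {0<..})"
    unfolding e using assms by (simp add: mult.assoc[symmetric] ennreal_mult'[symmetric])
  finally show ?thesis ..
qed

text \<open>
  The integrand is the derivative of \<open>ln \<eta> / (1 + |ln \<eta>|)\<close>, which increases from \<open>-1\<close> to \<open>1\<close>. The
  absolute value does no harm: \<open>t / (1 + |t|)\<close> is differentiable at \<open>0\<close> as well.
\<close>

lemma nn_integral_inverse_log_square:
  "(\<integral>\<^sup>+\<eta>. ennreal (1 / (\<eta> * (1 + \<bar>ln \<eta>\<bar>)\<^sup>2)) \<partial>restrict_space lborel {0<..}) < \<infinity>"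
proof -
  define F :: "real \<Rightarrow> real" where "F = (\<lambda>\<eta>. ln \<eta> / (1 + \<bar>ln \<eta>\<bar>))"
  have G: "((\<lambda>t::real. t / (1 + \<bar>t\<bar>)) has_field_derivative 1 / (1 + \<bar>t\<bar>)\<^sup>2) (at t)" for t
  proof -
    consider "t > 0" | "t < 0" | "t = 0" by linarith
    then show ?thesis
    proof cases
      case 1
      have "((\<lambda>t::real. t / (1 + t)) has_field_derivative 1 / (1 + \<bar>t\<bar>)\<^sup>2) (at t)"
        using 1 by (auto intro!: derivative_eq_intros simp: power2_eq_square field_simps)
      then show ?thesis
        using 1 by (subst DERIV_cong_ev[OF refl _ refl, where g = "\<lambda>t. t / (1 + t)"])
          (auto intro!: eventually_mono[OF eventually_nhds_in_open[of "{0<..}" t]])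
    next
      case 2
      have "((\<lambda>t::real. t / (1 - t)) has_field_derivative 1 / (1 + \<bar>t\<bar>)\<^sup>2) (at t)"
        using 2 by (auto intro!: derivative_eq_intros simp: power2_eq_square field_simps)
      then show ?thesis
        using 2 by (subst DERIV_cong_ev[OF refl _ refl, where g = "\<lambda>t. t / (1 - t)"])
          (auto intro!: eventually_mono[OF eventually_nhds_in_open[of "{..<0}" t]])
    next
      case 3
      have "((\<lambda>t::real. 1 / (1 + \<bar>t\<bar>)) \<longlongrightarrow> 1 / (1 + \<bar>0\<bar>)) (at 0)"
        by (intro tendsto_intros) auto
      then have "((\<lambda>t::real. t / (1 + \<bar>t\<bar>) / t) \<longlongrightarrow> 1) (at 0)"
        by (subst (asm) tendsto_cong[of _ "\<lambda>t. t / (1 + \<bar>t\<bar>) / t"])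
          (auto simp: eventually_at_topological intro!: exI[of _ UNIV])
      then show ?thesis unfolding 3 by (simp add: has_field_derivative_iff)
    qed
  qed
  have "set_integrable lborel (einterval 0 \<infinity>) (\<lambda>\<eta>::real. 1 / (\<eta> * (1 + \<bar>ln \<eta>\<bar>)\<^sup>2))"
  proof (rule interval_integral_FTC_nonneg(1)[where F = F and A = "-1" and B = 1])
    show "(F has_field_derivative 1 / (x * (1 + \<bar>ln x\<bar>)\<^sup>2)) (at x)" if "0 < ereal x" for x
      using DERIV_chain2[OF G[of "ln x"] DERIV_ln[of x]] that
      by (simp add: F_def divide_inverse mult.commute)
    show "isCont (\<lambda>\<eta>::real. 1 / (\<eta> * (1 + \<bar>ln \<eta>\<bar>)\<^sup>2)) x" if "0 < ereal x" for x
      using that by (auto intro!: continuous_intros)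
    have "((\<lambda>t::real. - 1 + inverse (1 + - t)) \<longlongrightarrow> - 1 + 0) at_bot"
      by (intro tendsto_add tendsto_const tendsto_inverse_0_at_top
          filterlim_tendsto_add_at_top[OF tendsto_const] filterlim_uminus_at_top_at_bot)
    moreover have "\<forall>\<^sub>F t in at_bot. - 1 + inverse (1 + - t) = (t::real) / (1 + \<bar>t\<bar>)"
      using eventually_le_at_bot[of "0::real"] by eventually_elim (simp add: field_simps)
    ultimately have m1: "((\<lambda>t::real. t / (1 + \<bar>t\<bar>)) \<longlongrightarrow> - 1 + 0) at_bot"
      by (rule Lim_transform_eventually)
    have "(F \<longlongrightarrow> -1) (at_right 0)"
      using filterlim_compose[OF m1 ln_at_0] by (simp add: F_def)
    then show "((F \<circ> real_of_ereal) \<longlongrightarrow> - 1) (at_right 0)"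
      unfolding zero_ereal_def by (simp only: ereal_tendsto_simps)
    have "((\<lambda>t::real. 1 - inverse (1 + t)) \<longlongrightarrow> 1 - 0) at_top"
      by (intro tendsto_diff tendsto_const tendsto_inverse_0_at_top
          filterlim_tendsto_add_at_top[OF tendsto_const] filterlim_ident)
    moreover have "\<forall>\<^sub>F t in at_top. 1 - inverse (1 + t) = (t::real) / (1 + \<bar>t\<bar>)"
      using eventually_ge_at_top[of "0::real"] by eventually_elim (simp add: field_simps)
    ultimately have p1: "((\<lambda>t::real. t / (1 + \<bar>t\<bar>)) \<longlongrightarrow> 1 - 0) at_top"
      by (rule Lim_transform_eventually)
    have "(F \<longlongrightarrow> 1) at_top"
      using filterlim_compose[OF p1 ln_at_top] by (simp add: F_def)
    then show "((F \<circ> real_of_ereal) \<longlongrightarrow> 1) (at_left \<infinity>)"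
      by (simp only: ereal_tendsto_simps)
  qed auto
  also have "einterval 0 \<infinity> = {0<..}" by (auto simp: einterval_def)
  finally have si: "set_integrable lborel {0<..} (\<lambda>\<eta>::real. 1 / (\<eta> * (1 + \<bar>ln \<eta>\<bar>)\<^sup>2))" .
  have "{0<..} \<inter> space lborel \<in> sets (lborel :: real measure)" by simp
  from Bochner_Integration.integrable_restrict_space[OF this] si
  have "integrable (restrict_space lborel {0<..}) (\<lambda>\<eta>::real. 1 / (\<eta> * (1 + \<bar>ln \<eta>\<bar>)\<^sup>2))"
    unfolding set_integrable_def by blast
  then have "(\<integral>\<^sup>+\<eta>. ennreal (norm (1 / (\<eta> * (1 + \<bar>ln \<eta>\<bar>)\<^sup>2) :: real)) \<partial>restrict_space lborel {0<..}) < \<infinity>"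
    unfolding integrable_iff_bounded by (rule conjunct2)
  also have "(\<integral>\<^sup>+\<eta>. ennreal (norm (1 / (\<eta> * (1 + \<bar>ln \<eta>\<bar>)\<^sup>2) :: real)) \<partial>restrict_space lborel {0<..})
      = (\<integral>\<^sup>+\<eta>. ennreal (1 / (\<eta> * (1 + \<bar>ln \<eta>\<bar>)\<^sup>2)) \<partial>restrict_space lborel {0<..})"
    by (intro nn_integral_cong) (auto simp: space_restrict_space abs_mult)
  finally show ?thesis .
qed

lemma nn_integral_beta_density_finite:
  assumes "-1 < a" "-1 < b"
  shows "(\<integral>\<^sup>+l. ennreal (beta_density a b l) \<partial>restrict_space lborel {0<..<1}) < \<infinity>"
proof -
  let ?g = "\<lambda>t::real. t powr a * (1 - t) powr b" and ?c = "1 / Beta (a + 1) (b + 1)"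
  have "set_integrable lborel {0..1} ?g"
    using integrable_Beta[of "a + 1" "b + 1"] assms by simp
  then have "set_integrable lborel {0<..<1} ?g"
    by (rule set_integrable_subset) auto
  then have "integrable (restrict_space lborel {0<..<1}) ?g"
    by (subst Bochner_Integration.integrable_restrict_space) (auto simp: set_integrable_def)
  then have "integrable (restrict_space lborel {0<..<1}) (\<lambda>t. ?c * ?g t)"
    by (rule integrable_mult_right)
  then have "integrable (restrict_space lborel {0<..<1}) (beta_density a b)"
    unfolding beta_density_def[abs_def] by (simp only: times_divide_eq_left mult_1)
  then have "(\<integral>\<^sup>+l. ennreal (norm (beta_density a b l)) \<partial>restrict_space lborel {0<..<1}) < \<infinity>"
    unfolding integrable_iff_bounded by (rule conjunct2)
  moreover have "(\<integral>\<^sup>+l. ennreal (beta_density a b l) \<partial>restrict_space lborel {0<..<1})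
      \<le> (\<integral>\<^sup>+l. ennreal (norm (beta_density a b l)) \<partial>restrict_space lborel {0<..<1})"
    by (intro nn_integral_mono ennreal_leI) simp
  ultimately show ?thesis by (rule le_less_trans[rotated])
qed

section \<open>The joint law of observation and hyperparameters\<close>

lemma borel_measurable_fst_restrict [measurable (raw)]:
  assumes "f \<in> M \<rightarrow>\<^sub>M restrict_space lborel S \<Otimes>\<^sub>M N"
  shows "(\<lambda>x. fst (f x)) \<in> borel_measurable M"
proof -
  have "(\<lambda>x. fst (f x)) \<in> M \<rightarrow>\<^sub>M restrict_space lborel S"
    using assms by (rule measurable_fst')
  then have "(\<lambda>x. fst (f x)) \<in> M \<rightarrow>\<^sub>M lborel"
    by (simp add: measurable_restrict_space2_iff)
  then show ?thesis by simp
qed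

lemma borel_measurable_snd_restrict [measurable (raw)]:
  assumes "f \<in> M \<rightarrow>\<^sub>M N \<Otimes>\<^sub>M restrict_space lborel S"
  shows "(\<lambda>x. snd (f x)) \<in> borel_measurable M"
proof -
  have "(\<lambda>x. snd (f x)) \<in> M \<rightarrow>\<^sub>M restrict_space lborel S"
    using assms by (rule measurable_snd')
  then have "(\<lambda>x. snd (f x)) \<in> M \<rightarrow>\<^sub>M lborel"
    by (simp add: measurable_restrict_space2_iff)
  then show ?thesis by simp
qed

lemma borel_measurable_ident_restrict [measurable (raw)]:
  "(\<lambda>x. x) \<in> borel_measurable (restrict_space lborel S)"
  by (rule measurable_restrict_space1) simp

abbreviation obs :: "((real ^ 'p) \<times> real) measure" where
  "obs \<equiv> lborel \<Otimes>\<^sub>M restrict_space lborel {0<..}"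

abbreviation hyper :: "(real \<times> real) measure" where
  "hyper \<equiv> restrict_space lborel {0<..} \<Otimes>\<^sub>M restrict_space lborel {0<..<1}"

lemma borel_measurable_fs [measurable (raw)]:
  assumes [measurable]: "\<eta> \<in> borel_measurable M" "s \<in> borel_measurable M"
  shows "(\<lambda>w. fs n (\<eta> w) (s w)) \<in> borel_measurable M"
  unfolding fs_def by measurable

lemma borel_measurable_beta_density [measurable]: "beta_density a b \<in> borel_measurable borel"
  unfolding beta_density_def[abs_def] by measurable

text \<open>
  The joint density of \<open>z = (x, s)\<close> and \<open>y = (\<eta>, l)\<close> once \<open>\<theta>\<close> is integrated out. The factor \<open>\<eta>\<close> of the
  loss is included, and it cancels the \<open>1 / \<eta>\<close> of the prior.
\<close>

definition joint :: "nat \<Rightarrow> real \<Rightarrow> real \<Rightarrow> (real ^ 'p) \<times> real \<Rightarrow> real \<times> real \<Rightarrow> real" where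
  "joint n a b z y = fx 0 (fst y * snd y) (fst z) * fs n (fst y) (snd z) * beta_density a b (snd y)"

lemma joint_measurable [measurable]:
  "(\<lambda>(z, y). joint n a b z y) \<in> borel_measurable ((obs :: ((real ^ 'p) \<times> real) measure) \<Otimes>\<^sub>M hyper)"
  unfolding joint_def by measurable

lemma sigma_finite_restrict_lborel:
  assumes "S \<in> sets borel"
  shows "sigma_finite_measure (restrict_space lborel S)"
  using assms by (intro sigma_finite_measure_restrict_space lborel.sigma_finite_measure_axioms) simp

interpretation obs: pair_sigma_finite "lborel :: (real ^ 'p) measure" "restrict_space lborel {0<..} :: real measure"
  by (intro pair_sigma_finite.intro lborel.sigma_finite_measure_axioms sigma_finite_restrict_lborel) simp

interpretation hyper: pair_sigma_finite "restrict_space lborel {0<..} :: real measure"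
    "restrict_space lborel {0<..<1} :: real measure"
  by (intro pair_sigma_finite.intro sigma_finite_restrict_lborel) simp_all

lemma (in pair_sigma_finite) nn_integral_prod_mult:
  assumes [measurable]: "f \<in> borel_measurable M1" "g \<in> borel_measurable M2"
  shows "(\<integral>\<^sup>+p. f (fst p) * g (snd p) \<partial>(M1 \<Otimes>\<^sub>M M2)) = (\<integral>\<^sup>+x. f x \<partial>M1) * (\<integral>\<^sup>+y. g y \<partial>M2)"
  by (subst M2.nn_integral_fst[symmetric]) (simp_all add: nn_integral_cmult nn_integral_multc)

lemma beta_density_pos:
  assumes "-1 < a" "-1 < b" "0 < l" "l < 1"
  shows "0 < beta_density a b l"
proof -
  have "0 < Beta (a + 1) (b + 1)"
    unfolding Beta_def using assms by (intro divide_pos_pos mult_pos_pos Gamma_real_pos) auto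
  then show ?thesis unfolding beta_density_def using assms by simp
qed

lemma fs_pos:
  assumes "0 < n" "0 < \<eta>" "0 < s"
  shows "0 < fs n \<eta> s"
  unfolding fs_def using assms by (intro mult_pos_pos divide_pos_pos Gamma_real_pos) auto

lemma fx_pos:
  assumes "0 < \<eta>"
  shows "0 < fx \<theta> \<eta> x"
  unfolding fx_def using assms by simp

lemma space_obs: "space obs = {z. 0 < snd z}"
  by (auto simp: space_pair_measure space_restrict_space)

lemma space_hyper: "space hyper = {y. 0 < fst y \<and> 0 < snd y \<and> snd y < 1}"
  by (auto simp: space_pair_measure space_restrict_space)

lemma nn_integral_fs_moment:
  assumes "0 < n" "0 < \<eta>" "0 < n / 2 + r"
  shows "(\<integral>\<^sup>+s. ennreal ((\<eta> * s) powr r * fs n \<eta> s) \<partial>restrict_space lborel {0<..})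
    = ennreal (Gamma (n / 2 + r) * 2 powr r / Gamma (n / 2))"
proof -
  let ?K = "\<eta> powr (n / 2 + r) / (Gamma (n / 2) * 2 powr (n / 2))"
  have G: "0 < Gamma (real n / 2)" using assms by (intro Gamma_real_pos) simp
  have "(\<integral>\<^sup>+s. ennreal ((\<eta> * s) powr r * fs n \<eta> s) \<partial>restrict_space lborel {0<..})
    = (\<integral>\<^sup>+s. ennreal ?K * ennreal (s powr (n / 2 + r - 1) * exp (- (\<eta> / 2 * s))) \<partial>restrict_space lborel {0<..})"
  proof (intro nn_integral_cong)
    fix s :: real assume "s \<in> space (restrict_space lborel {0<..})"
    then have s: "0 < s" by (simp add: space_restrict_space)
    have "s powr (n / 2 + r - 1) = s powr r * s powr (n / 2 - 1)"
      by (simp flip: powr_add add: algebra_simps)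
    then show "ennreal ((\<eta> * s) powr r * fs n \<eta> s)
        = ennreal ?K * ennreal (s powr (n / 2 + r - 1) * exp (- (\<eta> / 2 * s)))"
      using assms G s by (simp add: fs_def powr_mult powr_add mult_ac flip: ennreal_mult')
  qed
  also have "\<dots> = ennreal ?K * ennreal (Gamma (n / 2 + r) / (\<eta> / 2) powr (n / 2 + r))"
    using nn_integral_powr_exp[of "n / 2 + r" "\<eta> / 2"] assms by (subst nn_integral_cmult) simp_all
  also have "\<dots> = ennreal (Gamma (n / 2 + r) * 2 powr r / Gamma (n / 2))"
  proof -
    have "(\<eta> / 2) powr (n / 2 + r) = \<eta> powr (n / 2 + r) / 2 powr (n / 2 + r)"
      by (rule powr_divide)
    moreover have "2 powr (n / 2 + r) = 2 powr (n / 2) * (2 powr r :: real)" by (rule powr_add)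
    ultimately have "?K * (Gamma (n / 2 + r) / (\<eta> / 2) powr (n / 2 + r)) = Gamma (n / 2 + r) * 2 powr r / Gamma (n / 2)"
      using assms by simp
    then show ?thesis using G by (simp only: ennreal_mult'[symmetric] divide_nonneg_nonneg powr_ge_zero
        less_imp_le mult_nonneg_nonneg)
  qed
  finally show ?thesis .
qed

lemma joint_eq_gamma_kernel:
  fixes x :: "real ^ 'p"
  assumes "0 < \<eta>"
  shows "joint n a b (x, s) (\<eta>, l) =
      (l powr (CARD('p) / 2) / (2 * pi) powr (CARD('p) / 2)
       * (s powr (n / 2 - 1) / (Gamma (n / 2) * 2 powr (n / 2))) * beta_density a b l)
      * (\<eta> powr ((CARD('p) + n) / 2) * exp (- ((s + l * (norm x)\<^sup>2) / 2 * \<eta>)))"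
proof -
  have "exp (- ((s + l * (norm x)\<^sup>2) / 2 * \<eta>)) = exp (- (\<eta> * l / 2) * (norm (x - 0))\<^sup>2) * exp (- (\<eta> * s / 2))"
    by (simp add: field_simps flip: exp_add)
  moreover have "\<eta> powr ((CARD('p) + n) / 2) = \<eta> powr (CARD('p) / 2) * \<eta> powr (n / 2)"
    by (simp add: add_divide_distrib powr_add)
  ultimately show ?thesis
    by (simp add: joint_def fx_def fs_def powr_mult)
qed

text \<open>
  As a function of \<open>\<eta>\<close> the joint density is a Gamma kernel, so all its power moments are explicit. The
  factor in front does not involve the exponent \<open>r\<close> and drops out of ratios.
\<close>

lemma nn_integral_joint_powr:
  fixes x :: "real ^ 'p"
  assumes ab: "-1 < a" "-1 < b" and "0 < n" "0 < s" "0 < l" "l < 1"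
    and r: "0 < (CARD('p) + n) / 2 + 1 + r"
  shows "(\<integral>\<^sup>+\<eta>. ennreal (\<eta> powr r * joint n a b (x, s) (\<eta>, l)) \<partial>restrict_space lborel {0<..})
    = ennreal ((l powr (CARD('p) / 2) / (2 * pi) powr (CARD('p) / 2)
       * (s powr (n / 2 - 1) / (Gamma (n / 2) * 2 powr (n / 2))) * beta_density a b l)
       * (Gamma ((CARD('p) + n) / 2 + 1 + r) / ((s + l * (norm x)\<^sup>2) / 2) powr ((CARD('p) + n) / 2 + 1 + r)))"
    (is "_ = ennreal (?D * _)")
proof -
  let ?q = "(CARD('p) + n) / 2 + 1" and ?c = "(s + l * (norm x)\<^sup>2) / 2"
  have c: "0 < ?c" using assms by (simp add: add_pos_nonneg)
  have G: "0 < Gamma (real n / 2)" using assms by (intro Gamma_real_pos) simp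
  have D: "0 \<le> ?D"
    using G beta_density_pos[OF ab, of l] assms by (intro mult_nonneg_nonneg divide_nonneg_nonneg) auto
  have "(\<integral>\<^sup>+\<eta>. ennreal (\<eta> powr r * joint n a b (x, s) (\<eta>, l)) \<partial>restrict_space lborel {0<..})
    = (\<integral>\<^sup>+\<eta>. ennreal ?D * ennreal (\<eta> powr (?q + r - 1) * exp (- (?c * \<eta>))) \<partial>restrict_space lborel {0<..})"
  proof (intro nn_integral_cong)
    fix \<eta> :: real assume "\<eta> \<in> space (restrict_space lborel {0<..})"
    then have "0 < \<eta>" by (simp add: space_restrict_space)
    moreover have "\<eta> powr (?q + r - 1) = \<eta> powr r * \<eta> powr ((CARD('p) + n) / 2)"
      by (simp flip: powr_add add: algebra_simps)
    ultimately show "ennreal (\<eta> powr r * joint n a b (x, s) (\<eta>, l))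
        = ennreal ?D * ennreal (\<eta> powr (?q + r - 1) * exp (- (?c * \<eta>)))"
      by (simp only: joint_eq_gamma_kernel ennreal_mult'[OF D, symmetric]) (simp add: mult_ac)
  qed
  also have "\<dots> = ennreal ?D * ennreal (Gamma (?q + r) / ?c powr (?q + r))"
    using nn_integral_powr_exp[of "?q + r" ?c] r c by (subst nn_integral_cmult) simp_all
  finally show ?thesis using D by (simp only: ennreal_mult'[symmetric])
qed

text \<open>
  The normalizing constant of the posterior law of \<open>(\<eta>, l)\<close>.
\<close>

definition evidence :: "nat \<Rightarrow> real \<Rightarrow> real \<Rightarrow> (real ^ 'p) \<times> real \<Rightarrow> ennreal" where
  "evidence n a b z = (\<integral>\<^sup>+y. ennreal (joint n a b z y) \<partial>hyper)"

lemma evidence_measurable [measurable]: "evidence n a b \<in> borel_measurable obs"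
  unfolding evidence_def by measurable

lemma joint_section_measurable [measurable]: "joint n a b z \<in> borel_measurable hyper"
  unfolding joint_def[abs_def] by measurable

lemma joint_pos:
  fixes z :: "(real ^ 'p) \<times> real"
  assumes "-1 < a" "-1 < b" "0 < n" "z \<in> space obs" "y \<in> space hyper"
  shows "0 < joint n a b z y"
  using assms unfolding joint_def space_obs space_hyper
  by (auto intro!: mult_pos_pos fx_pos fs_pos beta_density_pos)

lemma evidence_pos:
  fixes z :: "(real ^ 'p) \<times> real"
  assumes "-1 < a" "-1 < b" "0 < n" "z \<in> space obs"
  shows "0 < evidence n a b z"
proof (rule ccontr)
  assume "\<not> 0 < evidence n a b z"
  then have "(\<integral>\<^sup>+y. ennreal (joint n a b z y) \<partial>hyper) = 0" by (simp add: evidence_def)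
  then have "AE y in hyper. ennreal (joint n a b z y) = 0"
    by (subst (asm) nn_integral_0_iff_AE) auto
  then have "AE y in hyper. False"
    by (rule AE_mp) (auto intro!: AE_I2 simp: ennreal_eq_0_iff not_le joint_pos[OF assms])
  then have "emeasure hyper (space hyper) = 0"
    using AE_iff_measurable[of "space hyper" hyper "\<lambda>_. False"] by simp
  moreover have "emeasure hyper (space hyper) = emeasure lborel {0::real<..} * emeasure lborel {0::real<..<1}"
    unfolding space_pair_measure hyper.M2.emeasure_pair_measure_Times[OF sets.top sets.top]
    by (simp add: emeasure_restrict_space space_restrict_space)
  moreover have "emeasure lborel {1::real<..<2} \<le> emeasure lborel {0::real<..}"
    by (intro emeasure_mono) auto
  ultimately show False by auto
qed

text \<open>
  For fixed \<open>l\<close> the posterior moment of \<open>\<eta> powr r\<close> is a constant times \<open>c powr (- r)\<close>, with \<open>c\<close> the rate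
  of the Gamma kernel. A bound on \<open>c powr (- r)\<close> that is uniform in \<open>l\<close> therefore survives the integration
  over \<open>l\<close>, whatever the posterior of \<open>l\<close> looks like.
\<close>

lemma nn_integral_tilted_joint_le:
  fixes x :: "real ^ 'p"
  assumes ab: "-1 < a" "-1 < b" and ns: "0 < n" "0 < s"
    and r: "0 < (CARD('p) + n) / 2 + 1 + r"
    and B: "\<And>l. 0 < l \<Longrightarrow> l < 1 \<Longrightarrow> ((s + l * (norm x)\<^sup>2) / 2) powr (- r) \<le> B"
  shows "(\<integral>\<^sup>+y. ennreal (fst y powr r * joint n a b (x, s) y) \<partial>hyper)
    \<le> ennreal (Gamma ((CARD('p) + n) / 2 + 1 + r) / Gamma ((CARD('p) + n) / 2 + 1) * B) * evidence n a b (x, s)"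
proof -
  let ?q = "(CARD('p) + n) / 2 + 1" and ?c = "\<lambda>l. (s + l * (norm x)\<^sup>2) / 2"
  let ?K = "Gamma (?q + r) / Gamma ?q"
  have G: "0 < Gamma ?q" "0 < Gamma (?q + r)" using r by (intro Gamma_real_pos; simp add: add_nonneg_pos)+
  have K: "0 \<le> ?K" using G by simp
  have "(\<integral>\<^sup>+y. ennreal (fst y powr r * joint n a b (x, s) y) \<partial>hyper)
      = (\<integral>\<^sup>+l. \<integral>\<^sup>+\<eta>. ennreal (\<eta> powr r * joint n a b (x, s) (\<eta>, l)) \<partial>restrict_space lborel {0<..} \<partial>restrict_space lborel {0<..<1})"
    by (subst hyper.nn_integral_snd[symmetric]) auto
  also have "\<dots> \<le> (\<integral>\<^sup>+l. ennreal (?K * B) * (\<integral>\<^sup>+\<eta>. ennreal (joint n a b (x, s) (\<eta>, l)) \<partial>restrict_space lborel {0<..}) \<partial>restrict_space lborel {0<..<1})"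
  proof (rule nn_integral_mono)
    fix l :: real assume "l \<in> space (restrict_space lborel {0<..<1})"
    then have l: "0 < l" "l < 1" by (auto simp: space_restrict_space)
    have c: "0 < ?c l" using l ns by (simp add: add_pos_nonneg)
    have B0: "0 \<le> B" using B[OF l] powr_ge_zero[of "?c l" "- r"] by linarith
    let ?D = "l powr (CARD('p) / 2) / (2 * pi) powr (CARD('p) / 2)
       * (s powr (n / 2 - 1) / (Gamma (n / 2) * 2 powr (n / 2))) * beta_density a b l"
    have D: "0 \<le> ?D"
      using Gamma_real_pos[of "n / 2"] beta_density_pos[OF ab l] ns by (intro mult_nonneg_nonneg divide_nonneg_nonneg) auto
    have q: "0 < ?q + 0" by (simp add: add_nonneg_pos)
    have E: "(\<integral>\<^sup>+\<eta>. ennreal (joint n a b (x, s) (\<eta>, l)) \<partial>restrict_space lborel {0<..})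
        = ennreal (?D * (Gamma ?q / ?c l powr ?q))"
    proof -
      have "(\<integral>\<^sup>+\<eta>. ennreal (joint n a b (x, s) (\<eta>, l)) \<partial>restrict_space lborel {0<..})
          = (\<integral>\<^sup>+\<eta>. ennreal (\<eta> powr 0 * joint n a b (x, s) (\<eta>, l)) \<partial>restrict_space lborel {0<..})"
        by (intro nn_integral_cong) (simp add: space_restrict_space)
      also have "\<dots> = ennreal (?D * (Gamma ?q / ?c l powr ?q))"
        using nn_integral_joint_powr[OF ab ns l q, of x] by simp
      finally show ?thesis .
    qed
    have "(\<integral>\<^sup>+\<eta>. ennreal (\<eta> powr r * joint n a b (x, s) (\<eta>, l)) \<partial>restrict_space lborel {0<..})
        = ennreal (?D * (Gamma (?q + r) / ?c l powr (?q + r)))"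
      by (rule nn_integral_joint_powr[OF ab ns l r])
    also have "Gamma (?q + r) / ?c l powr (?q + r) = ?K * ?c l powr (- r) * (Gamma ?q / ?c l powr ?q)"
    proof -
      have "B / (cq * cr) = B / A * inverse cr * (A / cq)" if "A \<noteq> 0" for A B cq cr :: real
        using that by (simp add: divide_inverse)
      from this[of "Gamma ?q"] show ?thesis
        using G(1) unfolding powr_add[of _ ?q r] powr_minus by (metis less_irrefl)
    qed
    also have "ennreal (?D * (?K * ?c l powr (- r) * (Gamma ?q / ?c l powr ?q)))
        \<le> ennreal (?D * (?K * B * (Gamma ?q / ?c l powr ?q)))"
      using B[OF l] G K D by (intro ennreal_leI mult_left_mono mult_right_mono) auto
    also have "\<dots> = ennreal (?K * B) * ennreal (?D * (Gamma ?q / ?c l powr ?q))"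
      by (simp only: ennreal_mult'[OF mult_nonneg_nonneg[OF K B0], symmetric]) (simp only: mult_ac)
    finally show "(\<integral>\<^sup>+\<eta>. ennreal (\<eta> powr r * joint n a b (x, s) (\<eta>, l)) \<partial>restrict_space lborel {0<..})
        \<le> ennreal (?K * B) * (\<integral>\<^sup>+\<eta>. ennreal (joint n a b (x, s) (\<eta>, l)) \<partial>restrict_space lborel {0<..})"
      unfolding E .
  qed
  also have "\<dots> = ennreal (?K * B) * evidence n a b (x, s)"
    unfolding evidence_def by (subst hyper.nn_integral_snd[symmetric]) (auto simp: nn_integral_cmult)
  finally show ?thesis .
qed

lemma evidence_finite:
  fixes z :: "(real ^ 'p) \<times> real"
  assumes ab: "-1 < a" "-1 < b" and "0 < n" "z \<in> space obs"
  shows "evidence n a b z < \<infinity>"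
proof -
  obtain x s where z: "z = (x, s)" by (cases z)
  have s: "0 < s" using assms by (simp add: z space_obs)
  let ?q = "(CARD('p) + n) / 2 + 1"
  have q: "0 < ?q + 0" by (simp add: add_nonneg_pos)
  then have Gq: "0 < Gamma ?q" using Gamma_real_pos[of ?q] by simp
  define D where "D = 1 / (2 * pi) powr (CARD('p) / 2) * (s powr (n / 2 - 1) / (Gamma (n / 2) * 2 powr (n / 2)))"
  have D: "0 \<le> D"
    using Gamma_real_pos[of "n / 2"] assms by (auto simp: D_def)
  have "evidence n a b z = (\<integral>\<^sup>+l. \<integral>\<^sup>+\<eta>. ennreal (joint n a b (x, s) (\<eta>, l)) \<partial>restrict_space lborel {0<..} \<partial>restrict_space lborel {0<..<1})"
    unfolding evidence_def z by (subst hyper.nn_integral_snd[symmetric]) auto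
  also have "\<dots> \<le> (\<integral>\<^sup>+l. ennreal (D * (Gamma ?q / (s / 2) powr ?q)) * ennreal (beta_density a b l) \<partial>restrict_space lborel {0<..<1})"
  proof (rule nn_integral_mono)
    fix l :: real assume "l \<in> space (restrict_space lborel {0<..<1})"
    then have l: "0 < l" "l < 1" by (auto simp: space_restrict_space)
    have "(\<integral>\<^sup>+\<eta>. ennreal (joint n a b (x, s) (\<eta>, l)) \<partial>restrict_space lborel {0<..})
        = (\<integral>\<^sup>+\<eta>. ennreal (\<eta> powr 0 * joint n a b (x, s) (\<eta>, l)) \<partial>restrict_space lborel {0<..})"
      by (intro nn_integral_cong) (simp add: space_restrict_space)
    also have "\<dots> = ennreal (l powr (CARD('p) / 2) * D * beta_density a b l * (Gamma ?q / ((s + l * (norm x)\<^sup>2) / 2) powr ?q))"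
      using nn_integral_joint_powr[OF ab assms(3) s l q, of x] by (simp add: D_def)
    also have "\<dots> \<le> ennreal (1 * D * beta_density a b l * (Gamma ?q / (s / 2) powr ?q))"
    proof -
      have c: "0 < s + l * (norm x)\<^sup>2" using l s by (simp add: add_pos_nonneg)
      have "l powr (real CARD('p) / 2) \<le> 1" using l by (intro powr_le1) auto
      then show ?thesis
        by (intro ennreal_leI mult_mono divide_left_mono powr_mono2 mult_nonneg_nonneg mult_pos_pos)
          (use l s c D Gq beta_density_pos[OF ab l] in auto)
    qed
    also have "\<dots> = ennreal (D * (Gamma ?q / (s / 2) powr ?q)) * ennreal (beta_density a b l)"
    proof -
      have "0 \<le> D * (Gamma ?q / (s / 2) powr ?q)" using D Gq by simp
      then show ?thesis by (simp only: ennreal_mult'[symmetric] mult_1) (simp only: mult_ac)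
    qed
    finally show "(\<integral>\<^sup>+\<eta>. ennreal (joint n a b (x, s) (\<eta>, l)) \<partial>restrict_space lborel {0<..})
        \<le> ennreal (D * (Gamma ?q / (s / 2) powr ?q)) * ennreal (beta_density a b l)" .
  qed
  also have "\<dots> < \<infinity>"
    using nn_integral_beta_density_finite[OF ab] by (subst nn_integral_cmult) (auto simp: ennreal_mult_less_top)
  finally show ?thesis .
qed

section \<open>Integrability of the majorant\<close>

text \<open>
  The majorant of the squared increments of the cut-off functions. It is not symmetric: its second factor
  \<open>1 / (1 + |ln \<eta>|)\<^sup>2\<close> involves only \<open>y\<close>, which is what remains to be integrated last.
\<close>

definition log_weight :: "real \<times> real \<Rightarrow> real \<times> real \<Rightarrow> real" where
  "log_weight y y' = (1 + \<bar>ln (fst y) - ln (fst y')\<bar>)\<^sup>2 / (1 + \<bar>ln (fst y)\<bar>)\<^sup>2"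

lemma log_weight_measurable [measurable]:
  "(\<lambda>(y, y'). log_weight y y') \<in> borel_measurable (hyper \<Otimes>\<^sub>M hyper)"
  unfolding log_weight_def by measurable

lemma log_weight_section_measurable [measurable]: "log_weight y \<in> borel_measurable hyper"
  unfolding log_weight_def[abs_def] by measurable

text \<open>
  Logarithms are traded for powers, which have explicit Gamma moments. The exponent must be so small
  that \<open>s powr (- (1 / 4))\<close> is integrable against the law of \<open>S\<close> already for one degree of freedom.
\<close>

lemma log_ratio_square_le:
  fixes u v :: real
  assumes "0 < u" "0 < v"
  shows "(1 + \<bar>ln u - ln v\<bar>)\<^sup>2 \<le> 64 * (u powr (1 / 4) * v powr (- (1 / 4)) + u powr (- (1 / 4)) * v powr (1 / 4))"
proof -
  define t where "t = ln u - ln v"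
  have "1 + \<bar>t\<bar> \<le> 8 * exp (\<bar>t\<bar> / 8)"
    using exp_ge_add_one_self[of "\<bar>t\<bar> / 8"] by linarith
  then have "(1 + \<bar>t\<bar>)\<^sup>2 \<le> (8 * exp (\<bar>t\<bar> / 8))\<^sup>2"
    by (intro power_mono) auto
  also have "\<dots> = 64 * exp (\<bar>t\<bar> / 4)"
    by (simp add: power_mult_distrib flip: exp_double)
  also have "\<dots> \<le> 64 * (exp (t / 4) + exp (- t / 4))"
    by (cases "0 \<le> t") auto
  also have "exp (t / 4) = u powr (1 / 4) * v powr (- (1 / 4))"
    using assms by (simp add: powr_def t_def diff_divide_distrib flip: exp_add)
  also have "exp (- t / 4) = u powr (- (1 / 4)) * v powr (1 / 4)"
    using assms by (simp add: powr_def t_def diff_divide_distrib flip: exp_add)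
  finally show ?thesis by (simp add: t_def)
qed

lemma powr_quarter_le:
  fixes t :: real
  assumes "0 \<le> t"
  shows "t powr (1 / 4) \<le> 1 + t"
proof -
  have "t powr (1 / 4) \<le> (1 + t) powr (1 / 4)" using assms by (intro powr_mono2) auto
  also have "\<dots> \<le> (1 + t) powr 1" using assms by (intro powr_mono) auto
  finally show ?thesis using assms by simp
qed

text \<open>
  Integrates out the independent copy \<open>y'\<close>. By \<open>nn_integral_tilted_joint_le\<close> the posterior moments
  of \<open>\<eta>' powr (1 / 4)\<close> and \<open>\<eta>' powr (- (1 / 4))\<close> are of the order of \<open>s powr (- (1 / 4))\<close> and
  \<open>(s + |x|\<^sup>2) powr (1 / 4)\<close>; together with the powers of \<open>\<eta>\<close> they combine to scale-free expressions in
  \<open>\<eta> s\<close> and \<open>\<eta> |x|\<^sup>2\<close>.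
\<close>

lemma nn_integral_log_weight_joint_le:
  assumes ab: "-1 < a" "-1 < b" and n: "0 < n"
  obtains C where "0 \<le> C" "\<And>(x :: real ^ 'p) s y. 0 < s \<Longrightarrow> y \<in> space hyper \<Longrightarrow>
    (\<integral>\<^sup>+y'. ennreal (log_weight y y' * joint n a b (x, s) y') \<partial>hyper)
      \<le> ennreal (C * (1 + fst y * s + fst y * (norm x)\<^sup>2 + (fst y * s) powr (- (1 / 4))) / (1 + \<bar>ln (fst y)\<bar>)\<^sup>2)
        * evidence n a b (x, s)"
proof -
  let ?q = "(CARD('p) + n) / 2 + 1"
  define K1 where "K1 = Gamma (?q + 1 / 4) / Gamma ?q * 2 powr (1 / 4)"
  define K2 where "K2 = Gamma (?q + - (1 / 4)) / Gamma ?q"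
  have "0 \<le> (CARD('p) + n) / 2" by simp
  then have q: "0 < ?q" "0 < ?q + 1 / 4" "0 < ?q + - (1 / 4)" by linarith+
  have G: "0 < Gamma ?q" "0 < Gamma (?q + 1 / 4)" "0 < Gamma (?q + - (1 / 4))"
    by (intro Gamma_real_pos q)+
  have K1: "0 \<le> K1" unfolding K1_def using G by (intro mult_nonneg_nonneg divide_nonneg_nonneg) auto
  have K2: "0 \<le> K2" unfolding K2_def using G by (intro divide_nonneg_nonneg) auto
  define C where "C = 64 * (K1 + K2)"
  show ?thesis
  proof (rule that[of C])
    show "0 \<le> C" using K1 K2 by (simp add: C_def)
    fix x :: "real ^ 'p" and s :: real and y :: "real \<times> real"
    assume s: "0 < s" and y: "y \<in> space hyper"
    define \<eta> where "\<eta> = fst y"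
    have \<eta>: "0 < \<eta>" using y by (simp add: \<eta>_def space_hyper)
    let ?L = "(1 + \<bar>ln \<eta>\<bar>)\<^sup>2"
    have L: "0 < ?L" by (simp add: add_pos_nonneg)
    define A1 where "A1 = 64 * \<eta> powr (- (1 / 4)) / ?L"
    define A2 where "A2 = 64 * \<eta> powr (1 / 4) / ?L"
    have A: "0 \<le> A1" "0 \<le> A2" by (simp_all add: A1_def A2_def)
    have j: "0 \<le> joint n a b (x, s) y'" if "y' \<in> space hyper" for y'
      using joint_pos[OF ab n _ that, of "(x, s)"] s by (simp add: space_obs less_imp_le)
    have "(\<integral>\<^sup>+y'. ennreal (log_weight y y' * joint n a b (x, s) y') \<partial>hyper)
      \<le> (\<integral>\<^sup>+y'. ennreal A1 * ennreal (fst y' powr (1 / 4) * joint n a b (x, s) y')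
          + ennreal A2 * ennreal (fst y' powr (- (1 / 4)) * joint n a b (x, s) y') \<partial>hyper)"
    proof (rule nn_integral_mono)
      fix y' :: "real \<times> real" assume y': "y' \<in> space hyper"
      have "log_weight y y' \<le> 64 * (\<eta> powr (1 / 4) * fst y' powr (- (1 / 4)) + \<eta> powr (- (1 / 4)) * fst y' powr (1 / 4)) / ?L"
        unfolding log_weight_def \<eta>_def[symmetric] using \<eta> y'
        by (intro divide_right_mono log_ratio_square_le) (auto simp: space_hyper)
      also have "\<dots> = A1 * fst y' powr (1 / 4) + A2 * fst y' powr (- (1 / 4))"
        by (simp add: A1_def A2_def add_divide_distrib distrib_left)
      finally have "log_weight y y' * joint n a b (x, s) y'
          \<le> (A1 * fst y' powr (1 / 4) + A2 * fst y' powr (- (1 / 4))) * joint n a b (x, s) y'"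
        by (intro mult_right_mono j y')
      then have "ennreal (log_weight y y' * joint n a b (x, s) y')
          \<le> ennreal (A1 * (fst y' powr (1 / 4) * joint n a b (x, s) y')
             + A2 * (fst y' powr (- (1 / 4)) * joint n a b (x, s) y'))"
        by (intro ennreal_leI) (simp add: algebra_simps)
      then show "ennreal (log_weight y y' * joint n a b (x, s) y')
          \<le> ennreal A1 * ennreal (fst y' powr (1 / 4) * joint n a b (x, s) y')
          + ennreal A2 * ennreal (fst y' powr (- (1 / 4)) * joint n a b (x, s) y')"
        using A j[OF y'] by (simp add: ennreal_mult')
    qed
    also have "\<dots> = ennreal A1 * (\<integral>\<^sup>+y'. ennreal (fst y' powr (1 / 4) * joint n a b (x, s) y') \<partial>hyper)
          + ennreal A2 * (\<integral>\<^sup>+y'. ennreal (fst y' powr (- (1 / 4)) * joint n a b (x, s) y') \<partial>hyper)"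
      by (simp add: nn_integral_add nn_integral_cmult)
    also have "\<dots> \<le> ennreal A1 * (ennreal (K1 * s powr (- (1 / 4))) * evidence n a b (x, s))
        + ennreal A2 * (ennreal (K2 * (s + (norm x)\<^sup>2) powr (1 / 4)) * evidence n a b (x, s))"
    proof (intro add_mono mult_left_mono)
      have e: "(s / 2) powr (- (1 / 4)) = 2 powr (1 / 4) * s powr (- (1 / 4))"
        by (simp add: powr_divide powr_minus_divide)
      have "((s + l * (norm x)\<^sup>2) / 2) powr (- (1 / 4)) \<le> (s / 2) powr (- (1 / 4))" if "0 < l" for l
        using s that by (intro powr_mono2') auto
      from nn_integral_tilted_joint_le[OF ab n s q(2) this[unfolded e]]
      show "(\<integral>\<^sup>+y'. ennreal (fst y' powr (1 / 4) * joint n a b (x, s) y') \<partial>hyper)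
          \<le> ennreal (K1 * s powr (- (1 / 4))) * evidence n a b (x, s)"
        by (simp add: K1_def mult.assoc)
      have "((s + l * (norm x)\<^sup>2) / 2) powr (- (- (1 / 4))) \<le> (s + (norm x)\<^sup>2) powr (1 / 4)" if "0 < l" "l < 1" for l
      proof -
        have "l * (norm x)\<^sup>2 \<le> (norm x)\<^sup>2" using that by (simp add: mult_left_le_one_le)
        moreover have "0 \<le> (norm x)\<^sup>2" "0 \<le> l * (norm x)\<^sup>2" using that by simp_all
        moreover have "(s + t) / 2 \<le> s + N \<and> 0 \<le> (s + t) / 2" if "t \<le> N" "0 \<le> t" for t N :: real
          using that s by (simp add: field_simps)
        ultimately have "(s + l * (norm x)\<^sup>2) / 2 \<le> s + (norm x)\<^sup>2 \<and> 0 \<le> (s + l * (norm x)\<^sup>2) / 2"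
          by blast
        then show ?thesis by (subst minus_minus, intro powr_mono2) simp_all
      qed
      from nn_integral_tilted_joint_le[OF ab n s q(3) this]
      show "(\<integral>\<^sup>+y'. ennreal (fst y' powr (- (1 / 4)) * joint n a b (x, s) y') \<partial>hyper)
          \<le> ennreal (K2 * (s + (norm x)\<^sup>2) powr (1 / 4)) * evidence n a b (x, s)"
        by (simp add: K2_def)
    qed auto
    also have "\<dots> = ennreal (A1 * (K1 * s powr (- (1 / 4))) + A2 * (K2 * (s + (norm x)\<^sup>2) powr (1 / 4))) * evidence n a b (x, s)"
      using A K1 K2 by (simp add: ennreal_mult' distrib_right mult.assoc)
    also have "\<dots> \<le> ennreal (C * (1 + \<eta> * s + \<eta> * (norm x)\<^sup>2 + (\<eta> * s) powr (- (1 / 4))) / ?L) * evidence n a b (x, s)"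
    proof (intro mult_right_mono ennreal_leI)
      have e1: "A1 * (K1 * s powr (- (1 / 4))) = 64 * K1 * (\<eta> * s) powr (- (1 / 4)) / ?L"
        by (simp add: A1_def powr_mult)
      have "A2 * (K2 * (s + (norm x)\<^sup>2) powr (1 / 4)) = 64 * K2 * (\<eta> * (s + (norm x)\<^sup>2)) powr (1 / 4) / ?L"
        by (simp add: A2_def powr_mult)
      also have "\<dots> \<le> 64 * K2 * (1 + \<eta> * (s + (norm x)\<^sup>2)) / ?L"
        using K2 \<eta> s by (intro divide_right_mono mult_left_mono powr_quarter_le) auto
      finally have "A1 * (K1 * s powr (- (1 / 4))) + A2 * (K2 * (s + (norm x)\<^sup>2) powr (1 / 4))
          \<le> (64 * K1 * (\<eta> * s) powr (- (1 / 4)) + 64 * K2 * (1 + \<eta> * (s + (norm x)\<^sup>2))) / ?L"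
        unfolding e1 by (simp add: add_divide_distrib)
      also have "\<dots> \<le> C * (1 + \<eta> * s + \<eta> * (norm x)\<^sup>2 + (\<eta> * s) powr (- (1 / 4))) / ?L"
      proof (intro divide_right_mono)
        have "0 \<le> K1 * (1 + \<eta> * (s + (norm x)\<^sup>2))" "0 \<le> K2 * (\<eta> * s) powr (- (1 / 4))"
          using K1 K2 \<eta> s by (auto intro!: mult_nonneg_nonneg add_nonneg_nonneg)
        then show "64 * K1 * (\<eta> * s) powr (- (1 / 4)) + 64 * K2 * (1 + \<eta> * (s + (norm x)\<^sup>2))
          \<le> C * (1 + \<eta> * s + \<eta> * (norm x)\<^sup>2 + (\<eta> * s) powr (- (1 / 4)))"
          by (simp add: C_def algebra_simps)
      qed simp
      finally show "A1 * (K1 * s powr (- (1 / 4))) + A2 * (K2 * (s + (norm x)\<^sup>2) powr (1 / 4))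
        \<le> C * (1 + \<eta> * s + \<eta> * (norm x)\<^sup>2 + (\<eta> * s) powr (- (1 / 4))) / ?L" .
    qed simp
    finally show "(\<integral>\<^sup>+y'. ennreal (log_weight y y' * joint n a b (x, s) y') \<partial>hyper)
      \<le> ennreal (C * (1 + fst y * s + fst y * (norm x)\<^sup>2 + (fst y * s) powr (- (1 / 4))) / (1 + \<bar>ln (fst y)\<bar>)\<^sup>2)
        * evidence n a b (x, s)"
      unfolding \<eta>_def .
  qed
qed

lemma nn_integral_hyper_log_finite:
  assumes "-1 < a" "-1 < b"
  shows "(\<integral>\<^sup>+y. ennreal (1 / (fst y * (1 + \<bar>ln (fst y)\<bar>)\<^sup>2) * beta_density a b (snd y)) \<partial>hyper) < \<infinity>"
proof -
  have "(\<integral>\<^sup>+y. ennreal (1 / (fst y * (1 + \<bar>ln (fst y)\<bar>)\<^sup>2) * beta_density a b (snd y)) \<partial>hyper)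
      = (\<integral>\<^sup>+y. ennreal (1 / (fst y * (1 + \<bar>ln (fst y)\<bar>)\<^sup>2)) * ennreal (beta_density a b (snd y)) \<partial>hyper)"
    by (intro nn_integral_cong ennreal_mult') (auto simp: space_hyper)
  also have "\<dots> = (\<integral>\<^sup>+\<eta>. ennreal (1 / (\<eta> * (1 + \<bar>ln \<eta>\<bar>)\<^sup>2)) \<partial>restrict_space lborel {0<..})
      * (\<integral>\<^sup>+l. ennreal (beta_density a b l) \<partial>restrict_space lborel {0<..<1})"
    by (rule hyper.nn_integral_prod_mult) (auto intro!: measurable_restrict_space1)
  also have "\<dots> < \<infinity>"
    using nn_integral_inverse_log_square nn_integral_beta_density_finite[OF assms]
    by (simp add: ennreal_mult_less_top)
  finally show ?thesis .
qed

interpretation oh: pair_sigma_finite "obs :: ((real ^ 'p) \<times> real) measure" hyper ..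

text \<open>
  Given \<open>(\<eta>, l)\<close>, the law of \<open>\<eta> s\<close> does not depend on \<open>\<eta>\<close>, and \<open>\<eta> |x|\<^sup>2\<close> is of the order of \<open>1 / l\<close>. The worst
  term is \<open>\<eta> |x|\<^sup>4\<close>, of the order of \<open>1 / (\<eta> l\<^sup>2)\<close>; the factor \<open>l\<^sup>2\<close> compensates it exactly, so that the
  bound has no singularity at \<open>l = 0\<close> beyond that of the Beta density.
\<close>

lemma nn_integral_moment_joint_le:
  assumes ab: "-1 < a" "-1 < b" and n: "0 < n"
  obtains C where "0 \<le> C" "\<And>y. y \<in> space hyper \<Longrightarrow>
    (\<integral>\<^sup>+z. ennreal ((norm (fst z))\<^sup>2 * (snd y)\<^sup>2
        * (1 + fst y * snd z + fst y * (norm (fst z))\<^sup>2 + (fst y * snd z) powr (- (1 / 4)))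
        * joint n a b z y) \<partial>(obs :: ((real ^ 'p) \<times> real) measure))
      \<le> ennreal (C / fst y * beta_density a b (snd y))"
proof -
  define P where "P = 2 powr (CARD('p) / 2)"
  define K where "K r = Gamma (n / 2 + r) * 2 powr r / Gamma (n / 2)" for r :: real
  have K: "0 \<le> K r" if "0 < n / 2 + r" for r
    using that Gamma_real_pos[of "n / 2"] Gamma_real_pos[of "n / 2 + r"] n by (simp add: K_def)
  have nh: "1 / 2 \<le> real n / 2" using n by simp
  define S where "S = K 0 + K 1 + K (- (1 / 4))"
  have K0: "0 \<le> K 0" "0 \<le> K 1" "0 \<le> K (- (1 / 4))" using nh by (intro K; linarith)+
  \<comment> \<open>\<open>4 P\<close> and \<open>32 P\<close> bound the second and fourth moments of a Gaussian vector of unit precision.\<close>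
  define C where "C = 4 * P * S + 32 * P * K 0"
  have P: "0 \<le> P" by (simp add: P_def)
  have S: "0 \<le> S" using K0 by (simp add: S_def)
  show ?thesis
  proof (rule that[of C])
    show "0 \<le> C" using P S K0 by (simp add: C_def)
    fix y :: "real \<times> real" assume y: "y \<in> space hyper"
    define \<eta> l where "\<eta> = fst y" and "l = snd y"
    have \<eta>: "0 < \<eta>" "0 < l" "l < 1" using y by (auto simp: \<eta>_def l_def space_hyper)
    let ?\<beta> = "beta_density a b l"
    have \<beta>: "0 \<le> ?\<beta>" using beta_density_pos[OF ab] \<eta> by (simp add: less_imp_le)
    have el: "0 < \<eta> * l" using \<eta> by simp
    let ?f = "\<lambda>x :: real ^ 'p. fx 0 (\<eta> * l) x"
    let ?g = "\<lambda>s. fs n \<eta> s"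
    have M: "(\<integral>\<^sup>+s. ennreal ((\<eta> * s) powr r * ?g s) \<partial>restrict_space lborel {0<..}) = ennreal (K r)"
      if "0 < n / 2 + r" for r
      unfolding K_def using n \<eta>(1) that by (rule nn_integral_fs_moment)
    have f0: "0 \<le> fs n \<eta> s" if "0 < s" for s using fs_pos[OF n \<eta>(1) that] by simp
    have "(\<integral>\<^sup>+z. ennreal ((norm (fst z))\<^sup>2 * (snd y)\<^sup>2
        * (1 + fst y * snd z + fst y * (norm (fst z))\<^sup>2 + (fst y * snd z) powr (- (1 / 4)))
        * joint n a b z y) \<partial>(obs :: ((real ^ 'p) \<times> real) measure))
      = (\<integral>\<^sup>+z. ennreal (l\<^sup>2 * ?\<beta>) * (
          ennreal ((norm (fst z))\<^sup>2 ^ 1 * ?f (fst z)) * (ennreal ((\<eta> * snd z) powr 0 * ?g (snd z))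
             + ennreal ((\<eta> * snd z) powr 1 * ?g (snd z)) + ennreal ((\<eta> * snd z) powr (- (1 / 4)) * ?g (snd z)))
          + ennreal \<eta> * (ennreal ((norm (fst z))\<^sup>2 ^ 2 * ?f (fst z)) * ennreal ((\<eta> * snd z) powr 0 * ?g (snd z)))) \<partial>obs)"
    proof (rule nn_integral_cong)
      fix z :: "(real ^ 'p) \<times> real" assume z: "z \<in> space obs"
      then have s: "0 < snd z" by (simp add: space_obs)
      define F G N w1 w2 where "F = ?f (fst z)" and "G = ?g (snd z)" and "N = (norm (fst z))\<^sup>2"
        and "w1 = \<eta> * snd z" and "w2 = (\<eta> * snd z) powr (- (1 / 4))"
      have nn: "0 \<le> F" "0 \<le> G" "0 \<le> N" "0 \<le> w1" "0 \<le> w2" "0 \<le> \<eta>" "0 \<le> l\<^sup>2" "0 \<le> ?\<beta>"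
        using f0[OF s] s \<eta> \<beta> by (auto simp: F_def G_def N_def w1_def w2_def)
      have p: "(\<eta> * snd z) powr 0 = 1" "(\<eta> * snd z) powr 1 = w1" using s \<eta> by (auto simp: w1_def)
      have "(norm (fst z))\<^sup>2 * (snd y)\<^sup>2
        * (1 + fst y * snd z + fst y * (norm (fst z))\<^sup>2 + (fst y * snd z) powr (- (1 / 4))) * joint n a b z y
        = N * l\<^sup>2 * (1 + w1 + \<eta> * N + w2) * (F * G * ?\<beta>)"
        by (simp add: joint_def F_def G_def N_def w1_def w2_def \<eta>_def l_def)
      also have "\<dots> = l\<^sup>2 * ?\<beta> * (N ^ 1 * F * (1 * G + w1 * G + w2 * G) + \<eta> * (N ^ 2 * F * (1 * G)))"
        by (simp add: algebra_simps power2_eq_square)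
      also have "ennreal \<dots> = ennreal (l\<^sup>2 * ?\<beta>) * (ennreal (N ^ 1 * F) * (ennreal (1 * G) + ennreal (w1 * G) + ennreal (w2 * G))
          + ennreal \<eta> * (ennreal (N ^ 2 * F) * ennreal (1 * G)))"
        using nn by (simp add: ennreal_mult)
      finally show "ennreal ((norm (fst z))\<^sup>2 * (snd y)\<^sup>2
        * (1 + fst y * snd z + fst y * (norm (fst z))\<^sup>2 + (fst y * snd z) powr (- (1 / 4)))
        * joint n a b z y) = ennreal (l\<^sup>2 * ?\<beta>) * (
          ennreal ((norm (fst z))\<^sup>2 ^ 1 * ?f (fst z)) * (ennreal ((\<eta> * snd z) powr 0 * ?g (snd z))
             + ennreal ((\<eta> * snd z) powr 1 * ?g (snd z)) + ennreal ((\<eta> * snd z) powr (- (1 / 4)) * ?g (snd z)))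
          + ennreal \<eta> * (ennreal ((norm (fst z))\<^sup>2 ^ 2 * ?f (fst z)) * ennreal ((\<eta> * snd z) powr 0 * ?g (snd z))))"
        unfolding p F_def[symmetric] G_def[symmetric] N_def[symmetric] w2_def[symmetric] .
    qed
    also have "\<dots> = ennreal (l\<^sup>2 * ?\<beta>) * (
        (\<integral>\<^sup>+x. ennreal ((norm x)\<^sup>2 ^ 1 * ?f x) \<partial>lborel) *
          (\<integral>\<^sup>+s. ennreal ((\<eta> * s) powr 0 * ?g s) + ennreal ((\<eta> * s) powr 1 * ?g s) + ennreal ((\<eta> * s) powr (- (1 / 4)) * ?g s) \<partial>restrict_space lborel {0<..})
        + ennreal \<eta> * ((\<integral>\<^sup>+x. ennreal ((norm x)\<^sup>2 ^ 2 * ?f x) \<partial>lborel) * (\<integral>\<^sup>+s. ennreal ((\<eta> * s) powr 0 * ?g s) \<partial>restrict_space lborel {0<..})))"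
      (is "_ = _ * (?X1 * ?S1 + _ * (?X2 * ?S0))")
      by (subst nn_integral_cmult, measurable, subst nn_integral_add, measurable, measurable, subst nn_integral_cmult, measurable)
         (subst (1 2) obs.nn_integral_prod_mult, auto)
    also have "?S1 = ennreal S"
    proof -
      have "?S1 = (\<integral>\<^sup>+s. ennreal ((\<eta> * s) powr 0 * ?g s) \<partial>restrict_space lborel {0<..})
          + (\<integral>\<^sup>+s. ennreal ((\<eta> * s) powr 1 * ?g s) \<partial>restrict_space lborel {0<..})
          + (\<integral>\<^sup>+s. ennreal ((\<eta> * s) powr (- (1 / 4)) * ?g s) \<partial>restrict_space lborel {0<..})"
        by (simp add: nn_integral_add)
      also have "\<dots> = ennreal (K 0) + ennreal (K 1) + ennreal (K (- (1 / 4)))"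
      proof -
        have "0 < n / 2 + 0" "0 < real n / 2 + 1" "0 < real n / 2 + - (1 / 4)" using nh by linarith+
        from this[THEN M] show ?thesis by (simp only:)
      qed
      finally show ?thesis using K0 by (simp add: S_def)
    qed
    also have "?S0 = ennreal (K 0)"
      using nh by (intro M) linarith
    also have "ennreal (l\<^sup>2 * ?\<beta>) * (?X1 * ennreal S + ennreal \<eta> * (?X2 * ennreal (K 0)))
        \<le> ennreal (l\<^sup>2 * ?\<beta>) * (ennreal (fact 1 * 4 ^ 1 * P / (\<eta> * l) ^ 1) * ennreal S
            + ennreal \<eta> * (ennreal (fact 2 * 4 ^ 2 * P / (\<eta> * l) ^ 2) * ennreal (K 0)))"
      unfolding P_def by (intro mult_left_mono add_mono mult_right_mono nn_integral_norm_power_fx_le el) auto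
    also have "\<dots> = ennreal (l\<^sup>2 * ?\<beta> * (4 * P / (\<eta> * l) * S + \<eta> * (32 * P / (\<eta> * l)\<^sup>2 * K 0)))"
    proof -
      have "ennreal A * (ennreal B * ennreal S + ennreal \<eta> * (ennreal D * ennreal (K 0)))
          = ennreal (A * (B * S + \<eta> * (D * K 0)))" if "0 \<le> A" "0 \<le> B" "0 \<le> D" for A B D
        using that P S K0 \<eta> by (simp add: ennreal_mult)
      moreover have "fact 1 * 4 ^ 1 * P / (\<eta> * l) ^ 1 = 4 * P / (\<eta> * l)"
        "fact 2 * 4 ^ 2 * P / (\<eta> * l) ^ 2 = 32 * P / (\<eta> * l)\<^sup>2"
        by (simp_all add: fact_numeral)
      moreover have "0 \<le> l\<^sup>2 * ?\<beta>" "0 \<le> 4 * P / (\<eta> * l)" "0 \<le> 32 * P / (\<eta> * l)\<^sup>2"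
        using P \<beta> \<eta> by simp_all
      ultimately show ?thesis by (simp only:)
    qed
    also have "\<dots> \<le> ennreal (C / \<eta> * ?\<beta>)"
    proof (rule ennreal_leI)
      have "l\<^sup>2 * ?\<beta> * (4 * P / (\<eta> * l) * S + \<eta> * (32 * P / (\<eta> * l)\<^sup>2 * K 0))
          = (l * (4 * P * S) + 32 * P * K 0) / \<eta> * ?\<beta>"
        using \<eta> by (simp add: field_simps power2_eq_square)
      also have "\<dots> \<le> (1 * (4 * P * S) + 32 * P * K 0) / \<eta> * ?\<beta>"
        using \<eta> \<beta> P S by (intro mult_right_mono divide_right_mono add_right_mono) auto
      finally show "l\<^sup>2 * ?\<beta> * (4 * P / (\<eta> * l) * S + \<eta> * (32 * P / (\<eta> * l)\<^sup>2 * K 0)) \<le> C / \<eta> * ?\<beta>"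
        by (simp add: C_def)
    qed
    finally show "(\<integral>\<^sup>+z. ennreal ((norm (fst z))\<^sup>2 * (snd y)\<^sup>2
        * (1 + fst y * snd z + fst y * (norm (fst z))\<^sup>2 + (fst y * snd z) powr (- (1 / 4)))
        * joint n a b z y) \<partial>(obs :: ((real ^ 'p) \<times> real) measure))
      \<le> ennreal (C / fst y * beta_density a b (snd y))"
      unfolding \<eta>_def l_def .
  qed
qed

lemma domination_finite:
  assumes ab: "-1 < a" "-1 < b" and n: "0 < n"
  shows "(\<integral>\<^sup>+z. \<integral>\<^sup>+y. \<integral>\<^sup>+y'. ennreal ((norm (fst z))\<^sup>2 * (snd y)\<^sup>2 * log_weight y y'
      * joint n a b z y * joint n a b z y' / enn2real (evidence n a b z)) \<partial>hyper \<partial>hyper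
      \<partial>(obs :: ((real ^ 'p) \<times> real) measure)) < \<infinity>"
proof -
  obtain C1 where C1: "0 \<le> C1" and le1: "\<And>(x :: real ^ 'p) s y. 0 < s \<Longrightarrow> y \<in> space hyper \<Longrightarrow>
    (\<integral>\<^sup>+y'. ennreal (log_weight y y' * joint n a b (x, s) y') \<partial>hyper)
      \<le> ennreal (C1 * (1 + fst y * s + fst y * (norm x)\<^sup>2 + (fst y * s) powr (- (1 / 4))) / (1 + \<bar>ln (fst y)\<bar>)\<^sup>2)
        * evidence n a b (x, s)"
    using nn_integral_log_weight_joint_le[OF ab n] by blast
  obtain C2 where C2: "0 \<le> C2" and le2: "\<And>y. y \<in> space hyper \<Longrightarrow>
    (\<integral>\<^sup>+z. ennreal ((norm (fst z))\<^sup>2 * (snd y)\<^sup>2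
        * (1 + fst y * snd z + fst y * (norm (fst z))\<^sup>2 + (fst y * snd z) powr (- (1 / 4)))
        * joint n a b z y) \<partial>(obs :: ((real ^ 'p) \<times> real) measure))
      \<le> ennreal (C2 / fst y * beta_density a b (snd y))"
    using nn_integral_moment_joint_le[OF ab n] by blast
  define V :: "(real ^ 'p) \<times> real \<Rightarrow> real \<times> real \<Rightarrow> real" where
    "V z y = (norm (fst z))\<^sup>2 * (snd y)\<^sup>2
        * (1 + fst y * snd z + fst y * (norm (fst z))\<^sup>2 + (fst y * snd z) powr (- (1 / 4)))
        * joint n a b z y" for z y
  have "(\<integral>\<^sup>+z. \<integral>\<^sup>+y. \<integral>\<^sup>+y'. ennreal ((norm (fst z))\<^sup>2 * (snd y)\<^sup>2 * log_weight y y'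
      * joint n a b z y * joint n a b z y' / enn2real (evidence n a b z)) \<partial>hyper \<partial>hyper
      \<partial>(obs :: ((real ^ 'p) \<times> real) measure))
    \<le> (\<integral>\<^sup>+z. \<integral>\<^sup>+y. ennreal (C1 / (1 + \<bar>ln (fst y)\<bar>)\<^sup>2) * ennreal (V z y) \<partial>hyper \<partial>obs)"
  proof (intro nn_integral_mono)
    fix z :: "(real ^ 'p) \<times> real" and y :: "real \<times> real"
    assume z: "z \<in> space obs" and y: "y \<in> space hyper"
    define E where "E = enn2real (evidence n a b z)"
    have Ee: "evidence n a b z = ennreal E" and E: "0 < E"
      using evidence_pos[OF ab n z] evidence_finite[OF ab n z]
      by (auto simp: E_def enn2real_positive_iff)
    have j: "0 \<le> joint n a b z y" using joint_pos[OF ab n z y] by simp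
    let ?c = "(norm (fst z))\<^sup>2 * (snd y)\<^sup>2 * joint n a b z y / E"
    let ?w = "1 + fst y * snd z + fst y * (norm (fst z))\<^sup>2 + (fst y * snd z) powr (- (1 / 4))"
    have w: "0 \<le> ?w" using z y by (auto simp: space_obs space_hyper intro!: add_nonneg_nonneg)
    have "(\<integral>\<^sup>+y'. ennreal ((norm (fst z))\<^sup>2 * (snd y)\<^sup>2 * log_weight y y'
      * joint n a b z y * joint n a b z y' / E) \<partial>hyper)
      = (\<integral>\<^sup>+y'. ennreal ?c * ennreal (log_weight y y' * joint n a b z y') \<partial>hyper)"
    proof (intro nn_integral_cong)
      fix y' :: "real \<times> real"
      have c: "0 \<le> ?c" using j E by simp
      show "ennreal ((norm (fst z))\<^sup>2 * (snd y)\<^sup>2 * log_weight y y' * joint n a b z y * joint n a b z y' / E)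
        = ennreal ?c * ennreal (log_weight y y' * joint n a b z y')"
        unfolding ennreal_mult'[OF c, symmetric] by (simp add: mult_ac)
    qed
    also have "\<dots> = ennreal ?c * (\<integral>\<^sup>+y'. ennreal (log_weight y y' * joint n a b z y') \<partial>hyper)"
      by (rule nn_integral_cmult) simp
    also have "\<dots> \<le> ennreal ?c * (ennreal (C1 * ?w / (1 + \<bar>ln (fst y)\<bar>)\<^sup>2) * ennreal E)"
      using le1[of "snd z" y "fst z"] z y by (intro mult_left_mono) (auto simp: space_obs Ee)
    also have "\<dots> = ennreal (?c * (C1 * ?w / (1 + \<bar>ln (fst y)\<bar>)\<^sup>2 * E))"
    proof -
      have "ennreal A * (ennreal B * ennreal E) = ennreal (A * (B * E))" if "0 \<le> A" "0 \<le> B" for A B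
        using that E by (simp add: ennreal_mult)
      moreover have "0 \<le> ?c" "0 \<le> C1 * ?w / (1 + \<bar>ln (fst y)\<bar>)\<^sup>2" using C1 w j E by simp_all
      ultimately show ?thesis by blast
    qed
    also have "?c * (C1 * ?w / (1 + \<bar>ln (fst y)\<bar>)\<^sup>2 * E) = C1 / (1 + \<bar>ln (fst y)\<bar>)\<^sup>2 * V z y"
      using E by (simp add: V_def)
    also have "ennreal \<dots> = ennreal (C1 / (1 + \<bar>ln (fst y)\<bar>)\<^sup>2) * ennreal (V z y)"
      using C1 by (intro ennreal_mult') simp
    finally show "(\<integral>\<^sup>+y'. ennreal ((norm (fst z))\<^sup>2 * (snd y)\<^sup>2 * log_weight y y'
      * joint n a b z y * joint n a b z y' / enn2real (evidence n a b z)) \<partial>hyper)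
      \<le> ennreal (C1 / (1 + \<bar>ln (fst y)\<bar>)\<^sup>2) * ennreal (V z y)"
      unfolding E_def .
  qed
  also have "\<dots> = (\<integral>\<^sup>+y. \<integral>\<^sup>+z. ennreal (C1 / (1 + \<bar>ln (fst y)\<bar>)\<^sup>2) * ennreal (V z y) \<partial>obs \<partial>hyper)"
    unfolding V_def by (intro oh.Fubini'[symmetric]) measurable
  also have "\<dots> = (\<integral>\<^sup>+y. ennreal (C1 / (1 + \<bar>ln (fst y)\<bar>)\<^sup>2) * (\<integral>\<^sup>+z. ennreal (V z y) \<partial>obs) \<partial>hyper)"
    unfolding V_def by (intro nn_integral_cong nn_integral_cmult) measurable
  also have "\<dots> \<le> (\<integral>\<^sup>+y. ennreal (C1 / (1 + \<bar>ln (fst y)\<bar>)\<^sup>2) * ennreal (C2 / fst y * beta_density a b (snd y)) \<partial>hyper)"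
    unfolding V_def by (intro nn_integral_mono mult_left_mono le2) auto
  also have "\<dots> = (\<integral>\<^sup>+y. ennreal (C1 * C2) * ennreal (1 / (fst y * (1 + \<bar>ln (fst y)\<bar>)\<^sup>2) * beta_density a b (snd y)) \<partial>hyper)"
  proof (intro nn_integral_cong)
    fix y :: "real \<times> real"
    have c: "0 \<le> C1 / (1 + \<bar>ln (fst y)\<bar>)\<^sup>2" "0 \<le> C1 * C2" using C1 C2 by simp_all
    show "ennreal (C1 / (1 + \<bar>ln (fst y)\<bar>)\<^sup>2) * ennreal (C2 / fst y * beta_density a b (snd y))
      = ennreal (C1 * C2) * ennreal (1 / (fst y * (1 + \<bar>ln (fst y)\<bar>)\<^sup>2) * beta_density a b (snd y))"
      unfolding ennreal_mult'[OF c(1), symmetric] ennreal_mult'[OF c(2), symmetric] by (simp add: mult_ac)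
  qed
  also have "\<dots> < \<infinity>"
    using nn_integral_hyper_log_finite[OF ab] by (subst nn_integral_cmult) (auto simp: ennreal_mult_less_top)
  finally show ?thesis .
qed

section \<open>The generalized Bayes estimator\<close>

text \<open>
  The posterior mean of \<open>l\<close>, called \<open>L\<close> in the introduction.
\<close>

definition posterior_shrinkage :: "nat \<Rightarrow> real \<Rightarrow> real \<Rightarrow> (real ^ 'p) \<times> real \<Rightarrow> real" where
  "posterior_shrinkage n a b z = (\<integral>y. joint n a b z y / enn2real (evidence n a b z) * snd y \<partial>hyper)"

lemma prior_measurable [measurable]:
  "(\<lambda>w. prior a b (fst w :: real ^ 'p) (snd w)) \<in> borel_measurable (lborel \<Otimes>\<^sub>M restrict_space lborel {0<..})"
  unfolding prior_def set_lebesgue_integral_def by measurable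

lemma posterior_shrinkage_measurable [measurable]:
  "posterior_shrinkage n a b \<in> borel_measurable (obs :: ((real ^ 'p) \<times> real) measure)"
  unfolding posterior_shrinkage_def[abs_def] by measurable

lemma evidence_eq_integral:
  fixes z :: "(real ^ 'p) \<times> real"
  assumes "-1 < a" "-1 < b" "0 < n" "z \<in> space obs"
  shows "integrable hyper (joint n a b z)" "(\<integral>y. joint n a b z y \<partial>hyper) = enn2real (evidence n a b z)"
    "0 < enn2real (evidence n a b z)" "evidence n a b z = ennreal (enn2real (evidence n a b z))"
proof -
  have j: "AE y in hyper. 0 \<le> joint n a b z y"
    using joint_pos[OF assms] by (auto intro!: AE_I2 less_imp_le)
  show i: "integrable hyper (joint n a b z)"
    using evidence_finite[OF assms] j unfolding evidence_def by (intro integrableI_nonneg) auto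
  show "(\<integral>y. joint n a b z y \<partial>hyper) = enn2real (evidence n a b z)"
    unfolding evidence_def using j by (intro integral_eq_nn_integral) auto
  show "0 < enn2real (evidence n a b z)" "evidence n a b z = ennreal (enn2real (evidence n a b z))"
    using evidence_pos[OF assms] evidence_finite[OF assms] by (auto simp: enn2real_positive_iff)
qed

interpretation th: pair_sigma_finite "lborel :: (real ^ 'p) measure" hyper ..

text \<open>
  The joint density of \<open>w = (\<theta>, \<eta>, l)\<close> and the observation \<open>z\<close>, written as the normal posterior density of
  \<open>\<theta>\<close> times \<open>joint\<close>.
\<close>

definition posterior_kernel ::
  "nat \<Rightarrow> real \<Rightarrow> real \<Rightarrow> (real ^ 'p) \<times> real \<Rightarrow> (real ^ 'p) \<times> real \<times> real \<Rightarrow> real" where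
  "posterior_kernel n a b z w = fx ((1 - snd (snd w)) *\<^sub>R fst z) (fst (snd w) / (1 - snd (snd w))) (fst w)
     * joint n a b z (snd w)"

lemma posterior_kernel_measurable [measurable]:
  "posterior_kernel n a b z \<in> borel_measurable (lborel \<Otimes>\<^sub>M hyper)"
  unfolding posterior_kernel_def[abs_def] by measurable

text \<open>
  Licenses exchanging the integrals in the definition of the generalized Bayes estimator. The first
  moment in \<open>\<theta>\<close> is bounded by the second one, whose variance part is of order \<open>1 / \<eta>\<close> and hence a tilted
  moment with exponent \<open>-1\<close>.
\<close>

lemma integrable_posterior_kernel:
  fixes z :: "(real ^ 'p) \<times> real"
  assumes ab: "-1 < a" "-1 < b" and n: "0 < n" and z: "z \<in> space obs"
  shows "integrable (lborel \<Otimes>\<^sub>M hyper) (posterior_kernel n a b z)"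
    "integrable (lborel \<Otimes>\<^sub>M hyper) (\<lambda>w. posterior_kernel n a b z w *\<^sub>R fst w)"
proof -
  note j = joint_pos[OF ab n z]
  have nn: "0 \<le> posterior_kernel n a b z w" if "w \<in> space (lborel \<Otimes>\<^sub>M hyper)" for w
    using j[of "snd w"] that unfolding posterior_kernel_def
    by (auto simp: space_pair_measure less_imp_le intro!: mult_nonneg_nonneg)
  define P where "P = 4 * 2 powr (CARD('p) / 2)"
  have P: "0 \<le> P" by (simp add: P_def)
  have s: "0 < snd z" using z by (simp add: space_obs)
  have m0: "(\<integral>\<^sup>+\<theta>. ennreal (posterior_kernel n a b z (\<theta>, y)) \<partial>lborel) = ennreal (joint n a b z y)"
    if y: "y \<in> space hyper" for y
  proof -
    have "0 < fst y / (1 - snd y)" using y by (auto simp: space_hyper)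
    from nn_integral_fx[OF this, of "(1 - snd y) *\<^sub>R fst z"] show ?thesis
      using j[OF y] by (simp add: posterior_kernel_def ennreal_mult'' nn_integral_multc)
  qed
  have m2: "(\<integral>\<^sup>+\<theta>. ennreal ((norm \<theta>)\<^sup>2 * posterior_kernel n a b z (\<theta>, y)) \<partial>lborel)
      \<le> ennreal ((norm (fst z))\<^sup>2) * ennreal (joint n a b z y)
        + ennreal P * ennreal (fst y powr (- 1) * joint n a b z y)"
    if y: "y \<in> space hyper" for y
  proof -
    let ?t = "fst y / (1 - snd y)" and ?m = "(1 - snd y) *\<^sub>R fst z"
    have l: "0 < snd y" "snd y < 1" and \<eta>: "0 < fst y" and t: "0 < ?t" using y by (auto simp: space_hyper)
    have "(\<integral>\<^sup>+\<theta>. ennreal ((norm \<theta>)\<^sup>2 * posterior_kernel n a b z (\<theta>, y)) \<partial>lborel)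
        = (\<integral>\<^sup>+\<theta>. ennreal ((norm (0 - \<theta>))\<^sup>2 * fx ?m ?t \<theta>) * ennreal (joint n a b z y) \<partial>lborel)"
      using j[OF y] by (intro nn_integral_cong) (simp add: posterior_kernel_def ennreal_mult''[symmetric] mult_ac)
    also have "\<dots> = (\<integral>\<^sup>+\<theta>. ennreal ((norm (0 - \<theta>))\<^sup>2 * fx ?m ?t \<theta>) \<partial>lborel) * ennreal (joint n a b z y)"
      by (rule nn_integral_multc) simp
    also have "\<dots> = (ennreal ((norm (0 - ?m))\<^sup>2)
          + (\<integral>\<^sup>+x. ennreal ((norm x)\<^sup>2 * fx 0 ?t x) \<partial>(lborel :: (real ^ 'p) measure))) * ennreal (joint n a b z y)"
      by (simp only: bias_variance[OF t, of 0 ?m])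
    also have "\<dots> \<le> (ennreal ((norm (fst z))\<^sup>2) + ennreal (P * fst y powr (- 1))) * ennreal (joint n a b z y)"
    proof (intro mult_right_mono add_mono ennreal_leI)
      show "(norm (0 - ?m))\<^sup>2 \<le> (norm (fst z))\<^sup>2"
        using l by (auto simp: power_mult_distrib intro!: mult_left_le_one_le power_le_one)
      have "(\<integral>\<^sup>+x. ennreal ((norm x)\<^sup>2 * fx 0 ?t x) \<partial>(lborel :: (real ^ 'p) measure)) \<le> ennreal (P / ?t)"
        using nn_integral_norm_power_fx_le[OF t, of 1, where 'p = 'p] by (simp add: P_def)
      also have "\<dots> \<le> ennreal (P * fst y powr (- 1))"
      proof (rule ennreal_leI)
        have "P / ?t = P * (1 - snd y) / fst y" by simp
        also have "\<dots> \<le> P * 1 / fst y" using P l \<eta> by (intro divide_right_mono mult_left_mono) auto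
        finally show "P / ?t \<le> P * fst y powr (- 1)" using \<eta> by (simp add: powr_minus divide_inverse)
      qed
      finally show "(\<integral>\<^sup>+x. ennreal ((norm x)\<^sup>2 * fx 0 ?t x) \<partial>(lborel :: (real ^ 'p) measure)) \<le> ennreal (P * fst y powr (- 1))" .
    qed auto
    also have "\<dots> = ennreal ((norm (fst z))\<^sup>2) * ennreal (joint n a b z y)
        + ennreal P * ennreal (fst y powr (- 1) * joint n a b z y)"
    proof -
      have "(A + ennreal (P * q)) * ennreal J = A * ennreal J + ennreal P * ennreal (q * J)"
        if "0 \<le> q" "0 \<le> J" for A q J
        using P that by (simp add: distrib_right ennreal_mult mult.assoc)
      from this[OF powr_ge_zero less_imp_le[OF j[OF y]]] show ?thesis .
    qed
    finally show ?thesis .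
  qed
  have E: "evidence n a b z < \<infinity>" by (rule evidence_finite[OF ab n z])
  have fin0: "(\<integral>\<^sup>+w. ennreal (posterior_kernel n a b z w) \<partial>(lborel \<Otimes>\<^sub>M hyper)) = evidence n a b z"
    unfolding evidence_def by (subst th.nn_integral_snd[symmetric]) (auto intro!: nn_integral_cong m0)
  have T: "(\<integral>\<^sup>+y. ennreal (fst y powr (- 1) * joint n a b z y) \<partial>hyper) < \<infinity>"
  proof -
    have "((snd z + l * (norm (fst z))\<^sup>2) / 2) powr (- (- 1)) \<le> (snd z + (norm (fst z))\<^sup>2)" if "0 < l" "l < 1" for l
    proof -
      have "l * (norm (fst z))\<^sup>2 \<le> 1 * (norm (fst z))\<^sup>2" using that by (intro mult_right_mono) auto
      moreover have "0 \<le> l * (norm (fst z))\<^sup>2" using that by simp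
      ultimately show ?thesis using s by (simp add: field_simps)
    qed
    moreover have "0 < (CARD('p) + n) / 2 + 1 + (- 1)" using n by simp
    ultimately have "(\<integral>\<^sup>+y. ennreal (fst y powr (- 1) * joint n a b (fst z, snd z) y) \<partial>hyper)
      \<le> ennreal (Gamma ((CARD('p) + n) / 2 + 1 + (- 1)) / Gamma ((CARD('p) + n) / 2 + 1)
         * (snd z + (norm (fst z))\<^sup>2)) * evidence n a b (fst z, snd z)"
      by (intro nn_integral_tilted_joint_le ab n s)
    also have "\<dots> < \<infinity>" using E by (simp add: ennreal_mult_less_top)
    finally show ?thesis by simp
  qed
  have fin2: "(\<integral>\<^sup>+w. ennreal ((norm (fst w))\<^sup>2 * posterior_kernel n a b z w) \<partial>(lborel \<Otimes>\<^sub>M hyper)) < \<infinity>"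
  proof -
    have "(\<integral>\<^sup>+w. ennreal ((norm (fst w))\<^sup>2 * posterior_kernel n a b z w) \<partial>(lborel \<Otimes>\<^sub>M hyper))
        = (\<integral>\<^sup>+y. \<integral>\<^sup>+\<theta>. ennreal ((norm \<theta>)\<^sup>2 * posterior_kernel n a b z (\<theta>, y)) \<partial>lborel \<partial>hyper)"
      by (subst th.nn_integral_snd[symmetric]) auto
    also have "\<dots> \<le> (\<integral>\<^sup>+y. ennreal ((norm (fst z))\<^sup>2) * ennreal (joint n a b z y)
        + ennreal P * ennreal (fst y powr (- 1) * joint n a b z y) \<partial>hyper)"
      by (intro nn_integral_mono m2)
    also have "\<dots> = ennreal ((norm (fst z))\<^sup>2) * evidence n a b z
        + ennreal P * (\<integral>\<^sup>+y. ennreal (fst y powr (- 1) * joint n a b z y) \<partial>hyper)"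
      unfolding evidence_def by (simp add: nn_integral_add nn_integral_cmult)
    also have "\<dots> < \<infinity>" using E T by (simp add: ennreal_mult_less_top)
    finally show ?thesis .
  qed
  show i0: "integrable (lborel \<Otimes>\<^sub>M hyper) (posterior_kernel n a b z)"
    using fin0 E nn by (intro integrableI_nonneg) (auto intro!: AE_I2)
  have i2: "integrable (lborel \<Otimes>\<^sub>M hyper) (\<lambda>w. (norm (fst w))\<^sup>2 * posterior_kernel n a b z w)"
    using fin2 nn by (intro integrableI_nonneg) (auto intro!: AE_I2)
  show "integrable (lborel \<Otimes>\<^sub>M hyper) (\<lambda>w. posterior_kernel n a b z w *\<^sub>R fst w)"
  proof (rule Bochner_Integration.integrable_bound[OF Bochner_Integration.integrable_add[OF i0 i2]])
    show "AE w in lborel \<Otimes>\<^sub>M hyper. norm (posterior_kernel n a b z w *\<^sub>R fst w)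
        \<le> norm (posterior_kernel n a b z w + (norm (fst w))\<^sup>2 * posterior_kernel n a b z w)"
    proof (rule AE_I2)
      fix w assume w: "w \<in> space ((lborel :: (real ^ 'p) measure) \<Otimes>\<^sub>M hyper)"
      have "norm (fst w) \<le> 1 + (norm (fst w))\<^sup>2"
        using zero_le_power2[of "norm (fst w) - 1"] norm_ge_zero[of "fst w"]
        unfolding power2_diff one_power2 by linarith
      from mult_right_mono[OF this nn[OF w]]
      show "norm (posterior_kernel n a b z w *\<^sub>R fst w)
        \<le> norm (posterior_kernel n a b z w + (norm (fst w))\<^sup>2 * posterior_kernel n a b z w)"
        using nn[OF w] by (simp add: algebra_simps)
    qed
  qed simp
qed

lemma set_lebesgue_integral_eq_restrict:
  fixes f :: "real \<Rightarrow> 'b::{banach, second_countable_topology}"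
  assumes "S \<in> sets borel"
  shows "(LINT x:S|lborel. f x) = (\<integral>x. f x \<partial>restrict_space lborel S)"
  unfolding set_lebesgue_integral_def using assms by (subst integral_restrict_space) auto

lemma prior_integrand_eq_posterior_kernel:
  fixes x \<theta> :: "real ^ 'p"
  assumes "0 < \<eta>"
  shows "\<eta> * fx \<theta> \<eta> x * fs n \<eta> s * prior a b \<theta> \<eta>
    = (\<integral>l. posterior_kernel n a b (x, s) (\<theta>, \<eta>, l) \<partial>restrict_space lborel {0<..<1})"
proof -
  have "\<eta> * fx \<theta> \<eta> x * fs n \<eta> s * prior a b \<theta> \<eta>
      = fx \<theta> \<eta> x * fs n \<eta> s * (\<integral>l. fx 0 (\<eta> * (l / (1 - l))) \<theta> * beta_density a b l \<partial>restrict_space lborel {0<..<1})"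
    using assms by (simp add: prior_hierarchical set_lebesgue_integral_eq_restrict)
  also have "\<dots> = (\<integral>l. fx \<theta> \<eta> x * fs n \<eta> s * (fx 0 (\<eta> * (l / (1 - l))) \<theta> * beta_density a b l) \<partial>restrict_space lborel {0<..<1})"
    by (rule integral_mult_right_zero[symmetric])
  also have "\<dots> = (\<integral>l. posterior_kernel n a b (x, s) (\<theta>, \<eta>, l) \<partial>restrict_space lborel {0<..<1})"
  proof (intro Bochner_Integration.integral_cong refl)
    fix l :: real assume "l \<in> space (restrict_space lborel {0<..<1})"
    then have "0 < l" "l < 1" by (auto simp: space_restrict_space)
    from fx_mult_fx[OF assms this, of \<theta> x]
    show "fx \<theta> \<eta> x * fs n \<eta> s * (fx 0 (\<eta> * (l / (1 - l))) \<theta> * beta_density a b l)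
        = posterior_kernel n a b (x, s) (\<theta>, \<eta>, l)"
      by (simp add: posterior_kernel_def joint_def mult_ac)
  qed
  finally show ?thesis .
qed

text \<open>
  Integrating \<open>\<theta>\<close> first replaces \<open>\<theta>\<close> by its conditional posterior mean \<open>(1 - l) x\<close>. For exceptional \<open>\<theta>\<close>, such as
  \<open>\<theta> = 0\<close>, the integral over \<open>l\<close> may diverge; Fubini's theorem confines this to a null set.
\<close>

lemma gen_bayes_prior:
  fixes x :: "real ^ 'p"
  assumes ab: "-1 < a" "-1 < b" and n: "0 < n" and s: "0 < s"
  shows "gen_bayes n (prior a b) (x, s) = x - posterior_shrinkage n a b (x, s) *\<^sub>R x"
proof -
  let ?E = "restrict_space lborel {0::real<..}" and ?U = "restrict_space lborel {0::real<..<1}"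
  have z: "(x, s) \<in> space obs" using s by (simp add: space_obs)
  let ?k = "posterior_kernel n a b (x, s)"
  let ?e = "enn2real (evidence n a b (x, s))"
  note I = integrable_posterior_kernel[OF ab n z]
  note ev = evidence_eq_integral[OF ab n z]
  let ?g = "\<lambda>\<theta> \<eta>. \<eta> * fx \<theta> \<eta> x * fs n \<eta> s * prior a b \<theta> \<eta>"
  have inner: "AE \<theta> in lborel. integrable ?E (?g \<theta>) \<and> (\<integral>\<eta>. ?g \<theta> \<eta> \<partial>?E) = (\<integral>y. ?k (\<theta>, y) \<partial>hyper)"
    using th.AE_integrable_fst'[OF I(1)]
  proof eventually_elim
    case (elim \<theta>)
    have e: "?g \<theta> \<eta> = (\<integral>l. ?k (\<theta>, \<eta>, l) \<partial>?U)" if "\<eta> \<in> space ?E" for \<eta>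
      using that by (intro prior_integrand_eq_posterior_kernel) (simp add: space_restrict_space)
    have "integrable ?E (?g \<theta>) \<longleftrightarrow> integrable ?E (\<lambda>\<eta>. \<integral>l. ?k (\<theta>, \<eta>, l) \<partial>?U)"
      by (rule Bochner_Integration.integrable_cong[OF refl e])
    moreover have "(\<integral>\<eta>. ?g \<theta> \<eta> \<partial>?E) = (\<integral>\<eta>. \<integral>l. ?k (\<theta>, \<eta>, l) \<partial>?U \<partial>?E)"
      by (rule Bochner_Integration.integral_cong[OF refl e])
    ultimately show ?case
      using hyper.integrable_fst'[OF elim] hyper.integral_fst'[OF elim] by simp
  qed
  have den: "(LINT \<theta>|lborel. (LINT \<eta>:{0<..}|lborel. ?g \<theta> \<eta>)) = ?e"
  proof -
    have "(LINT \<theta>|lborel. (LINT \<eta>:{0<..}|lborel. ?g \<theta> \<eta>)) = (\<integral>\<theta>. \<integral>\<eta>. ?g \<theta> \<eta> \<partial>?E \<partial>lborel)"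
      by (simp add: set_lebesgue_integral_eq_restrict)
    also have "\<dots> = (\<integral>\<theta>. \<integral>y. ?k (\<theta>, y) \<partial>hyper \<partial>lborel)"
      by (rule integral_cong_AE) (use inner in \<open>auto elim: eventually_mono\<close>)
    also have "\<dots> = (\<integral>y. \<integral>\<theta>. ?k (\<theta>, y) \<partial>lborel \<partial>hyper)"
      using th.integral_fst'[OF I(1)] th.integral_snd[of "\<lambda>\<theta> y. ?k (\<theta>, y)"] I(1) by simp
    also have "\<dots> = (\<integral>y. joint n a b (x, s) y \<partial>hyper)"
      by (intro Bochner_Integration.integral_cong refl)
        (auto simp: posterior_kernel_def integral_fx_scaleR space_hyper)
    finally show ?thesis using ev by simp
  qed
  have num: "(LINT \<theta>|lborel. (LINT \<eta>:{0<..}|lborel. ?g \<theta> \<eta> *\<^sub>R \<theta>))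
      = (\<integral>y. joint n a b (x, s) y * (1 - snd y) \<partial>hyper) *\<^sub>R x"
  proof -
    have "(LINT \<theta>|lborel. (LINT \<eta>:{0<..}|lborel. ?g \<theta> \<eta> *\<^sub>R \<theta>)) = (\<integral>\<theta>. \<integral>\<eta>. ?g \<theta> \<eta> *\<^sub>R \<theta> \<partial>?E \<partial>lborel)"
      by (simp add: set_lebesgue_integral_eq_restrict)
    also have "\<dots> = (\<integral>\<theta>. \<integral>y. ?k (\<theta>, y) *\<^sub>R \<theta> \<partial>hyper \<partial>lborel)"
    proof (rule integral_cong_AE)
      show "AE \<theta> in lborel. (\<integral>\<eta>. ?g \<theta> \<eta> *\<^sub>R \<theta> \<partial>?E) = (\<integral>y. ?k (\<theta>, y) *\<^sub>R \<theta> \<partial>hyper)"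
        using inner th.AE_integrable_fst'[OF I(1)] by eventually_elim simp
    qed measurable
    also have "\<dots> = (\<integral>y. \<integral>\<theta>. ?k (\<theta>, y) *\<^sub>R \<theta> \<partial>lborel \<partial>hyper)"
      using th.integral_fst'[OF I(2)] th.integral_snd[of "\<lambda>\<theta> y. ?k (\<theta>, y) *\<^sub>R \<theta>"] I(2) by (simp add: split_beta')
    also have "\<dots> = (\<integral>y. (joint n a b (x, s) y * (1 - snd y)) *\<^sub>R x \<partial>hyper)"
    proof (intro Bochner_Integration.integral_cong refl)
      fix y assume y: "y \<in> space hyper"
      let ?m = "(1 - snd y) *\<^sub>R x" and ?t = "fst y / (1 - snd y)"
      have t: "0 < ?t" using y by (auto simp: space_hyper)
      have "(\<integral>\<theta>. ?k (\<theta>, y) *\<^sub>R \<theta> \<partial>lborel) = (\<integral>\<theta>. joint n a b (x, s) y *\<^sub>R (fx ?m ?t \<theta> *\<^sub>R \<theta>) \<partial>lborel)"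
        by (intro Bochner_Integration.integral_cong) (auto simp: posterior_kernel_def mult.commute)
      also have "\<dots> = joint n a b (x, s) y *\<^sub>R ?m"
        using integral_scaleR_right[where M = lborel and c = "joint n a b (x, s) y" and f = "\<lambda>\<theta>. fx ?m ?t \<theta> *\<^sub>R \<theta>"]
          integral_fx_scaleR(3,4)[OF t, of ?m] by (simp del: scaleR_scaleR)
      finally show "(\<integral>\<theta>. ?k (\<theta>, y) *\<^sub>R \<theta> \<partial>lborel) = (joint n a b (x, s) y * (1 - snd y)) *\<^sub>R x" by simp
    qed
    also have "\<dots> = (\<integral>y. joint n a b (x, s) y * (1 - snd y) \<partial>hyper) *\<^sub>R x"
    proof (rule integral_scaleR_left)
      show "integrable hyper (\<lambda>y. joint n a b (x, s) y * (1 - snd y))"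
        by (rule Bochner_Integration.integrable_bound[OF ev(1)])
          (auto intro!: AE_I2 simp: abs_mult space_hyper mult_left_le)
    qed
    finally show ?thesis .
  qed
  have il: "integrable hyper (\<lambda>y. joint n a b (x, s) y * snd y)"
    by (rule Bochner_Integration.integrable_bound[OF ev(1)])
      (auto intro!: AE_I2 simp: abs_mult space_hyper mult_left_le)
  have "(\<integral>y. joint n a b (x, s) y * (1 - snd y) \<partial>hyper) = ?e - (\<integral>y. joint n a b (x, s) y * snd y \<partial>hyper)"
    using ev(1,2) il by (simp add: right_diff_distrib)
  also have "(\<integral>y. joint n a b (x, s) y * snd y \<partial>hyper) = posterior_shrinkage n a b (x, s) * ?e"
  proof -
    have "posterior_shrinkage n a b (x, s) = (\<integral>y. joint n a b (x, s) y * snd y / ?e \<partial>hyper)"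
      by (simp add: posterior_shrinkage_def)
    also have "\<dots> = (\<integral>y. joint n a b (x, s) y * snd y \<partial>hyper) / ?e" by (rule integral_divide_zero)
    finally show ?thesis using ev(3) by simp
  qed
  finally have "(\<integral>y. joint n a b (x, s) y * (1 - snd y) \<partial>hyper) = (1 - posterior_shrinkage n a b (x, s)) * ?e"
    by (simp add: left_diff_distrib)
  then have "gen_bayes n (prior a b) (x, s) = ((1 - posterior_shrinkage n a b (x, s)) * ?e / ?e) *\<^sub>R x"
    unfolding gen_bayes_def by (simp only: case_prod_conv den num) (simp add: divide_inverse mult.commute)
  then show ?thesis using ev(3) by (simp add: scaleR_diff_left)
qed

section \<open>Averaging the risk over the conditional prior\<close>

lemma estimator_iff_measurable_obs:
  fixes \<delta> :: "(real ^ 'p) \<times> real \<Rightarrow> real ^ 'p"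
  shows "estimator \<delta> \<longleftrightarrow> \<delta> \<in> borel_measurable obs"
proof -
  have "sets (borel \<Otimes>\<^sub>M restrict_space borel {0<..}) = sets (obs :: ((real ^ 'p) \<times> real) measure)"
    by (intro sets_pair_measure_cong sets_restrict_space_cong) simp_all
  then show ?thesis
    unfolding estimator_def by (simp cong: measurable_cong_sets)
qed

lemma risk_eq_nn_integral_obs:
  fixes \<delta> :: "(real ^ 'p) \<times> real \<Rightarrow> real ^ 'p"
  assumes [measurable]: "\<delta> \<in> borel_measurable obs"
  shows "risk n \<theta> \<eta> \<delta>
    = (\<integral>\<^sup>+z. ennreal (fx \<theta> \<eta> (fst z)) * ennreal (fs n \<eta> (snd z)) * ennreal (loss \<theta> \<eta> (\<delta> z)) \<partial>obs)"
proof -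
  let ?E = "restrict_space lborel {0::real<..}"
  have [measurable]: "(\<lambda>s. ennreal (fs n \<eta> s)) \<in> borel_measurable ?E"
    by (rule measurable_restrict_space1) measurable
  have "sigma_finite_measure (density ?E (\<lambda>s. ennreal (fs n \<eta> s)))"
    by (subst obs.M2.sigma_finite_iff_density_finite) auto
  then have "sampling_law n \<theta> \<eta> = density obs (\<lambda>(x, s). ennreal (fx \<theta> \<eta> x) * ennreal (fs n \<eta> s))"
    unfolding sampling_law_def
    by (intro pair_measure_density obs.M2.sigma_finite_measure_axioms) measurable
  then show ?thesis
    unfolding risk_def loss_def by (simp add: nn_integral_density split_beta')
qed

text \<open>
  The inner integral over \<open>\<theta>\<close> is a bias-variance decomposition around the posterior mean
  \<open>(1 - l) x\<close>, whose variance term depends neither on \<open>\<delta>\<close> nor on the observation.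
\<close>

lemma nn_integral_risk_conjugate_prior:
  fixes \<delta> :: "(real ^ 'p) \<times> real \<Rightarrow> real ^ 'p"
  assumes n: "0 < n" and y: "y \<in> space hyper" and [measurable]: "\<delta> \<in> borel_measurable obs"
  shows "(\<integral>\<^sup>+\<theta>. ennreal (fx 0 (fst y * (snd y / (1 - snd y))) \<theta>) * risk n \<theta> (fst y) \<delta> \<partial>lborel)
    = ennreal (fst y) * (
        (\<integral>\<^sup>+z. ennreal ((norm (\<delta> z - (1 - snd y) *\<^sub>R fst z))\<^sup>2 * (fx 0 (fst y * snd y) (fst z) * fs n (fst y) (snd z))) \<partial>obs)
        + (\<integral>\<^sup>+x. ennreal ((norm x)\<^sup>2 * fx 0 (fst y / (1 - snd y)) x) \<partial>(lborel :: (real ^ 'p) measure)))"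
proof -
  define \<eta> l where "\<eta> = fst y" and "l = snd y"
  have \<eta>: "0 < \<eta>" and l: "0 < l" "l < 1" using y by (auto simp: \<eta>_def l_def space_hyper)
  have t: "0 < \<eta> / (1 - l)" using \<eta> l by simp
  let ?V = "\<integral>\<^sup>+x. ennreal ((norm x)\<^sup>2 * fx 0 (\<eta> / (1 - l)) x) \<partial>(lborel :: (real ^ 'p) measure)"
  let ?p = "\<lambda>z :: (real ^ 'p) \<times> real. fx 0 (\<eta> * l) (fst z) * fs n \<eta> (snd z)"
  let ?m = "\<lambda>z :: (real ^ 'p) \<times> real. (1 - l) *\<^sub>R fst z"
  interpret Q: pair_sigma_finite "lborel :: (real ^ 'p) measure" "obs :: ((real ^ 'p) \<times> real) measure" ..
  have p0: "0 \<le> fs n \<eta> (snd z)" if "z \<in> space (obs :: ((real ^ 'p) \<times> real) measure)" for z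
    using that fs_pos[OF n \<eta>, of "snd z"] by (simp add: space_obs)
  have p1: "(\<integral>\<^sup>+z. ennreal (?p z) \<partial>obs) = 1"
  proof -
    have "(\<integral>\<^sup>+z. ennreal (?p z) \<partial>obs) = (\<integral>\<^sup>+z. ennreal (fx 0 (\<eta> * l) (fst z)) * ennreal (fs n \<eta> (snd z)) \<partial>(obs :: ((real ^ 'p) \<times> real) measure))"
      by (intro nn_integral_cong ennreal_mult') simp
    also have "\<dots> = (\<integral>\<^sup>+x. ennreal (fx 0 (\<eta> * l) x) \<partial>(lborel :: (real ^ 'p) measure))
        * (\<integral>\<^sup>+s. ennreal (fs n \<eta> s) \<partial>restrict_space lborel {0<..})"
      by (rule obs.nn_integral_prod_mult) (auto intro!: measurable_restrict_space1)
    also have "(\<integral>\<^sup>+s. ennreal (fs n \<eta> s) \<partial>restrict_space lborel {0<..})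
        = (\<integral>\<^sup>+s. ennreal ((\<eta> * s) powr 0 * fs n \<eta> s) \<partial>restrict_space lborel {0<..})"
      using \<eta> by (intro nn_integral_cong) (simp add: space_restrict_space)
    also have "\<dots> = 1"
    proof -
      have "Gamma (real n / 2) \<noteq> 0" using Gamma_real_pos[of "n / 2"] n by (intro notI) simp
      moreover have "0 < n / 2 + (0 :: real)" using n by simp
      ultimately show ?thesis by (subst nn_integral_fs_moment[OF n \<eta>]) simp_all
    qed
    finally show ?thesis using \<eta> l by (simp add: nn_integral_fx)
  qed
  have "(\<integral>\<^sup>+\<theta>. ennreal (fx 0 (\<eta> * (l / (1 - l))) \<theta>) * risk n \<theta> \<eta> \<delta> \<partial>lborel)
    = (\<integral>\<^sup>+\<theta>. \<integral>\<^sup>+z. ennreal \<eta> * (ennreal (?p z) * ennreal ((norm (\<delta> z - \<theta>))\<^sup>2 * fx (?m z) (\<eta> / (1 - l)) \<theta>)) \<partial>obs \<partial>lborel)"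
  proof (rule nn_integral_cong)
    fix \<theta> :: "real ^ 'p"
    have "ennreal (fx 0 (\<eta> * (l / (1 - l))) \<theta>) * risk n \<theta> \<eta> \<delta>
      = (\<integral>\<^sup>+z. ennreal (fx 0 (\<eta> * (l / (1 - l))) \<theta>) * (ennreal (fx \<theta> \<eta> (fst z)) * ennreal (fs n \<eta> (snd z)) * ennreal (loss \<theta> \<eta> (\<delta> z))) \<partial>obs)"
      unfolding risk_eq_nn_integral_obs[OF assms(3)] loss_def by (rule nn_integral_cmult[symmetric]) measurable
    also have "\<dots> = (\<integral>\<^sup>+z. ennreal \<eta> * (ennreal (?p z) * ennreal ((norm (\<delta> z - \<theta>))\<^sup>2 * fx (?m z) (\<eta> / (1 - l)) \<theta>)) \<partial>obs)"
    proof (rule nn_integral_cong)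
      fix z :: "(real ^ 'p) \<times> real" assume z: "z \<in> space obs"
      have regroup: "ennreal A * (ennreal B * ennreal C * ennreal (D * E)) = ennreal D * (ennreal F * ennreal (E * G))"
        if "A * B * C = F * G" "0 \<le> A" "0 \<le> B" "0 \<le> C" "0 \<le> D" "0 \<le> E" "0 \<le> F" "0 \<le> G" for A B C D E F G
      proof -
        have "ennreal A * (ennreal B * ennreal C * ennreal (D * E)) = ennreal (D * E * (A * B * C))"
          using that(2-) by (simp add: ennreal_mult mult_ac)
        also have "\<dots> = ennreal D * (ennreal F * ennreal (E * G))"
          unfolding that(1) using that(2-) by (simp add: ennreal_mult mult_ac)
        finally show ?thesis .
      qed
      have "fx 0 (\<eta> * (l / (1 - l))) \<theta> * fx \<theta> \<eta> (fst z) * fs n \<eta> (snd z) = ?p z * fx (?m z) (\<eta> / (1 - l)) \<theta>"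
        using fx_mult_fx[OF \<eta> l, of \<theta> "fst z"] by (simp add: mult_ac)
      then show "ennreal (fx 0 (\<eta> * (l / (1 - l))) \<theta>) * (ennreal (fx \<theta> \<eta> (fst z)) * ennreal (fs n \<eta> (snd z)) * ennreal (loss \<theta> \<eta> (\<delta> z)))
        = ennreal \<eta> * (ennreal (?p z) * ennreal ((norm (\<delta> z - \<theta>))\<^sup>2 * fx (?m z) (\<eta> / (1 - l)) \<theta>))"
        unfolding loss_def by (rule regroup) (use p0[OF z] \<eta> in simp_all)
    qed
    finally show "ennreal (fx 0 (\<eta> * (l / (1 - l))) \<theta>) * risk n \<theta> \<eta> \<delta>
      = (\<integral>\<^sup>+z. ennreal \<eta> * (ennreal (?p z) * ennreal ((norm (\<delta> z - \<theta>))\<^sup>2 * fx (?m z) (\<eta> / (1 - l)) \<theta>)) \<partial>obs)" .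
  qed
  also have "\<dots> = (\<integral>\<^sup>+z. \<integral>\<^sup>+\<theta>. ennreal \<eta> * (ennreal (?p z) * ennreal ((norm (\<delta> z - \<theta>))\<^sup>2 * fx (?m z) (\<eta> / (1 - l)) \<theta>)) \<partial>lborel \<partial>obs)"
    by (rule Q.Fubini'[symmetric]) measurable
  also have "\<dots> = (\<integral>\<^sup>+z. ennreal \<eta> * (ennreal (?p z) * (\<integral>\<^sup>+\<theta>. ennreal ((norm (\<delta> z - \<theta>))\<^sup>2 * fx (?m z) (\<eta> / (1 - l)) \<theta>) \<partial>lborel)) \<partial>obs)"
    by (intro nn_integral_cong, subst nn_integral_cmult, simp, subst nn_integral_cmult, simp, rule refl)
  also have "\<dots> = (\<integral>\<^sup>+z. ennreal \<eta> * (ennreal ((norm (\<delta> z - ?m z))\<^sup>2 * ?p z) + ?V * ennreal (?p z)) \<partial>obs)"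
    unfolding bias_variance[OF t]
    using p0 by (intro nn_integral_cong) (simp add: distrib_left ennreal_mult mult_ac)
  also have "\<dots> = ennreal \<eta> * (\<integral>\<^sup>+z. ennreal ((norm (\<delta> z - ?m z))\<^sup>2 * ?p z) + ?V * ennreal (?p z) \<partial>obs)"
    by (rule nn_integral_cmult) measurable
  also have "(\<integral>\<^sup>+z. ennreal ((norm (\<delta> z - ?m z))\<^sup>2 * ?p z) + ?V * ennreal (?p z) \<partial>obs)
      = (\<integral>\<^sup>+z. ennreal ((norm (\<delta> z - ?m z))\<^sup>2 * ?p z) \<partial>obs) + ?V * (\<integral>\<^sup>+z. ennreal (?p z) \<partial>obs)"
    by (simp add: nn_integral_add nn_integral_cmult)
  also note p1
  finally show ?thesis unfolding \<eta>_def l_def mult_1_right .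
qed

text \<open>
  The common variance is finite for each single \<open>(\<eta>, l)\<close> and can be cancelled there, before any
  integration over the hyperparameters.
\<close>

lemma risk_le_imp_shrinkage_risk_le:
  fixes \<delta> \<delta>' :: "(real ^ 'p) \<times> real \<Rightarrow> real ^ 'p"
  assumes n: "0 < n" and y: "y \<in> space hyper"
    and m: "\<delta> \<in> borel_measurable obs" "\<delta>' \<in> borel_measurable obs"
    and le: "\<And>\<theta>. risk n \<theta> (fst y) \<delta>' \<le> risk n \<theta> (fst y) \<delta>"
  shows "(\<integral>\<^sup>+z. ennreal ((norm (\<delta>' z - (1 - snd y) *\<^sub>R fst z))\<^sup>2 * (fx 0 (fst y * snd y) (fst z) * fs n (fst y) (snd z))) \<partial>obs)
    \<le> (\<integral>\<^sup>+z. ennreal ((norm (\<delta> z - (1 - snd y) *\<^sub>R fst z))\<^sup>2 * (fx 0 (fst y * snd y) (fst z) * fs n (fst y) (snd z))) \<partial>obs)"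
    (is "?R' \<le> ?R")
proof -
  let ?V = "\<integral>\<^sup>+x. ennreal ((norm x)\<^sup>2 * fx 0 (fst y / (1 - snd y)) x) \<partial>(lborel :: (real ^ 'p) measure)"
  have \<eta>: "0 < fst y" and t: "0 < fst y / (1 - snd y)" using y by (auto simp: space_hyper)
  have V: "?V \<noteq> \<infinity>"
    using nn_integral_norm_power_fx_le[OF t, of 1, where 'p = 'p] by (auto simp: top_unique)
  have "(\<integral>\<^sup>+\<theta>. ennreal (fx 0 (fst y * (snd y / (1 - snd y))) \<theta>) * risk n \<theta> (fst y) \<delta>' \<partial>lborel)
      \<le> (\<integral>\<^sup>+\<theta>. ennreal (fx 0 (fst y * (snd y / (1 - snd y))) \<theta>) * risk n \<theta> (fst y) \<delta> \<partial>lborel)"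
    by (intro nn_integral_mono mult_left_mono le) simp
  then have "ennreal (fst y) * (?R' + ?V) \<le> ennreal (fst y) * (?R + ?V)"
    unfolding nn_integral_risk_conjugate_prior[OF n y m(1)] nn_integral_risk_conjugate_prior[OF n y m(2)] .
  then have "?R' + ?V \<le> ?R + ?V"
    using \<eta> by (simp add: ennreal_mult_le_mult_iff)
  then show ?thesis
    using V by (simp add: add.commute[of _ ?V] ennreal_add_left_cancel_le)
qed

section \<open>The cut-off functions\<close>

definition log_cutoff :: "nat \<Rightarrow> real \<times> real \<Rightarrow> real" where
  "log_cutoff i y = (real i + 1) / (real i + 1 + \<bar>ln (fst y)\<bar>)"

lemma log_cutoff_measurable [measurable]: "log_cutoff i \<in> borel_measurable hyper"
  unfolding log_cutoff_def[abs_def] by measurable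

lemma log_cutoff_bounds: "0 < log_cutoff i y" "log_cutoff i y \<le> 1"
  by (simp_all add: log_cutoff_def add_pos_nonneg)

lemma log_cutoff_mono: "log_cutoff 0 y \<le> log_cutoff i y"
proof -
  let ?t = "\<bar>ln (fst y)\<bar>"
  have "1 / (1 + ?t) \<le> (real i + 1) / (real i + 1 + ?t)"
    by (subst frac_le_eq) (auto simp: add_pos_nonneg divide_le_0_iff algebra_simps mult_nonneg_nonneg)
  then show ?thesis by (simp add: log_cutoff_def)
qed

lemma log_cutoff_tendsto_1: "(\<lambda>i. log_cutoff i y) \<longlonglongrightarrow> 1"
proof -
  let ?t = "\<bar>ln (fst y)\<bar>"
  have "(\<lambda>i. 1 / (1 + ?t * inverse (real (Suc i)))) \<longlonglongrightarrow> 1 / (1 + ?t * 0)"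
    by (intro tendsto_intros LIMSEQ_inverse_real_of_nat) simp
  moreover have "log_cutoff i y = 1 / (1 + ?t * inverse (real (Suc i)))" for i
    by (simp add: log_cutoff_def field_simps)
  ultimately show ?thesis by simp
qed

text \<open>
  The increment equals \<open>I / (I + |t'|) \<cdot> (|t'| - |t|) / (I + |t|)\<close> with \<open>I = i + 1 \<ge> 1\<close>; bounding
  the first factor by \<open>1\<close> and \<open>I\<close> by \<open>1\<close> from below in the second one removes the dependence on \<open>i\<close>.
\<close>

lemma log_cutoff_diff_le: "(log_cutoff i y - log_cutoff i y')\<^sup>2 \<le> log_weight y y'"
proof -
  define t t' I where "t = ln (fst y)" and "t' = ln (fst y')" and "I = real i + 1"
  have I: "1 \<le> I" by (simp add: I_def)
  have "\<bar>I / (I + \<bar>t\<bar>) - I / (I + \<bar>t'\<bar>)\<bar> = (I / (I + \<bar>t'\<bar>)) * (\<bar>\<bar>t'\<bar> - \<bar>t\<bar>\<bar> / (I + \<bar>t\<bar>))"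
  proof -
    have "I / (I + \<bar>t\<bar>) - I / (I + \<bar>t'\<bar>) = (I / (I + \<bar>t'\<bar>)) * ((\<bar>t'\<bar> - \<bar>t\<bar>) / (I + \<bar>t\<bar>))"
    proof -
      have "I + \<bar>t\<bar> \<noteq> 0" "I + \<bar>t'\<bar> \<noteq> 0" using I by linarith+
      then show ?thesis by (simp add: divide_simps) (simp add: algebra_simps)
    qed
    then show ?thesis using I by (simp add: abs_mult)
  qed
  also have "\<dots> \<le> 1 * ((1 + \<bar>t - t'\<bar>) / (1 + \<bar>t\<bar>))"
    using I by (intro mult_mono frac_le) auto
  finally have "\<bar>I / (I + \<bar>t\<bar>) - I / (I + \<bar>t'\<bar>)\<bar>\<^sup>2 \<le> ((1 + \<bar>t - t'\<bar>) / (1 + \<bar>t\<bar>))\<^sup>2"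
    by (intro power_mono) auto
  then show ?thesis
    by (simp add: log_cutoff_def log_weight_def t_def t'_def I_def power_divide)
qed

lemma log_cutoff_square_le:
  "(log_cutoff i y)\<^sup>2 \<le> (real i + 1)\<^sup>2 * log_weight y y'"
  "(log_cutoff i y')\<^sup>2 \<le> (real i + 1)\<^sup>2 * log_weight y y'"
proof -
  define t t' I where "t = ln (fst y)" and "t' = ln (fst y')" and "I = real i + 1"
  have I: "1 \<le> I" by (simp add: I_def)
  have "I / (I + \<bar>t\<bar>) \<le> I * (1 + \<bar>t - t'\<bar>) / (1 + \<bar>t\<bar>)"
    using I by (intro frac_le) auto
  then have "(I / (I + \<bar>t\<bar>))\<^sup>2 \<le> (I * (1 + \<bar>t - t'\<bar>) / (1 + \<bar>t\<bar>))\<^sup>2"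
    using I by (intro power_mono) auto
  then show "(log_cutoff i y)\<^sup>2 \<le> (real i + 1)\<^sup>2 * log_weight y y'"
    by (simp add: log_cutoff_def log_weight_def t_def t'_def I_def power_divide power_mult_distrib)
  \<comment> \<open>Peetre's inequality moves the decay from \<open>t'\<close> to \<open>t\<close>.\<close>
  have "1 + \<bar>t\<bar> \<le> (1 + \<bar>t'\<bar>) * (1 + \<bar>t - t'\<bar>)"
  proof -
    have "\<bar>t\<bar> \<le> \<bar>t'\<bar> + \<bar>t - t'\<bar>" "0 \<le> \<bar>t'\<bar> * \<bar>t - t'\<bar>" by simp_all
    then show ?thesis by (simp only: distrib_left distrib_right mult_1 mult_1_right)
  qed
  then have "1 / (1 + \<bar>t'\<bar>) \<le> (1 + \<bar>t - t'\<bar>) / (1 + \<bar>t\<bar>)"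
    by (simp add: divide_simps add_pos_nonneg mult.commute)
  then have "I * (1 / (1 + \<bar>t'\<bar>)) \<le> I * ((1 + \<bar>t - t'\<bar>) / (1 + \<bar>t\<bar>))"
    using I by (intro mult_left_mono) auto
  moreover have "I / (I + \<bar>t'\<bar>) \<le> I / (1 + \<bar>t'\<bar>)"
    using I by (intro divide_left_mono) (auto intro!: mult_pos_pos add_pos_nonneg)
  ultimately have "I / (I + \<bar>t'\<bar>) \<le> I * (1 + \<bar>t - t'\<bar>) / (1 + \<bar>t\<bar>)" by simp
  then have "(I / (I + \<bar>t'\<bar>))\<^sup>2 \<le> (I * (1 + \<bar>t - t'\<bar>) / (1 + \<bar>t\<bar>))\<^sup>2"
    using I by (intro power_mono) auto
  then show "(log_cutoff i y')\<^sup>2 \<le> (real i + 1)\<^sup>2 * log_weight y y'"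
    by (simp add: log_cutoff_def log_weight_def t_def t'_def I_def power_divide power_mult_distrib)
qed

section \<open>Admissibility\<close>

text \<open>
  Blyth's method applied to \<open>u = x - \<delta>'\<close>, a competitor of \<open>L x\<close>. The marginal law of the observation has
  density \<open>evidence\<close>, so that the posterior density \<open>k\<close> times it is \<open>joint\<close> again.
\<close>

lemma AE_eq_of_risk_le:
  fixes \<delta>' :: "(real ^ 'p) \<times> real \<Rightarrow> real ^ 'p"
  assumes ab: "-1 < a" "-1 < b" and n: "0 < n"
    and m': "\<delta>' \<in> borel_measurable obs"
  defines "\<delta> \<equiv> \<lambda>z. fst z - posterior_shrinkage n a b z *\<^sub>R fst z"
  assumes le: "\<And>\<theta> \<eta>. 0 < \<eta> \<Longrightarrow> risk n \<theta> \<eta> \<delta>' \<le> risk n \<theta> \<eta> \<delta>"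
  shows "AE z in obs. \<delta>' z = \<delta> z"
proof -
  define e where "e z = enn2real (evidence n a b z)" for z :: "(real ^ 'p) \<times> real"
  note [measurable] = m'
  have e_meas[measurable]: "e \<in> borel_measurable obs" unfolding e_def[abs_def] by measurable
  have e: "0 < e z" "evidence n a b z = ennreal (e z)" if "z \<in> space obs" for z
    using evidence_eq_integral(3,4)[OF ab n that] by (simp_all add: e_def)
  let ?A = "density obs (\<lambda>z. ennreal (e z))"
  define k where "k z y = joint n a b z y / e z" for z y
  have m: "\<delta> \<in> borel_measurable obs" unfolding \<delta>_def by measurable
  have unnorm: "(\<integral>\<^sup>+z. \<integral>\<^sup>+y. ennreal (g z y * k z y) \<partial>hyper \<partial>?A) = (\<integral>\<^sup>+z. \<integral>\<^sup>+y. ennreal (g z y * joint n a b z y) \<partial>hyper \<partial>obs)"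
    if [measurable]: "(\<lambda>(z, y). g z y) \<in> borel_measurable (obs \<Otimes>\<^sub>M hyper)" for g
  proof -
    have "(\<integral>\<^sup>+z. \<integral>\<^sup>+y. ennreal (g z y * k z y) \<partial>hyper \<partial>?A)
        = (\<integral>\<^sup>+z. ennreal (e z) * (\<integral>\<^sup>+y. ennreal (g z y * k z y) \<partial>hyper) \<partial>obs)"
      unfolding k_def by (rule nn_integral_density) measurable
    also have "\<dots> = (\<integral>\<^sup>+z. \<integral>\<^sup>+y. ennreal (g z y * joint n a b z y) \<partial>hyper \<partial>obs)"
    proof (rule nn_integral_cong)
      fix z :: "(real ^ 'p) \<times> real" assume z: "z \<in> space obs"
      have [measurable]: "g z \<in> borel_measurable hyper"
        using measurable_Pair2[OF that z] by simp
      have "ennreal (e z) * (\<integral>\<^sup>+y. ennreal (g z y * k z y) \<partial>hyper)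
          = (\<integral>\<^sup>+y. ennreal (e z) * ennreal (g z y * k z y) \<partial>hyper)"
        unfolding k_def by (rule nn_integral_cmult[symmetric]) measurable
      also have "\<dots> = (\<integral>\<^sup>+y. ennreal (g z y * joint n a b z y) \<partial>hyper)"
        using e(1)[OF z] by (intro nn_integral_cong) (simp add: k_def ennreal_mult'[symmetric])
      finally show "ennreal (e z) * (\<integral>\<^sup>+y. ennreal (g z y * k z y) \<partial>hyper)
          = (\<integral>\<^sup>+y. ennreal (g z y * joint n a b z y) \<partial>hyper)" .
    qed
    finally show ?thesis .
  qed
  have "AE z in ?A. fst z - \<delta>' z = (\<integral>y. k z y * snd y \<partial>hyper) *\<^sub>R fst z"
  proof (rule blyth_limit[where h = log_cutoff and H = log_weight and f = snd and \<xi> = fst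
        and c = "\<lambda>i. (real i + 1)\<^sup>2" and B = hyper and k = k])
    show "sigma_finite_measure ?A"
      using obs.sigma_finite_iff_density_finite[of "\<lambda>z. ennreal (e z)"] by simp
    show "sigma_finite_measure hyper" by (rule hyper.sigma_finite_measure_axioms)
    show "(\<lambda>(z, y). k z y) \<in> borel_measurable (?A \<Otimes>\<^sub>M hyper)"
      unfolding k_def by measurable
    show "snd \<in> borel_measurable hyper" "log_cutoff i \<in> borel_measurable hyper"
      "(\<lambda>(y, y'). log_weight y y') \<in> borel_measurable (hyper \<Otimes>\<^sub>M hyper)"
      "fst \<in> borel_measurable ?A" "(\<lambda>z. fst z - \<delta>' z) \<in> borel_measurable ?A" for i
      by measurable
    show "0 \<le> k z y" if "z \<in> space ?A" "y \<in> space hyper" for z y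
      using joint_pos[OF ab n, of z y] e(1)[of z] that by (simp add: k_def less_imp_le)
    show "(\<integral>\<^sup>+y. ennreal (k z y) \<partial>hyper) = 1" if "z \<in> space ?A" for z
    proof -
      have z: "z \<in> space obs" using that by simp
      have "(\<integral>\<^sup>+y. ennreal (k z y) \<partial>hyper) = (\<integral>\<^sup>+y. ennreal (1 / e z) * ennreal (joint n a b z y) \<partial>hyper)"
        using e(1)[OF z] by (intro nn_integral_cong) (simp add: k_def ennreal_mult'[symmetric])
      also have "\<dots> = ennreal (1 / e z) * ennreal (e z)"
        unfolding e(2)[OF z, symmetric] evidence_def by (rule nn_integral_cmult) measurable
      also have "\<dots> = 1" using e(1)[OF z] by (simp add: ennreal_mult'[symmetric])
      finally show ?thesis .
    qed
    show "0 \<le> snd y \<and> snd y \<le> 1" if "y \<in> space hyper" for y using that by (auto simp: space_hyper)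
    show "(\<integral>\<^sup>+z. \<integral>\<^sup>+y. \<integral>\<^sup>+y'. ennreal ((norm (fst z))\<^sup>2 * (snd y)\<^sup>2 * log_weight y y' * k z y * k z y') \<partial>hyper \<partial>hyper \<partial>?A) < \<infinity>"
    proof -
      have "(\<integral>\<^sup>+z. \<integral>\<^sup>+y. \<integral>\<^sup>+y'. ennreal ((norm (fst z))\<^sup>2 * (snd y)\<^sup>2 * log_weight y y' * k z y * k z y') \<partial>hyper \<partial>hyper \<partial>?A)
          = (\<integral>\<^sup>+z. ennreal (e z) * (\<integral>\<^sup>+y. \<integral>\<^sup>+y'. ennreal ((norm (fst z))\<^sup>2 * (snd y)\<^sup>2 * log_weight y y' * k z y * k z y') \<partial>hyper \<partial>hyper) \<partial>obs)"
        unfolding k_def by (rule nn_integral_density) measurable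
      also have "\<dots> = (\<integral>\<^sup>+z. \<integral>\<^sup>+y. \<integral>\<^sup>+y'. ennreal ((norm (fst z))\<^sup>2 * (snd y)\<^sup>2 * log_weight y y'
          * joint n a b z y * joint n a b z y' / e z) \<partial>hyper \<partial>hyper \<partial>obs)"
      proof (rule nn_integral_cong)
        fix z :: "(real ^ 'p) \<times> real" assume z: "z \<in> space obs"
        have "ennreal (e z) * (\<integral>\<^sup>+y. \<integral>\<^sup>+y'. ennreal ((norm (fst z))\<^sup>2 * (snd y)\<^sup>2 * log_weight y y' * k z y * k z y') \<partial>hyper \<partial>hyper)
            = (\<integral>\<^sup>+y. ennreal (e z) * (\<integral>\<^sup>+y'. ennreal ((norm (fst z))\<^sup>2 * (snd y)\<^sup>2 * log_weight y y' * k z y * k z y') \<partial>hyper) \<partial>hyper)"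
          unfolding k_def by (rule nn_integral_cmult[symmetric]) measurable
        also have "\<dots> = (\<integral>\<^sup>+y. \<integral>\<^sup>+y'. ennreal (e z) * ennreal ((norm (fst z))\<^sup>2 * (snd y)\<^sup>2 * log_weight y y' * k z y * k z y') \<partial>hyper \<partial>hyper)"
          unfolding k_def by (intro nn_integral_cong nn_integral_cmult[symmetric]) measurable
        also have "\<dots> = (\<integral>\<^sup>+y. \<integral>\<^sup>+y'. ennreal ((norm (fst z))\<^sup>2 * (snd y)\<^sup>2 * log_weight y y'
          * joint n a b z y * joint n a b z y' / e z) \<partial>hyper \<partial>hyper)"
          using e(1)[OF z] by (intro nn_integral_cong) (simp add: k_def ennreal_mult'[symmetric])
        finally show "ennreal (e z) * (\<integral>\<^sup>+y. \<integral>\<^sup>+y'. ennreal ((norm (fst z))\<^sup>2 * (snd y)\<^sup>2 * log_weight y y' * k z y * k z y') \<partial>hyper \<partial>hyper)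
          = (\<integral>\<^sup>+y. \<integral>\<^sup>+y'. ennreal ((norm (fst z))\<^sup>2 * (snd y)\<^sup>2 * log_weight y y'
          * joint n a b z y * joint n a b z y' / e z) \<partial>hyper \<partial>hyper)" .
      qed
      also have "\<dots> < \<infinity>" unfolding e_def by (rule domination_finite[OF ab n])
      finally show ?thesis .
    qed
    show "(\<integral>\<^sup>+z. \<integral>\<^sup>+y. ennreal ((norm (fst z - \<delta>' z - snd y *\<^sub>R fst z))\<^sup>2 * (log_cutoff i y)\<^sup>2 * k z y) \<partial>hyper \<partial>?A)
      \<le> (\<integral>\<^sup>+z. \<integral>\<^sup>+y. ennreal ((norm ((\<integral>y. k z y * snd y \<partial>hyper) *\<^sub>R fst z - snd y *\<^sub>R fst z))\<^sup>2 * (log_cutoff i y)\<^sup>2 * k z y) \<partial>hyper \<partial>?A)" for i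
    proof -
      have swap: "(\<integral>\<^sup>+z. \<integral>\<^sup>+y. ennreal ((norm (fst z - d z - snd y *\<^sub>R fst z))\<^sup>2 * (log_cutoff i y)\<^sup>2 * k z y) \<partial>hyper \<partial>?A)
        = (\<integral>\<^sup>+y. ennreal ((log_cutoff i y)\<^sup>2 * beta_density a b (snd y)) *
            (\<integral>\<^sup>+z. ennreal ((norm (d z - (1 - snd y) *\<^sub>R fst z))\<^sup>2 * (fx 0 (fst y * snd y) (fst z) * fs n (fst y) (snd z))) \<partial>obs) \<partial>hyper)"
        if [measurable]: "d \<in> borel_measurable obs" for d :: "(real ^ 'p) \<times> real \<Rightarrow> real ^ 'p"
      proof -
        have "(\<integral>\<^sup>+z. \<integral>\<^sup>+y. ennreal ((norm (fst z - d z - snd y *\<^sub>R fst z))\<^sup>2 * (log_cutoff i y)\<^sup>2 * k z y) \<partial>hyper \<partial>?A)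
          = (\<integral>\<^sup>+z. \<integral>\<^sup>+y. ennreal ((norm (fst z - d z - snd y *\<^sub>R fst z))\<^sup>2 * (log_cutoff i y)\<^sup>2 * joint n a b z y) \<partial>hyper \<partial>obs)"
          by (rule unnorm) measurable
        also have "\<dots> = (\<integral>\<^sup>+y. \<integral>\<^sup>+z. ennreal ((norm (fst z - d z - snd y *\<^sub>R fst z))\<^sup>2 * (log_cutoff i y)\<^sup>2 * joint n a b z y) \<partial>obs \<partial>hyper)"
          by (rule oh.Fubini'[symmetric]) measurable
        also have "\<dots> = (\<integral>\<^sup>+y. \<integral>\<^sup>+z. ennreal ((log_cutoff i y)\<^sup>2 * beta_density a b (snd y)) *
            ennreal ((norm (d z - (1 - snd y) *\<^sub>R fst z))\<^sup>2 * (fx 0 (fst y * snd y) (fst z) * fs n (fst y) (snd z))) \<partial>obs \<partial>hyper)"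
        proof (intro nn_integral_cong)
          fix y z assume y: "y \<in> space hyper"
          have "norm (fst z - d z - snd y *\<^sub>R fst z) = norm (d z - (1 - snd y) *\<^sub>R fst z)"
            using norm_minus_cancel[of "fst z - d z - snd y *\<^sub>R fst z"] by (simp add: scaleR_diff_left algebra_simps)
          moreover have "0 \<le> (log_cutoff i y)\<^sup>2 * beta_density a b (snd y)"
            using y beta_density_pos[OF ab, of "snd y"] by (simp add: space_hyper)
          ultimately show "ennreal ((norm (fst z - d z - snd y *\<^sub>R fst z))\<^sup>2 * (log_cutoff i y)\<^sup>2 * joint n a b z y)
            = ennreal ((log_cutoff i y)\<^sup>2 * beta_density a b (snd y)) *
            ennreal ((norm (d z - (1 - snd y) *\<^sub>R fst z))\<^sup>2 * (fx 0 (fst y * snd y) (fst z) * fs n (fst y) (snd z)))"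
            by (simp only: ennreal_mult'[symmetric] joint_def) (simp only: mult_ac)
        qed
        also have "\<dots> = (\<integral>\<^sup>+y. ennreal ((log_cutoff i y)\<^sup>2 * beta_density a b (snd y)) *
            (\<integral>\<^sup>+z. ennreal ((norm (d z - (1 - snd y) *\<^sub>R fst z))\<^sup>2 * (fx 0 (fst y * snd y) (fst z) * fs n (fst y) (snd z))) \<partial>obs) \<partial>hyper)"
          by (intro nn_integral_cong nn_integral_cmult) measurable
        finally show ?thesis .
      qed
      have eq: "(\<integral>y. k z y * snd y \<partial>hyper) *\<^sub>R fst z = fst z - \<delta> z" for z
        by (simp add: \<delta>_def k_def e_def posterior_shrinkage_def)
      show ?thesis
        unfolding eq swap[OF m'] swap[OF m]
        by (intro nn_integral_mono mult_left_mono risk_le_imp_shrinkage_risk_le n m m' le) (auto simp: space_hyper)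
    qed
  qed (auto intro: log_cutoff_bounds log_cutoff_mono log_cutoff_tendsto_1 log_cutoff_diff_le log_cutoff_square_le)
  then have "AE z in obs. 0 < ennreal (e z) \<longrightarrow> fst z - \<delta>' z = (\<integral>y. k z y * snd y \<partial>hyper) *\<^sub>R fst z"
    by (subst (asm) AE_density) auto
  then show ?thesis
  proof (rule AE_mp, intro AE_I2 impI)
    fix z :: "(real ^ 'p) \<times> real" assume z: "z \<in> space obs"
      and "0 < ennreal (e z) \<longrightarrow> fst z - \<delta>' z = (\<integral>y. k z y * snd y \<partial>hyper) *\<^sub>R fst z"
    then have "fst z - \<delta>' z = posterior_shrinkage n a b z *\<^sub>R fst z"
      using e(1)[OF z] by (simp add: k_def e_def posterior_shrinkage_def)
    then show "\<delta>' z = \<delta> z" unfolding \<delta>_def by (simp add: algebra_simps)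
  qed
qed

theorem theorem2p1:
  fixes n :: nat and a b :: real
  assumes "n > 0"
    and "- 1 < a" and "a < n / 2"
    and "b > - 1 / 2"
  shows "admissible n (gen_bayes n (prior a b) :: (real ^ 'p) \<times> real \<Rightarrow> real ^ 'p)"
proof -
  have ab: "-1 < a" "-1 < b" and n: "0 < n" using assms by auto
  let ?\<delta> = "gen_bayes n (prior a b) :: (real ^ 'p) \<times> real \<Rightarrow> real ^ 'p"
  let ?d = "\<lambda>z :: (real ^ 'p) \<times> real. fst z - posterior_shrinkage n a b z *\<^sub>R fst z"
  have eq: "?\<delta> z = ?d z" if "z \<in> space obs" for z
    using gen_bayes_prior[OF ab n, of "snd z" "fst z"] that by (simp add: space_obs)
  have d: "?d \<in> borel_measurable obs" by measurable
  have m: "?\<delta> \<in> borel_measurable obs"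
    using d by (subst measurable_cong[OF eq]) auto
  have risk_cong: "risk n \<theta> \<eta> \<delta>1 = risk n \<theta> \<eta> \<delta>2"
    if "AE z in obs. \<delta>1 z = \<delta>2 z" "\<delta>1 \<in> borel_measurable obs" "\<delta>2 \<in> borel_measurable obs"
    for \<theta> \<eta> and \<delta>1 \<delta>2 :: "(real ^ 'p) \<times> real \<Rightarrow> real ^ 'p"
    unfolding risk_eq_nn_integral_obs[OF that(2)] risk_eq_nn_integral_obs[OF that(3)]
    using that(1) by (intro nn_integral_cong_AE) (auto elim: eventually_mono)
  have d\<delta>: "risk n \<theta> \<eta> ?d = risk n \<theta> \<eta> ?\<delta>" for \<theta> \<eta>
    using eq by (intro risk_cong d m AE_I2) simp
  have "\<not> dominates n \<delta>' ?\<delta>" if "estimator \<delta>'" for \<delta>' :: "(real ^ 'p) \<times> real \<Rightarrow> real ^ 'p"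
  proof
    assume dom: "dominates n \<delta>' ?\<delta>"
    have m': "\<delta>' \<in> borel_measurable obs" using that by (simp add: estimator_iff_measurable_obs)
    have "AE z in obs. \<delta>' z = ?d z"
      using dom by (intro AE_eq_of_risk_le[OF ab n m']) (auto simp: dominates_def d\<delta>)
    then have "risk n \<theta> \<eta> \<delta>' = risk n \<theta> \<eta> ?d" for \<theta> \<eta>
      by (rule risk_cong[OF _ m' d])
    then show False using dom by (auto simp: dominates_def d\<delta>)
  qed
  then show ?thesis
    unfolding admissible_def using m by (auto simp: estimator_iff_measurable_obs)
qed

end
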